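(* Let $\alpha\geq \tfrac12$ and let $f\in L^1(\mathbb{R}_+,\omega_\alpha)$ be such that its Fourier transform satisfies $\hat f(\lambda)\geq 0$ for all $\lambda\in\mathbb{R}_+$. Then the following statements are equivalent: (i) $f$ is square integrable on a neighborhood of $0$, i.e. there is $\delta>0$ with $\int_0^\delta |f|^2\,d\omega_\alpha<\infty$; (ii) $\hat f\in (L^1,\ell^2)(\mathbb{R}_+,*_\alpha)$; (iii) $f\in (L^2,\ell^\infty)(\mathbb{R}_+,*_\alpha)$.
   Context: Fix $\alpha\geq\tfrac12$. The Bessel–Kingman hypergroup is $(\mathbb{R}_+,*_\alpha)$, $\mathbb{R}_+=[0,\infty)$, with identity involution, Haar measure $\omega_\alpha(dz)=z^{2\alpha+1}dz$, and convolution of point masses given for $x,y>0$ by $\varepsilon_x*_\alpha\varepsilon_y(f)=\int_{|x-y|}^{x+y}K_\alpha(x,y,z)f(z)z^{2\alpha+1}dz$, where $K_\alpha(x,y,z)=C_\Gamma\,\frac{[(z^2-(x-y)^2)((x+y)^2-z^2)]^{\alpha-1/2}}{(xyz)^{2\alpha}}$, $C_\Gamma=\frac{\Gamma(\alpha+1)}{\Gamma(1/2)\Gamma(\alpha+1/2)2^{2\alpha-1}}$, and $\varepsilon_0$ is the identity. The characters are $\chi_\lambda(x)=j_\alpha(\lambda x)$, $\lambda\in\mathbb{R}_+$, where $j_\alpha(x)=\sum_{k\ge0}\frac{(-1)^k\Gamma(\alpha+1)}{2^{2k}k!\Gamma(\alpha+k+1)}x^{2k}$; the dual is identified with $\mathbb{R}_+$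 via $\lambda\mapsto\chi_\lambda$, and the Fourier transform of $f\in L^1(\omega_\alpha)$ is $\hat f(\lambda)=\int_{\mathbb{R}_+} f(x)\chi_\lambda(x)\,d\omega_\alpha(x)$. Let $I_n=[n-1,n)$ and $\omega_n=\omega_\alpha(I_n)$ for $n\ge1$. For $1\le p,q<\infty$ the discrete amalgam norm is $\|f\|_{p,q}=\big(\sum_{n\ge1}\omega_n\big(\frac1{\omega_n}\int_{I_n}|f|^p d\omega_\alpha\big)^{q/p}\big)^{1/q}$, with the usual modifications $\|f\|_{\infty,q}=(\sum_n\omega_n\sup_{I_n}|f|^q)^{1/q}$, $\|f\|_{p,\infty}=\sup_n(\frac1{\omega_n}\int_{I_n}|f|^pd\omega_\alpha)^{1/p}$, $\|f\|_{\infty,\infty}=\|f\|_\infty$; $(L^p,\ell^q)(\mathbb{R}_+,*_\alpha)$ is the space of measurable $f$ with $\|f\|_{p,q}<\infty$. *)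

theory Defs
  imports "HOL-Analysis.Analysis"
begin

text \<open>Haar measure of the Bessel-Kingman hypergroup on R_+ = [0,\<infinity>):
  omega_alpha(dz) = z^(2 alpha + 1) dz, as a measure on the reals concentrated on [0,\<infinity>).\<close>
definition bk_measure :: "real \<Rightarrow> real measure" where
  "bk_measure \<alpha> = density lborel (\<lambda>z. ennreal (indicator {0..} z * z powr (2 * \<alpha> + 1)))"

definition bessel_j :: "real \<Rightarrow> real \<Rightarrow> real" where
  "bessel_j \<alpha> x = (\<Sum>k. ((-1) ^ k * Gamma (\<alpha> + 1)
      / (2 ^ (2 * k) * fact k * Gamma (\<alpha> + real k + 1))) * x ^ (2 * k))"

definition bk_fourier :: "real \<Rightarrow> (real \<Rightarrow> complex) \<Rightarrow> real \<Rightarrow> complex" where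
  "bk_fourier \<alpha> f s = (LINT x|bk_measure \<alpha>. f x * complex_of_real (bessel_j \<alpha> (s * x)))"

definition bk_I :: "nat \<Rightarrow> real set" where
  "bk_I n = {real n - 1 ..< real n}"

definition bk_omega :: "real \<Rightarrow> nat \<Rightarrow> real" where
  "bk_omega \<alpha> n = measure (bk_measure \<alpha>) (bk_I n)"

definition amalgam_L1_l2 :: "real \<Rightarrow> (real \<Rightarrow> 'b::real_normed_vector) \<Rightarrow> bool" where
  "amalgam_L1_l2 \<alpha> g \<longleftrightarrow> g \<in> borel_measurable borel \<and>
     (\<Sum>n. ennreal (bk_omega \<alpha> (Suc n)) *
        (ennreal (1 / bk_omega \<alpha> (Suc n)) *
          (\<integral>\<^sup>+ x. ennreal (norm (g x)) * indicator (bk_I (Suc n)) x \<partial>bk_measure \<alpha>)) ^ 2) < \<infinity>"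

text \<open>(L^2, l^\<infinity>) amalgam: sup_{n\<ge>1} ((1/omega_n) int_{I_n} |g|^2 d omega)^(1/2) < \<infinity>,
  equivalently (the square root being monotone on [0,\<infinity>]) the sup of the squares is finite.\<close>
definition amalgam_L2_linf :: "real \<Rightarrow> (real \<Rightarrow> 'b::real_normed_vector) \<Rightarrow> bool" where
  "amalgam_L2_linf \<alpha> g \<longleftrightarrow> g \<in> borel_measurable borel \<and>
     (SUP n. (ennreal (1 / bk_omega \<alpha> (Suc n)) *
        (\<integral>\<^sup>+ x. ennreal (norm (g x) ^ 2) * indicator (bk_I (Suc n)) x \<partial>bk_measure \<alpha>))) < \<infinity>"

end

theory Submission
  imports Defs
begin

text \<open>
  The product formula for \<open>j\<^sub>\<alpha>\<close> turns \<open>\<integral> g(x) j\<^sub>\<alpha>(l x) j\<^sub>\<alpha>(m x) d\<omega>(x)\<close> into an average of the transform of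
  \<open>g\<close> over chord lengths between \<open>\<bar>l - m\<bar>\<close> and \<open>l + m\<close>. For a Gaussian \<open>g\<close> this shows that characters
  from different unit cells are almost orthogonal. Let \<open>S\<close> be the transform of the restriction of
  \<open>F\<close>, the transform of \<open>f\<close>, to \<open>[1, R)\<close>, and let \<open>A\<close> be the sum of \<open>(\<integral> F d\<omega>)\<^sup>2 / \<omega>\<^sub>k\<close> over the cells in \<open>[1, R)\<close>. Schur's test
  then gives \<open>\<integral> exp(- s x\<^sup>2) S\<^sup>2 d\<omega> \<le> C s\<^bsup>-1/2\<^esup> A\<close> for \<open>0 < s \<le> 1\<close>.

  (i) implies (ii): there is a bounded \<open>h\<close> supported near \<open>0\<close> whose transform is the square
  \<open>j\<^sub>\<alpha>\<^sub>+\<^sub>2(e z)\<^sup>2\<close>. As \<open>F \<ge> 0\<close>, inversion shows that \<open>\<integral> f h S d\<omega>\<close> dominates a multiple of \<open>A\<close>,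
  while Cauchy-Schwarz bounds it by a multiple of \<open>A\<^bsup>1/2\<^esup>\<close>.

  (ii) implies (iii): for linear combinations \<open>G\<close> of Gaussians, Parseval's formula is explicit and bounds
  \<open>\<integral> f G d\<omega>\<close> by the \<open>L\<^sup>1\<close> norm and a weighted \<open>L\<^sup>2\<close> norm of \<open>G\<close>. Such \<open>G\<close> approximate
  truncations of \<open>f\<close> to a cell, so the pairing becomes the square integral of \<open>f\<close> over that cell.
\<close>

section \<open>Bessel functions and the Gegenbauer measure\<close>

text \<open>The only transform computed by a full closed form at the start is that of a Gaussian,
  again a Gaussian; Parseval's formula, uniqueness and inversion all grow out of it. As
  \<open>F\<close> is not known to be integrable, it is truncated and every bound is uniform in
  \<open>R\<close>. The factor s^(-1/2) comes from the law of cosines: a squared chord equals (l -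
  m)^2 + 2 l m (1 - t), so the Gaussian exp(- chord^2 / (4 s)) splits into decay in l - m and a
  factor concentrated at t = 1 with average of order (l m / s)^(-(\<alpha> + 1/2)). The
  normalization s^(-(\<alpha> + 1)) leaves s^(-1/2), and (l m)^(-(\<alpha> + 1/2)) is comparable to
  the inverse square roots of the two cell measures. For the cell [n, n + 1) the choice s = 1 / (n +
  1)^2 keeps exp(s x^2) bounded there, and the loss s^(-1/2) = n + 1 is at most a multiple of the
  measure of the cell. Cauchy-Schwarz appears as a b <= t a^2 / 2 + b^2 / (2 t), with t such that
  half of the quantity sought is absorbed; truncation makes that quantity finite beforehand. From
  (iii) to (i) only the first cell is needed.\<close>

definition bessel_coeff :: "real \<Rightarrow> nat \<Rightarrow> real" where
  "bessel_coeff \<alpha> k = (-1) ^ k / (4 ^ k * fact k * pochhammer (\<alpha> + 1) k)"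

text \<open>
  The convolution \<open>\<epsilon>\<^sub>x * \<epsilon>\<^sub>y\<close> of point masses is the image of this probability measure under
  \<open>t \<mapsto> sqrt (x\<^sup>2 + y\<^sup>2 - 2 x y t)\<close>; working in the variable \<open>t\<close> avoids the kernel \<open>K\<^sub>\<alpha>\<close>.
\<close>

definition gegen_norm :: "real \<Rightarrow> real" where
  "gegen_norm \<alpha> = (LINT t|lborel. indicator {-1..1} t * (1 - t\<^sup>2) powr (\<alpha> - 1/2))"

definition gegen_measure :: "real \<Rightarrow> real measure" where
  "gegen_measure \<alpha> = density lborel
     (\<lambda>t. ennreal (indicator {-1..1} t * (1 - t\<^sup>2) powr (\<alpha> - 1/2) / gegen_norm \<alpha>))"

lemma sets_gegen_measure [simp, measurable_cong]: "sets (gegen_measure \<alpha>) = sets borel"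
  by (simp add: gegen_measure_def)

lemma space_gegen_measure [simp]: "space (gegen_measure \<alpha>) = UNIV"
  by (simp add: gegen_measure_def)

lemma sets_bk_measure [simp, measurable_cong]: "sets (bk_measure \<alpha>) = sets borel"
  by (simp add: bk_measure_def)

lemma space_bk_measure [simp]: "space (bk_measure \<alpha>) = UNIV"
  by (simp add: bk_measure_def)

locale bessel_kingman =
  fixes \<alpha> :: real
  assumes half_le: "1/2 \<le> \<alpha>"
begin

abbreviation \<mu> :: "real measure" where "\<mu> \<equiv> bk_measure \<alpha>"

abbreviation \<nu> :: "real measure" where "\<nu> \<equiv> gegen_measure \<alpha>"

lemma pochhammer_pos' [simp]: "0 < pochhammer (\<alpha> + 1) k"
  using half_le by (intro pochhammer_pos) simp

lemma pochhammer_nonzero [simp]: "pochhammer (\<alpha> + 1) k \<noteq> 0"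
  using pochhammer_pos'[of k] by linarith

lemma pochhammer_ge_1: "1 \<le> pochhammer (\<alpha> + 1) k"
proof (induction k)
  case (Suc k)
  have "1 * 1 \<le> pochhammer (\<alpha> + 1) k * (\<alpha> + 1 + real k)"
    using Suc half_le by (intro mult_mono) auto
  then show ?case by (simp add: pochhammer_Suc)
qed simp

lemma bessel_j_eq: "bessel_j \<alpha> x = (\<Sum>k. bessel_coeff \<alpha> k * x ^ (2 * k))"
proof -
  have "(-1) ^ k * Gamma (\<alpha> + 1) / (2 ^ (2 * k) * fact k * Gamma (\<alpha> + real k + 1)) = bessel_coeff \<alpha> k" for k
  proof -
    have "\<alpha> + 1 \<notin> \<int>\<^sub>\<le>\<^sub>0" using half_le by (auto dest: nonpos_Ints_nonpos)
    then have "pochhammer (\<alpha> + 1) k = Gamma (\<alpha> + 1 + real k) / Gamma (\<alpha> + 1)"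
      by (rule pochhammer_Gamma)
    moreover have "Gamma (\<alpha> + 1) > 0" using half_le by (intro Gamma_real_pos) simp
    ultimately show ?thesis
      by (simp add: bessel_coeff_def power_mult add_ac)
  qed
  then show ?thesis by (simp add: bessel_j_def)
qed

lemma abs_bessel_coeff_le: "\<bar>bessel_coeff \<alpha> k\<bar> \<le> (1/4) ^ k / fact k"
proof -
  have "\<bar>bessel_coeff \<alpha> k\<bar> = (1/4) ^ k / fact k * (1 / pochhammer (\<alpha> + 1) k)"
    by (simp add: bessel_coeff_def abs_mult power_divide less_imp_le)
  also have "\<dots> \<le> (1/4) ^ k / fact k * 1"
    using pochhammer_ge_1[of k] by (intro mult_left_mono) (auto simp: divide_le_eq_1)
  finally show ?thesis by simp
qed

text \<open>The Pochhammer symbols are at least 1, so the exponential series in |y| / 4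
  dominates.\<close>

lemma summable_abs_bessel: "summable (\<lambda>k. \<bar>bessel_coeff \<alpha> k\<bar> * \<bar>y\<bar> ^ k)"
proof (rule summable_comparison_test')
  show "summable (\<lambda>k. (\<bar>y\<bar>/4) ^ k /\<^sub>R fact k)" by (rule summable_exp_generic)
  fix k
  have "\<bar>bessel_coeff \<alpha> k\<bar> * \<bar>y\<bar> ^ k \<le> (1/4) ^ k / fact k * \<bar>y\<bar> ^ k"
    by (intro mult_right_mono abs_bessel_coeff_le) auto
  also have "\<dots> = (\<bar>y\<bar>/4) ^ k /\<^sub>R fact k"
    unfolding power_divide real_scaleR_def by (simp only: inverse_eq_divide power_one mult_1_left times_divide_eq_left times_divide_eq_right divide_divide_eq_left mult.commute)
  finally show "norm (\<bar>bessel_coeff \<alpha> k\<bar> * \<bar>y\<bar> ^ k) \<le> (\<bar>y\<bar>/4) ^ k /\<^sub>R fact k"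
    by (simp only: real_norm_def abs_mult abs_abs power_abs)
qed

lemma summable_bessel: "summable (\<lambda>k. bessel_coeff \<alpha> k * y ^ k)"
  by (rule summable_rabs_cancel) (use summable_abs_bessel[of y] in \<open>simp only: abs_mult power_abs\<close>)

lemma isCont_bessel_j [continuous_intros]: "isCont (bessel_j \<alpha>) x"
proof -
  have "isCont (\<lambda>y. \<Sum>k. bessel_coeff \<alpha> k * y ^ k) y" for y
    by (rule isCont_powser[of _ "\<bar>y\<bar> + 1"]) (auto intro: summable_bessel)
  moreover have "isCont (\<lambda>x::real. x\<^sup>2) x" by (intro continuous_intros)
  ultimately have "isCont (\<lambda>x. \<Sum>k. bessel_coeff \<alpha> k * (x\<^sup>2) ^ k) x"
    by (rule isCont_o2[where f="\<lambda>x. x\<^sup>2" and g="\<lambda>y. \<Sum>k. bessel_coeff \<alpha> k * y ^ k", rotated])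
  then show ?thesis by (simp add: bessel_j_eq[abs_def] power_mult)
qed

lemma continuous_on_bessel_j: "continuous_on A (bessel_j \<alpha>)"
  by (intro continuous_at_imp_continuous_on ballI isCont_bessel_j)

lemma measurable_bessel_j [measurable]: "bessel_j \<alpha> \<in> borel_measurable borel"
  by (intro borel_measurable_continuous_onI continuous_on_bessel_j)

lemma bessel_j_minus: "bessel_j \<alpha> (- x) = bessel_j \<alpha> x"
  by (simp add: bessel_j_eq)

section \<open>Moments of the Gegenbauer measure\<close>

definition gegen_moment :: "nat \<Rightarrow> real" where
  "gegen_moment l = (LINT t|\<nu>. t ^ l)"

definition gegen_weight :: "real \<Rightarrow> real" where
  "gegen_weight t = indicator {-1..1} t * (1 - t\<^sup>2) powr (\<alpha> - 1/2)"

lemma gegen_weight_nonneg: "0 \<le> gegen_weight t"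
  by (simp add: gegen_weight_def)

lemma gegen_weight_le: "gegen_weight t \<le> indicator {-1..1} t"
proof (cases "t \<in> {-1..1}")
  case True
  then have "0 \<le> 1 - t\<^sup>2" "1 - t\<^sup>2 \<le> 1" by (auto simp: abs_square_le_1 abs_le_iff)
  then have "(1 - t\<^sup>2) powr (\<alpha> - 1/2) \<le> 1" using half_le by (intro powr_le1) auto
  then show ?thesis using True by (simp add: gegen_weight_def)
qed (simp add: gegen_weight_def)

lemma measurable_gegen_weight [measurable]: "gegen_weight \<in> borel_measurable borel"
  unfolding gegen_weight_def[abs_def] by measurable

lemma integrable_power_gegen_weight: "integrable lborel (\<lambda>t. t ^ l * gegen_weight t)"
proof (rule Bochner_Integration.integrable_bound)
  show "integrable lborel (indicator {-1..1} :: real \<Rightarrow> real)" by simp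
  show "AE t in lborel. norm (t ^ l * gegen_weight t) \<le> norm (indicator {-1..1} t :: real)"
  proof (rule AE_I2)
    fix t :: real
    show "norm (t ^ l * gegen_weight t) \<le> norm (indicator {-1..1} t :: real)"
    proof (cases "t \<in> {-1..1}")
      case True
      then have "\<bar>t\<bar> ^ l \<le> 1" by (intro power_le_one) auto
      then have "\<bar>t\<bar> ^ l * gegen_weight t \<le> 1 * indicator {-1..1} t"
        using gegen_weight_le[of t] gegen_weight_nonneg[of t] by (intro mult_mono) auto
      then show ?thesis using gegen_weight_nonneg[of t] by (simp add: abs_mult power_abs)
    qed (simp add: gegen_weight_def)
  qed
qed measurable

lemma gegen_norm_eq: "gegen_norm \<alpha> = (LINT t|lborel. gegen_weight t)"
  by (simp add: gegen_norm_def gegen_weight_def)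

lemma gegen_norm_pos: "0 < gegen_norm \<alpha>"
proof -
  have int: "integrable lborel gegen_weight" using integrable_power_gegen_weight[of 0] by simp
  have "0 \<le> gegen_norm \<alpha>" unfolding gegen_norm_eq by (intro integral_nonneg_AE) (simp add: gegen_weight_nonneg)
  moreover have "gegen_norm \<alpha> \<noteq> 0"
  proof
    assume "gegen_norm \<alpha> = 0"
    then have "AE t in lborel. gegen_weight t = 0"
      using integral_nonneg_eq_0_iff_AE[OF int] gegen_weight_nonneg by (simp add: gegen_norm_eq)
    then have "AE t in lborel. \<not> (t \<in> {-1<..<1::real})"
    proof (rule AE_mp, intro AE_I2 impI notI)
      fix t :: real assume "gegen_weight t = 0" "t \<in> {-1<..<1}"
      then have "1 - t\<^sup>2 > 0" by (auto simp: abs_square_less_1 abs_less_iff)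
      with \<open>gegen_weight t = 0\<close> \<open>t \<in> _\<close> show False by (auto simp: gegen_weight_def)
    qed
    then have "emeasure lborel {-1<..<1::real} = 0"
      by (subst (asm) AE_iff_measurable[of "{-1<..<1}"]) auto
    then show False by simp
  qed
  ultimately show ?thesis by simp
qed

lemma gegen_measure_eq: "\<nu> = density lborel (\<lambda>t. ennreal (gegen_weight t / gegen_norm \<alpha>))"
  by (simp add: gegen_measure_def gegen_weight_def)

lemma emeasure_gegen_UNIV: "emeasure \<nu> UNIV = 1"
proof -
  have int: "integrable lborel gegen_weight" using integrable_power_gegen_weight[of 0] by simp
  have "emeasure \<nu> UNIV = (\<integral>\<^sup>+ t. ennreal (gegen_weight t / gegen_norm \<alpha>) \<partial>lborel)"
    by (simp add: gegen_measure_eq emeasure_density)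
  also have "\<dots> = ennreal (LINT t|lborel. gegen_weight t / gegen_norm \<alpha>)"
    using int gegen_norm_pos gegen_weight_nonneg by (intro nn_integral_eq_integral) (auto intro!: divide_nonneg_pos)
  also have "\<dots> = 1" using gegen_norm_pos by (simp add: gegen_norm_eq[symmetric])
  finally show ?thesis .
qed

sublocale gegen: finite_measure \<nu>
  by standard (simp add: emeasure_gegen_UNIV)

lemma measure_gegen_UNIV: "measure \<nu> UNIV = 1"
  by (simp add: measure_def emeasure_gegen_UNIV)

lemma AE_gegen: "AE t in \<nu>. t \<in> {-1..1}"
  unfolding gegen_measure_eq by (subst AE_density) (auto simp: gegen_weight_def indicator_def)

lemma integral_gegen:
  fixes g :: "real \<Rightarrow> real"
  assumes [measurable]: "g \<in> borel_measurable borel"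
  shows "(LINT t|\<nu>. g t) = (LINT t|lborel. gegen_weight t * g t) / gegen_norm \<alpha>"
  unfolding gegen_measure_eq
  using gegen_norm_pos gegen_weight_nonneg
  by (subst integral_density) (auto intro!: divide_nonneg_pos)

lemma gegen_integrable_bounded:
  fixes g :: "real \<Rightarrow> real"
  assumes [measurable]: "g \<in> borel_measurable borel" and "\<And>t. t \<in> {-1..1} \<Longrightarrow> \<bar>g t\<bar> \<le> B"
  shows "integrable \<nu> g"
  using AE_gegen assms(2) by (intro gegen.integrable_const_bound[where B=B]) (auto elim: eventually_mono)

lemma gegen_moment_0: "gegen_moment 0 = 1"
  by (simp add: gegen_moment_def measure_gegen_UNIV)

lemma gegen_weight_minus: "gegen_weight (- t) = gegen_weight t"
  by (auto simp: gegen_weight_def split: split_indicator)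

lemma gegen_moment_odd:
  assumes "odd l" shows "gegen_moment l = 0"
proof -
  have "(LINT t|lborel. gegen_weight t * t ^ l) = (LINT t|lborel. gegen_weight (- t) * (- t) ^ l)"
    by (subst lborel_integral_real_affine[where c="-1" and t=0]) auto
  also have "\<dots> = - (LINT t|lborel. gegen_weight t * t ^ l)"
    using assms by (simp add: gegen_weight_minus)
  finally show ?thesis by (simp add: gegen_moment_def integral_gegen)
qed

text \<open>Integrate the derivative of t^(l + 1) (1 - t^2)^(\<alpha> + 1/2) over [-1, 1]; the
  boundary values vanish. Differentiability is used only in the open interval, continuity at the
  endpoints.\<close>

lemma gegen_moment_rec: "(real l + 2 * \<alpha> + 2) * gegen_moment (l + 2) = (real l + 1) * gegen_moment l"
proof -
  let ?a = "\<alpha> - 1/2"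
  define F where "F t = t ^ (l + 1) * (1 - t\<^sup>2) powr (?a + 1)" for t :: real
  define G where "G t = (real l + 1) * t ^ l * (1 - t\<^sup>2) powr ?a
    - (real l + 2 * \<alpha> + 2) * t ^ (l + 2) * (1 - t\<^sup>2) powr ?a" for t :: real
  have der: "(F has_vector_derivative G t) (at t)" if t: "t \<in> {-1<..<1}" for t
  proof -
    have pos: "1 - t\<^sup>2 > 0" using t by (auto simp: abs_square_less_1 abs_less_iff)
    have 1: "((\<lambda>t. t ^ (l + 1)) has_real_derivative real (l + 1) * t ^ l) (at t)"
      using DERIV_pow[of "l + 1" t] by simp
    have 2: "((\<lambda>t. 1 - t\<^sup>2) has_real_derivative - 2 * t) (at t)"
      by (auto intro!: derivative_eq_intros)
    have 3: "((\<lambda>t. (1 - t\<^sup>2) powr (?a + 1)) has_real_derivative (?a + 1) * (1 - t\<^sup>2) powr ?a * (- 2 * t)) (at t)"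
      using DERIV_chain2[OF has_real_derivative_powr[OF pos, of "?a + 1"] 2] by simp
    have "(F has_real_derivative (real (l+1) * t ^ l * (1 - t\<^sup>2) powr (?a + 1)
        + t ^ (l+1) * ((?a + 1) * (1 - t\<^sup>2) powr ?a * (- 2 * t)))) (at t)"
      unfolding F_def using DERIV_mult[OF 1 3] by (simp only: mult.commute)
    also have "(1 - t\<^sup>2) powr (?a + 1) = (1 - t\<^sup>2) powr ?a * (1 - t\<^sup>2)"
      unfolding powr_add using pos by simp
    also have "real (l+1) * t ^ l * ((1 - t\<^sup>2) powr ?a * (1 - t\<^sup>2)) + t ^ (l+1) * ((?a + 1) * (1 - t\<^sup>2) powr ?a * (- 2 * t)) = G t"
      by (simp add: G_def algebra_simps power2_eq_square)
    finally show ?thesis by (simp add: has_real_derivative_iff_has_vector_derivative)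
  qed
  have "continuous_on {-1..1} F"
    unfolding F_def using half_le
    by (intro continuous_intros continuous_on_powr') (auto simp: abs_square_le_1 abs_le_iff)
  then have "(G has_integral (F 1 - F (-1))) {-1..1}"
    using der by (intro fundamental_theorem_of_calculus_interior) auto
  then have "(G has_integral 0) {-1..1}" by (simp add: F_def)
  then have 1: "((\<lambda>t. if t \<in> {-1..1} then G t else 0) has_integral 0) UNIV"
    by (subst has_integral_restrict_UNIV)
  have eq: "(\<lambda>t. if t \<in> {-1..1} then G t else 0) = (\<lambda>t. (real l + 1) * (t ^ l * gegen_weight t)
     - (real l + 2 * \<alpha> + 2) * (t ^ (l + 2) * gegen_weight t))"
    by (auto simp: fun_eq_iff G_def gegen_weight_def)
  have int: "integrable lborel (\<lambda>t. if t \<in> {-1..1} then G t else 0)"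
    unfolding eq
    by (intro Bochner_Integration.integrable_diff integrable_mult_right integrable_power_gegen_weight)
  have "(LINT t|lborel. (if t \<in> {-1..1} then G t else 0)) = 0"
    using has_integral_integral_lborel[OF int] 1 by (rule has_integral_unique)
  then have "(real l + 1) * (LINT t|lborel. t ^ l * gegen_weight t)
     - (real l + 2 * \<alpha> + 2) * (LINT t|lborel. t ^ (l + 2) * gegen_weight t) = 0"
    unfolding eq using integrable_power_gegen_weight[of l] integrable_power_gegen_weight[of "l+2"]
    by (subst (asm) Bochner_Integration.integral_diff) (auto simp del: power_add_numeral power_Suc)
  then show ?thesis
    using gegen_norm_pos by (simp add: gegen_moment_def integral_gegen mult.commute field_simps del: power_Suc)
qed

lemma gegen_moment_even:
  "gegen_moment (2 * k) = fact (2 * k) / (4 ^ k * fact k * pochhammer (\<alpha> + 1) k)"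
proof (induction k)
  case 0 then show ?case by (simp add: gegen_moment_0)
next
  case (Suc k)
  have nz: "2 * real k + 2 * \<alpha> + 2 \<noteq> 0" "\<alpha> + 1 + real k \<noteq> 0" using half_le by auto
  have "gegen_moment (2 * Suc k) = (2 * real k + 1) / (2 * real k + 2 * \<alpha> + 2) * gegen_moment (2 * k)"
    using gegen_moment_rec[of "2 * k"] nz by (simp add: field_simps)
  also have "\<dots> = (2 * real k + 1) / (2 * (\<alpha> + 1 + real k)) *
      (fact (2 * k) / (4 ^ k * fact k * pochhammer (\<alpha> + 1) k))"
    unfolding Suc by (simp add: ring_distribs add_ac)
  also have "\<dots> = ((2 * real k + 2) * (2 * real k + 1) * fact (2 * k)) / ((2 * real k + 2) * (2 * (\<alpha> + 1 + real k)) *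
       (4 ^ k * fact k * pochhammer (\<alpha> + 1) k))"
    by (simp add: mult.assoc)
  also have "(2 * real k + 2) * (2 * real k + 1) * fact (2 * k) = fact (2 * Suc k)"
    by (simp add: algebra_simps)
  also have "(2 * real k + 2) * (2 * (\<alpha> + 1 + real k)) * (4 ^ k * fact k * pochhammer (\<alpha> + 1) k)
     = 4 ^ Suc k * fact (Suc k) * pochhammer (\<alpha> + 1) (Suc k)"
    by (simp add: pochhammer_Suc algebra_simps)
  finally show ?case .
qed

end

context bessel_kingman
begin

subsection \<open>Product formula and Poisson integral\<close>

text \<open>The Chu-Vandermonde identity with upper arguments n and \<alpha> + i: each quotient of
  Pochhammer symbols is the generalized binomial coefficient of \<alpha> + i over i - j.\<close>

lemma pochhammer_Vandermonde:
  "(\<Sum>j\<le>i. real (n choose j) * (pochhammer (\<alpha> + 1) i / (pochhammer (\<alpha> + 1) j * fact (i - j))))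
     = pochhammer (\<alpha> + 1) (n + i) / (pochhammer (\<alpha> + 1) n * fact i)"
proof -
  have 1: "(\<alpha> + real i) gchoose (i - j) = pochhammer (\<alpha> + 1) i / (pochhammer (\<alpha> + 1) j * fact (i - j))"
    if "j \<le> i" for j
  proof -
    have "(\<alpha> + real i) gchoose (i - j) = pochhammer (\<alpha> + 1 + real j) (i - j) / fact (i - j)"
      using that by (simp add: gbinomial_pochhammer' of_nat_diff add_ac)
    moreover have "pochhammer (\<alpha> + 1) i = pochhammer (\<alpha> + 1) j * pochhammer (\<alpha> + 1 + real j) (i - j)"
      using that by (rule pochhammer_product)
    ultimately show ?thesis using pochhammer_pos'[of j] by simp
  qed
  have "(\<Sum>j\<le>i. real (n choose j) * (pochhammer (\<alpha> + 1) i / (pochhammer (\<alpha> + 1) j * fact (i - j))))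
     = (\<Sum>j\<in>{0..i}. (real n gchoose j) * ((\<alpha> + real i) gchoose (i - j)))"
    by (intro sum.cong) (auto simp: 1 binomial_gbinomial)
  also have "\<dots> = (real n + (\<alpha> + real i)) gchoose i" by (rule gbinomial_Vandermonde)
  also have "\<dots> = pochhammer (\<alpha> + 1 + real n) i / fact i"
    by (simp add: gbinomial_pochhammer' add_ac)
  also have "\<dots> = pochhammer (\<alpha> + 1) (n + i) / (pochhammer (\<alpha> + 1) n * fact i)"
    using pochhammer_pos'[of n] by (simp add: pochhammer_product')
  finally show ?thesis .
qed

lemma integrable_gegen_power: "integrable \<nu> (\<lambda>t. t ^ l)"
proof (rule gegen_integrable_bounded)
  show "\<bar>t ^ l\<bar> \<le> 1" if "t \<in> {-1..1}" for t :: real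
    unfolding power_abs using that by (intro power_le_one) auto
qed measurable

text \<open>Multiplied by \<open>bessel_coeff \<alpha> k\<close>, the right-hand side is the k-th
  term of the Cauchy product of two Bessel series. Expanding in powers of t, only the even moments
  survive; regrouping by powers of x^2 leaves an inner Vandermonde sum.\<close>

lemma gegen_integral_binomial:
  "(LINT t|\<nu>. (x\<^sup>2 + y\<^sup>2 - 2 * x * y * t) ^ k) =
     (\<Sum>i\<le>k. fact k * pochhammer (\<alpha> + 1) k / (fact i * pochhammer (\<alpha> + 1) i * fact (k - i) * pochhammer (\<alpha> + 1) (k - i))
        * (x\<^sup>2) ^ i * (y\<^sup>2) ^ (k - i))"
proof -
  let ?X = "x\<^sup>2" and ?Y = "y\<^sup>2" and ?p = "pochhammer (\<alpha> + 1)"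
  let ?T = "\<lambda>j l. fact k / (fact j * ?p j * fact l * fact (k - 2 * j - l)) * ?X ^ (j + l) * ?Y ^ (k - (j + l))"
  let ?S = "\<lambda>i j. fact k / (fact j * ?p j * fact (i - j) * fact (k - i - j)) * ?X ^ i * ?Y ^ (k - i)"
  let ?M = "\<lambda>l. of_nat (k choose l) * (- 2 * x * y) ^ l * (?X + ?Y) ^ (k - l) * gegen_moment l"
  have "(x\<^sup>2 + y\<^sup>2 - 2 * x * y * t) ^ k = (\<Sum>l\<le>k. of_nat (k choose l) * (- 2 * x * y) ^ l * (?X + ?Y) ^ (k - l) * t ^ l)" for t
  proof -
    have "(x\<^sup>2 + y\<^sup>2 - 2 * x * y * t) ^ k = ((- 2 * x * y) * t + (?X + ?Y)) ^ k" by (simp add: algebra_simps)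
    then show ?thesis by (simp only: binomial_ring power_mult_distrib mult_ac)
  qed
  then have "(LINT t|\<nu>. (x\<^sup>2 + y\<^sup>2 - 2 * x * y * t) ^ k) =
      (\<Sum>l\<le>k. ?M l)"
    using integrable_gegen_power by (simp add: gegen_moment_def)
  also have "\<dots> = (\<Sum>l\<in>(\<lambda>j. 2 * j) ` {j. 2 * j \<le> k}. ?M l)"
  proof (rule sum.mono_neutral_right)
    show "\<forall>l\<in>{..k} - (\<lambda>j. 2 * j) ` {j. 2 * j \<le> k}. ?M l = 0"
    proof
      fix l assume "l \<in> {..k} - (\<lambda>j. 2 * j) ` {j. 2 * j \<le> k}"
      then have "odd l" by (auto elim!: evenE)
      then show "?M l = 0"
        by (simp add: gegen_moment_odd)
    qed
  qed auto
  also have "\<dots> = (\<Sum>j | 2 * j \<le> k. ?M (2 * j))"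
    by (subst sum.reindex) (auto simp: inj_on_def)
  also have "\<dots> = (\<Sum>j | 2 * j \<le> k. \<Sum>l\<le>k - 2 * j. ?T j l)"
  proof (rule sum.cong[OF refl])
    fix j assume "j \<in> {j. 2 * j \<le> k}"
    then have j: "2 * j \<le> k" by simp
    have "?M (2 * j)
       = fact k / (fact j * ?p j * fact (k - 2 * j)) * (?X * ?Y) ^ j * (?X + ?Y) ^ (k - 2 * j)"
    proof -
      have "(- 2 * x * y) ^ (2 * j) = 4 ^ j * (?X * ?Y) ^ j"
        by (simp add: power_mult power_mult_distrib)
      then show ?thesis using j
        by (simp add: binomial_fact gegen_moment_even) (simp add: mult_ac)
    qed
    also have "(?X + ?Y) ^ (k - 2 * j) = (\<Sum>l\<le>k - 2 * j. of_nat ((k - 2 * j) choose l) * ?X ^ l * ?Y ^ (k - 2 * j - l))"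
      by (rule binomial_ring)
    also have "fact k / (fact j * ?p j * fact (k - 2 * j)) * (?X * ?Y) ^ j * \<dots> =
       (\<Sum>l\<le>k - 2 * j. ?T j l)"
      unfolding sum_distrib_left
    proof (rule sum.cong[OF refl])
      fix l assume "l \<in> {..k - 2 * j}"
      then have l: "l \<le> k - 2 * j" by simp
      have "k - (j + l) = j + (k - 2 * j - l)" using l j by simp
      then have "?Y ^ (k - (j + l)) = ?Y ^ j * ?Y ^ (k - 2 * j - l)" by (simp add: power_add)
      then show "fact k / (fact j * ?p j * fact (k - 2 * j)) * (?X * ?Y) ^ j * (of_nat ((k - 2 * j) choose l) * ?X ^ l * ?Y ^ (k - 2 * j - l))
         = ?T j l"
        using l by (simp add: binomial_fact power_mult_distrib power_add) (simp add: mult_ac)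
    qed
    finally show "?M (2 * j)
      = (\<Sum>l\<le>k - 2 * j. ?T j l)"
      by (simp only: binomial_ring)
  qed
  also have "\<dots> = (\<Sum>(j,l)\<in>(SIGMA j:{j. 2 * j \<le> k}. {..k - 2 * j}). ?T j l)"
    by (rule sum.Sigma) (auto intro: finite_subset[of _ "{..k}"])
  \<comment> \<open>The new index i = j + l is the power of x^2; the constraint l <= k - 2 j becomes
    j <= k - i.\<close>
  also have "\<dots> = (\<Sum>(i,j)\<in>(SIGMA i:{..k}. {j. j \<le> i \<and> j \<le> k - i}). ?S i j)"
    by (rule sum.reindex_bij_witness[of _ "\<lambda>(i,j). (j, i - j)" "\<lambda>(j,l). (j + l, j)"])
       (auto simp: algebra_simps intro!: arg_cong[where f=fact])
  also have "\<dots> = (\<Sum>i\<le>k. \<Sum>j | j \<le> i \<and> j \<le> k - i. ?S i j)"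
    by (rule sum.Sigma[symmetric]) auto
  also have "\<dots> = (\<Sum>i\<le>k. fact k * ?p k / (fact i * ?p i * fact (k - i) * ?p (k - i)) * ?X ^ i * ?Y ^ (k - i))"
  proof (rule sum.cong[OF refl])
    fix i assume "i \<in> {..k}"
    then have i: "i \<le> k" by simp
    let ?n = "k - i"
    have "(\<Sum>j | j \<le> i \<and> j \<le> ?n. fact k / (fact j * ?p j * fact (i - j) * fact (?n - j)) * ?X ^ i * ?Y ^ ?n)
      = (\<Sum>j | j \<le> i \<and> j \<le> ?n. fact k / (fact j * ?p j * fact (i - j) * fact (?n - j))) * ?X ^ i * ?Y ^ ?n"
      by (simp add: sum_distrib_right)
    also have "(\<Sum>j | j \<le> i \<and> j \<le> ?n. fact k / (fact j * ?p j * fact (i - j) * fact (?n - j)))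
       = (\<Sum>j | j \<le> i \<and> j \<le> ?n. fact k / (fact ?n * ?p i) * (real (?n choose j) * (?p i / (?p j * fact (i - j)))))"
    proof (rule sum.cong[OF refl])
      fix j assume "j \<in> {j. j \<le> i \<and> j \<le> ?n}"
      then have "j \<le> ?n" by simp
      then show "fact k / (fact j * ?p j * fact (i - j) * fact (?n - j)) = fact k / (fact ?n * ?p i) * (real (?n choose j) * (?p i / (?p j * fact (i - j))))"
        using pochhammer_pos'[of i] by (simp add: binomial_fact)
    qed
    also have "\<dots> = (\<Sum>j\<le>i. fact k / (fact ?n * ?p i) * (real (?n choose j) * (?p i / (?p j * fact (i - j)))))"
      by (rule sum.mono_neutral_left) auto
    also have "\<dots> = fact k / (fact ?n * ?p i) * (?p (?n + i) / (?p ?n * fact i))"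
      by (simp only: sum_distrib_left[symmetric] pochhammer_Vandermonde)
    also have "\<dots> = fact k * ?p k / (fact i * ?p i * fact ?n * ?p ?n)"
      using i by (simp add: mult_ac)
    finally show "(\<Sum>j | j \<le> i \<and> j \<le> ?n. fact k / (fact j * ?p j * fact (i - j) * fact (?n - j)) * ?X ^ i * ?Y ^ ?n)
      = fact k * ?p k / (fact i * ?p i * fact ?n * ?p ?n) * ?X ^ i * ?Y ^ ?n" .
  qed
  finally show ?thesis .
qed

text \<open>By the law of cosines this is the squared third side of a triangle with sides |x|, |y|
  and angle of cosine t or - t, according to the sign of x y.\<close>

lemma gegen_chord_bounds:
  fixes x y t :: real
  assumes "t \<in> {-1..1}"
  shows "0 \<le> x\<^sup>2 + y\<^sup>2 - 2 * x * y * t" "x\<^sup>2 + y\<^sup>2 - 2 * x * y * t \<le> (\<bar>x\<bar> + \<bar>y\<bar>)\<^sup>2"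
proof -
  have "\<bar>x * y * t\<bar> \<le> \<bar>x * y\<bar> * 1"
    unfolding abs_mult[of "x * y" t] using assms by (intro mult_left_mono) auto
  then have *: "\<bar>x * y * t\<bar> \<le> \<bar>x\<bar> * \<bar>y\<bar>" by (simp add: abs_mult)
  have "0 \<le> (\<bar>x\<bar> - \<bar>y\<bar>)\<^sup>2" by simp
  also have "\<dots> = x\<^sup>2 + y\<^sup>2 - 2 * (\<bar>x\<bar> * \<bar>y\<bar>)" by (simp add: power2_diff)
  also have "\<dots> \<le> x\<^sup>2 + y\<^sup>2 - 2 * (x * y * t)" using * by linarith
  finally show "0 \<le> x\<^sup>2 + y\<^sup>2 - 2 * x * y * t" by (simp add: mult.assoc)
  have "x\<^sup>2 + y\<^sup>2 - 2 * (x * y * t) \<le> x\<^sup>2 + y\<^sup>2 + 2 * (\<bar>x\<bar> * \<bar>y\<bar>)" using * by linarith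
  then show "x\<^sup>2 + y\<^sup>2 - 2 * x * y * t \<le> (\<bar>x\<bar> + \<bar>y\<bar>)\<^sup>2" by (simp add: power2_sum mult.assoc)
qed

lemma gegen_integral_suminf:
  fixes g :: "nat \<Rightarrow> real \<Rightarrow> real"
  assumes [measurable]: "\<And>k. g k \<in> borel_measurable borel"
    and bound: "\<And>k t. t \<in> {-1..1} \<Longrightarrow> \<bar>g k t\<bar> \<le> B k" and "summable B"
  shows "(LINT t|\<nu>. (\<Sum>k. g k t)) = (\<Sum>k. LINT t|\<nu>. g k t)"
proof (rule integral_suminf)
  show int: "integrable \<nu> (g k)" for k
    by (rule gegen_integrable_bounded[where B="B k"]) (auto intro: bound)
  show "AE t in \<nu>. summable (\<lambda>k. norm (g k t))"
    using AE_gegen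
  proof eventually_elim
    case (elim t)
    show ?case by (rule summable_comparison_test'[OF \<open>summable B\<close>, of 0]) (use bound elim in auto)
  qed
  show "summable (\<lambda>k. LINT t|\<nu>. norm (g k t))"
  proof (rule summable_comparison_test'[OF \<open>summable B\<close>, of 0])
    fix k
    have "(LINT t|\<nu>. norm (g k t)) \<le> (LINT t|\<nu>. B k)"
      using AE_gegen int bound by (intro integral_mono_AE) (auto elim: eventually_mono)
    then show "norm (LINT t|\<nu>. norm (g k t)) \<le> B k"
      by (simp add: measure_gegen_UNIV)
  qed
qed

text \<open>Integrating the power series in the squared chord term by term gives exactly the Cauchy
  product of the series in x^2 and y^2.\<close>

theorem bessel_j_product:
  "bessel_j \<alpha> x * bessel_j \<alpha> y = (LINT t|\<nu>. bessel_j \<alpha> (sqrt (x\<^sup>2 + y\<^sup>2 - 2 * x * y * t)))"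
proof -
  let ?D = "\<lambda>t. x\<^sup>2 + y\<^sup>2 - 2 * x * y * t"
  have "(LINT t|\<nu>. bessel_j \<alpha> (sqrt (?D t))) = (LINT t|\<nu>. (\<Sum>k. bessel_coeff \<alpha> k * ?D t ^ k))"
  proof (rule integral_cong_AE)
    show "AE t in \<nu>. bessel_j \<alpha> (sqrt (?D t)) = (\<Sum>k. bessel_coeff \<alpha> k * ?D t ^ k)"
      using AE_gegen
    proof eventually_elim
      case (elim t)
      then have "(sqrt (?D t))\<^sup>2 = ?D t" using gegen_chord_bounds(1)[OF elim, of x y] by (rule_tac real_sqrt_pow2)
      then show ?case by (simp only: bessel_j_eq power_mult)
    qed
  qed measurable
  also have "\<dots> = (\<Sum>k. LINT t|\<nu>. bessel_coeff \<alpha> k * ?D t ^ k)"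
  proof (rule gegen_integral_suminf)
    show "summable (\<lambda>k. \<bar>bessel_coeff \<alpha> k\<bar> * \<bar>(\<bar>x\<bar> + \<bar>y\<bar>)\<^sup>2\<bar> ^ k)"
      by (rule summable_abs_bessel)
    show "\<bar>bessel_coeff \<alpha> k * ?D t ^ k\<bar> \<le> \<bar>bessel_coeff \<alpha> k\<bar> * \<bar>(\<bar>x\<bar> + \<bar>y\<bar>)\<^sup>2\<bar> ^ k" if "t \<in> {-1..1}" for k t
      using gegen_chord_bounds[OF that, of x y] unfolding abs_mult
      by (intro mult_left_mono) (auto intro!: power_mono)
  qed measurable
  also have "\<dots> = (\<Sum>k. \<Sum>i\<le>k. (bessel_coeff \<alpha> i * (x\<^sup>2) ^ i) * (bessel_coeff \<alpha> (k - i) * (y\<^sup>2) ^ (k - i)))"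
  proof (rule suminf_cong)
    fix k
    have *: "bessel_coeff \<alpha> k * (fact k * pochhammer (\<alpha> + 1) k / (fact i * pochhammer (\<alpha> + 1) i * fact (k - i) * pochhammer (\<alpha> + 1) (k - i)))
       = bessel_coeff \<alpha> i * bessel_coeff \<alpha> (k - i)" if "i \<le> k" for i
    proof -
      have "(-1::real) ^ k = (-1) ^ i * (-1) ^ (k - i)" "(4::real) ^ k = 4 ^ i * 4 ^ (k - i)"
        using that by (simp_all flip: power_add)
      then show ?thesis using pochhammer_pos'[of k] by (simp add: bessel_coeff_def)
    qed
    have "(LINT t|\<nu>. bessel_coeff \<alpha> k * ?D t ^ k) = (\<Sum>i\<le>k.
       (bessel_coeff \<alpha> k * (fact k * pochhammer (\<alpha> + 1) k / (fact i * pochhammer (\<alpha> + 1) i * fact (k - i) * pochhammer (\<alpha> + 1) (k - i))))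
         * (x\<^sup>2) ^ i * (y\<^sup>2) ^ (k - i))"
      unfolding integral_mult_right_zero gegen_integral_binomial sum_distrib_left by (simp only: mult.assoc)
    also have "\<dots> = (\<Sum>i\<le>k. (bessel_coeff \<alpha> i * (x\<^sup>2) ^ i) * (bessel_coeff \<alpha> (k - i) * (y\<^sup>2) ^ (k - i)))"
      by (intro sum.cong refl) (simp only: atMost_iff *, simp add: mult_ac)
    finally show "(LINT t|\<nu>. bessel_coeff \<alpha> k * ?D t ^ k) =
      (\<Sum>i\<le>k. (bessel_coeff \<alpha> i * (x\<^sup>2) ^ i) * (bessel_coeff \<alpha> (k - i) * (y\<^sup>2) ^ (k - i)))" .
  qed
  also have "\<dots> = (\<Sum>k. bessel_coeff \<alpha> k * (x\<^sup>2) ^ k) * (\<Sum>k. bessel_coeff \<alpha> k * (y\<^sup>2) ^ k)"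
  proof (rule Cauchy_product[symmetric])
    show "summable (\<lambda>k. norm (bessel_coeff \<alpha> k * (x\<^sup>2) ^ k))" for x :: real
      using summable_abs_bessel[of "x\<^sup>2"] by (simp add: abs_mult)
    show "summable (\<lambda>k. norm (bessel_coeff \<alpha> k * (y\<^sup>2) ^ k))"
      using summable_abs_bessel[of "y\<^sup>2"] by (simp add: abs_mult)
  qed
  finally show ?thesis by (simp add: bessel_j_eq power_mult)
qed

text \<open>The even moments of \<open>\<nu>\<close> turn the factors 1 / (2 k)! of the cosine
  series into the Bessel coefficients. As \<open>\<nu>\<close> is a probability measure, bounds for
  the cosine pass to \<open>bessel_j\<close>.\<close>

theorem bessel_j_Poisson: "bessel_j \<alpha> x = (LINT t|\<nu>. cos (x * t))"
proof -
  have "(LINT t|\<nu>. cos (x * t)) =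
      (LINT t|\<nu>. (\<Sum>k. (-1) ^ k / fact (2 * k) * (x * t) ^ (2 * k)))"
    by (intro Bochner_Integration.integral_cong refl sums_unique cos_paired)
  also have "\<dots> = (\<Sum>k. LINT t|\<nu>. (-1) ^ k / fact (2 * k) * (x * t) ^ (2 * k))"
  proof (rule gegen_integral_suminf)
    have "summable (\<lambda>k. inverse (fact k) * (x\<^sup>2) ^ k)" by (rule summable_exp)
    then show "summable (\<lambda>k. (x\<^sup>2) ^ k / fact k)" by (simp add: field_simps)
    fix k :: nat and t :: real assume t: "t \<in> {-1..1}"
    have "(x\<^sup>2) ^ k * \<bar>t ^ (2 * k)\<bar> / fact (2 * k) \<le> (x\<^sup>2) ^ k * 1 / fact k"
      using t by (intro frac_le mult_mono fact_mono) (auto simp: power_abs abs_le_iff intro!: power_le_one)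
    then show "\<bar>(-1) ^ k / fact (2 * k) * (x * t) ^ (2 * k)\<bar> \<le> (x\<^sup>2) ^ k / fact k"
      by (simp add: abs_mult power_mult_distrib power_mult)
  qed measurable
  also have "\<dots> = (\<Sum>k. bessel_coeff \<alpha> k * x ^ (2 * k))"
  proof (rule suminf_cong)
    fix k
    have "(LINT t|\<nu>. (-1) ^ k / fact (2 * k) * (x * t) ^ (2 * k))
       = (-1) ^ k / fact (2 * k) * x ^ (2 * k) * gegen_moment (2 * k)"
      using integrable_gegen_power by (simp add: power_mult_distrib gegen_moment_def)
    then show "(LINT t|\<nu>. (-1) ^ k / fact (2 * k) * (x * t) ^ (2 * k)) = bessel_coeff \<alpha> k * x ^ (2 * k)"
      by (simp add: gegen_moment_even bessel_coeff_def)
  qed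
  finally show ?thesis by (simp add: bessel_j_eq)
qed

lemma abs_bessel_j_le_1: "\<bar>bessel_j \<alpha> x\<bar> \<le> 1"
proof -
  have "\<bar>bessel_j \<alpha> x\<bar> \<le> (LINT t|\<nu>. \<bar>cos (x * t)\<bar>)"
    unfolding bessel_j_Poisson by (rule integral_abs_bound)
  also have "\<dots> \<le> (LINT t|\<nu>. 1)"
    by (intro integral_mono gegen_integrable_bounded[where B=1]) auto
  finally show ?thesis by (simp add: measure_gegen_UNIV)
qed

lemma cos_ge_1_minus_half_square: "1 - x\<^sup>2 / 2 \<le> cos (x::real)"
proof -
  have "(sin (x / 2))\<^sup>2 \<le> (x / 2)\<^sup>2"
    using abs_sin_x_le_abs_x[of "x / 2"] by (simp only: abs_le_square_iff)
  moreover have "cos x = 1 - 2 * (sin (x / 2))\<^sup>2" using cos_double_sin[of "x / 2"] by simp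
  ultimately show ?thesis by (simp add: power_divide)
qed

lemma bessel_j_ge: "1 - x\<^sup>2 / 2 \<le> bessel_j \<alpha> x"
proof -
  have "(LINT t|\<nu>. 1 - x\<^sup>2 / 2) \<le> (LINT t|\<nu>. cos (x * t))"
  proof (rule integral_mono_AE)
    show "AE t in \<nu>. 1 - x\<^sup>2 / 2 \<le> cos (x * t)"
      using AE_gegen
    proof eventually_elim
      case (elim t)
      then have "(x * t)\<^sup>2 \<le> x\<^sup>2 * 1"
        unfolding power_mult_distrib by (intro mult_left_mono) (auto simp: abs_square_le_1 abs_le_iff)
      moreover have "1 - (x * t)\<^sup>2 / 2 \<le> cos (x * t)" by (rule cos_ge_1_minus_half_square)
      ultimately show ?case by simp
    qed
  qed (auto intro!: gegen_integrable_bounded[where B=1])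
  then show ?thesis by (simp add: measure_gegen_UNIV bessel_j_Poisson)
qed

end

section \<open>The Hankel transform\<close>

lemma sigma_finite_bk_measure: "sigma_finite_measure (bk_measure \<alpha>)"
  unfolding bk_measure_def by (subst sigma_finite_measure.sigma_finite_iff_density_finite[OF sigma_finite_lborel]) auto

interpretation bk: sigma_finite_measure "bk_measure \<alpha>" for \<alpha>
  by (rule sigma_finite_bk_measure)

lemma integrable_bk_measure:
  fixes g :: "real \<Rightarrow> real"
  assumes [measurable]: "g \<in> borel_measurable borel"
  shows "integrable (bk_measure \<alpha>) g \<longleftrightarrow> integrable lborel (\<lambda>x. indicator {0..} x * x powr (2 * \<alpha> + 1) * g x)"
  unfolding bk_measure_def by (subst integrable_density) auto

lemma integral_bk_measure:
  fixes g :: "real \<Rightarrow> real"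
  assumes [measurable]: "g \<in> borel_measurable borel"
  shows "(LINT x|bk_measure \<alpha>. g x) = (LINT x|lborel. indicator {0..} x * x powr (2 * \<alpha> + 1) * g x)"
  unfolding bk_measure_def by (subst integral_density) auto

lemma AE_bk_measure_nonneg: "AE x in bk_measure \<alpha>. 0 \<le> x"
  unfolding bk_measure_def by (subst AE_density) (auto simp: indicator_def)

text \<open>The substitution t = s x^2 in the Gamma integral, carried out on the open half-line,
  which it maps bijectively onto itself.\<close>

lemma has_bochner_integral_power_gauss:
  fixes s p :: real
  assumes "0 < s" "0 < p"
  shows "has_bochner_integral lborel (\<lambda>x. indicator {0..} x * x powr (2 * p - 1) * exp (- s * x\<^sup>2)) (Gamma p / (2 * s powr p))"
proof -
  let ?f = "\<lambda>t::real. t powr (p - 1) / exp t"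
  let ?g = "\<lambda>x::real. s * x\<^sup>2"
  let ?h = "\<lambda>x::real. 2 * s powr p * (x powr (2 * p - 1) * exp (- s * x\<^sup>2))"
  have "(?f has_integral Gamma p) {0..}" using assms by (intro Gamma_integral_real)
  then have "((\<lambda>t. if t \<in> {0<..} then ?f t else 0) has_integral Gamma p) {0..}"
    by (rule has_integral_spike [of "{0}", rotated 2]) auto
  then have G: "(?f has_integral Gamma p) {0<..}"
    by (subst (asm) has_integral_restrict) auto
  have "?f absolutely_integrable_on {0<..}"
    using G by (intro nonnegative_absolutely_integrable_1) (auto simp: has_integral_iff)
  moreover have im: "?g ` {0<..} = {0<..}"
  proof (intro equalityI subsetI)
    fix y :: real assume "y \<in> {0<..}"
    then have "y = ?g (sqrt (y / s))" "sqrt (y / s) \<in> {0<..}" using assms by auto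
    then show "y \<in> ?g ` {0<..}" by blast
  qed (use assms in auto)
  moreover have "inj_on ?g {0<..}" using assms by (auto simp: inj_on_def power2_eq_iff)
  ultimately have *: "(\<lambda>x. \<bar>2 * s * x\<bar> * ?f (?g x)) absolutely_integrable_on {0<..} \<and>
      integral {0<..} (\<lambda>x. \<bar>2 * s * x\<bar> * ?f (?g x)) = Gamma p"
    using G by (subst has_absolute_integral_change_of_variables_1')
      (auto intro!: derivative_eq_intros simp: has_integral_iff)
  have eq: "\<bar>2 * s * x\<bar> * ?f (?g x) = ?h x" if "x \<in> {0<..}" for x
  proof -
    have x: "x > 0" using that by simp
    have "(s * x\<^sup>2) powr (p - 1) = s powr (p - 1) * x powr (2 * (p - 1))"
    proof -
      have "(x\<^sup>2) powr (p - 1) = (x powr 2) powr (p - 1)" using x by simp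
      also have "\<dots> = x powr (2 * (p - 1))" by (rule powr_powr)
      finally show ?thesis using x assms by (simp add: powr_mult)
    qed
    moreover have "s powr p = s powr (p - 1) * s" 
      using assms powr_add[of s "p - 1" 1] by simp
    moreover have "x powr (2 * p - 1) = x powr (2 * (p - 1)) * x" 
      using x powr_add[of x "2 * (p - 1)" 1] by simp
    moreover have "exp (- s * x\<^sup>2) = 1 / exp (s * x\<^sup>2)" by (simp add: exp_minus field_simps)
    ultimately show ?thesis using x assms by (simp add: abs_mult)
  qed
  have "(\<lambda>x. indicator {0<..} x *\<^sub>R (\<bar>2 * s * x\<bar> * ?f (?g x))) = (\<lambda>x. indicator {0<..} x *\<^sub>R ?h x)"
  proof
    show "indicator {0<..} x *\<^sub>R (\<bar>2 * s * x\<bar> * ?f (?g x)) = indicator {0<..} x *\<^sub>R ?h x" for x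
    proof (cases "x \<in> {0<..}")
      case True
      show ?thesis unfolding eq[OF True] ..
    qed simp
  qed
  then have abs: "?h absolutely_integrable_on {0<..}"
    using conjunct1[OF *] unfolding set_integrable_def by (simp only:)
  have int: "integral {0<..} ?h = Gamma p"
  proof -
    have "integral {0<..} (\<lambda>x. \<bar>2 * s * x\<bar> * ?f (?g x)) = integral {0<..} ?h"
      by (rule integral_cong) (rule eq)
    then show ?thesis using conjunct2[OF *] by (simp only:)
  qed
  let ?H = "\<lambda>x. indicator {0..} x * x powr (2 * p - 1) * exp (- s * x\<^sup>2)"
  have H: "indicator {0<..} x *\<^sub>R ?h x = 2 * s powr p * ?H x" for x :: real
    by (auto simp: indicator_def)
  have "integrable lebesgue (\<lambda>x. 2 * s powr p * ?H x)"
    using abs unfolding set_integrable_def H .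
  then have "integrable lebesgue ?H" using assms by simp
  then have I: "integrable lborel ?H" by (subst (asm) integrable_completion) auto
  have "2 * s powr p * (LINT x|lborel. ?H x) = (LINT x|lebesgue. 2 * s powr p * ?H x)"
    by (subst integral_completion) auto
  also have "\<dots> = integral {0<..} ?h"
    using set_lebesgue_integral_eq_integral(2)[OF abs] unfolding set_lebesgue_integral_def H .
  finally have "2 * s powr p * (LINT x|lborel. ?H x) = Gamma p" using int by (simp only:)
  then show ?thesis using I assms by (simp add: has_bochner_integral_iff field_simps)
qed

text \<open>The integrand is dominated by B |u| |v|. Characters, bumps and \<open>kern\<close> are
  the kernels to which this is applied later.\<close>

lemma Fubini_bounded_kernel:
  fixes K :: "'a \<Rightarrow> 'b \<Rightarrow> real"
  assumes "sigma_finite_measure M" "sigma_finite_measure N"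
    and u: "integrable M u" and v: "integrable N v"
    and K: "case_prod K \<in> borel_measurable (M \<Otimes>\<^sub>M N)" "\<And>x y. \<bar>K x y\<bar> \<le> B"
  shows "(LINT x|M. u x * (LINT y|N. v y * K x y)) = (LINT y|N. v y * (LINT x|M. u x * K x y))"
    and "integrable M (\<lambda>x. u x * (LINT y|N. v y * K x y))"
    and "integrable (M \<Otimes>\<^sub>M N) (\<lambda>(x, y). u x * v y * K x y)"
proof -
  interpret M: sigma_finite_measure M by fact
  interpret N: sigma_finite_measure N by fact
  interpret pair_sigma_finite M N ..
  note [measurable] = borel_measurable_integrable[OF u] borel_measurable_integrable[OF v] K(1)
  have KN: "(\<lambda>y. K x y) \<in> borel_measurable N" if "x \<in> space M" for x
    using measurable_compose[OF measurable_Pair1'[OF that] K(1)] by simp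
  have ivK: "integrable N (\<lambda>y. v y * K x y)" if "x \<in> space M" for x
  proof (rule Bochner_Integration.integrable_bound)
    show "integrable N (\<lambda>y. \<bar>v y\<bar> * B)" using v by simp
    show "AE y in N. norm (v y * K x y) \<le> norm (\<bar>v y\<bar> * B)"
      using K(2) by (auto simp: abs_mult intro!: mult_left_mono AE_I2 order_trans[OF K(2) abs_ge_self])
    show "(\<lambda>y. v y * K x y) \<in> borel_measurable N" using KN[OF that] by measurable
  qed
  show int: "integrable (M \<Otimes>\<^sub>M N) (\<lambda>(x, y). u x * v y * K x y)"
  proof (rule Fubini_integrable)
    show "(\<lambda>(x, y). u x * v y * K x y) \<in> borel_measurable (M \<Otimes>\<^sub>M N)" by measurable
    have "integrable M (\<lambda>x. LINT y|N. \<bar>u x * v y * K x y\<bar>)"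
    proof (rule Bochner_Integration.integrable_bound)
      show "integrable M (\<lambda>x. \<bar>u x\<bar> * (B * (LINT y|N. \<bar>v y\<bar>)))" using u by simp
      show "AE x in M. norm (LINT y|N. \<bar>u x * v y * K x y\<bar>) \<le> norm (\<bar>u x\<bar> * (B * (LINT y|N. \<bar>v y\<bar>)))"
      proof (rule AE_I2)
        fix x assume x: "x \<in> space M"
        have "(LINT y|N. \<bar>u x * v y * K x y\<bar>) \<le> (LINT y|N. \<bar>u x\<bar> * B * \<bar>v y\<bar>)"
        proof (rule integral_mono)
          show "integrable N (\<lambda>y. \<bar>u x * v y * K x y\<bar>)"
            using ivK[OF x] by (intro integrable_abs) (simp add: mult.assoc)
          show "\<bar>u x * v y * K x y\<bar> \<le> \<bar>u x\<bar> * B * \<bar>v y\<bar>" for y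
          proof -
            have "\<bar>u x * v y * K x y\<bar> = \<bar>u x\<bar> * \<bar>v y\<bar> * \<bar>K x y\<bar>" by (simp add: abs_mult)
            also have "\<dots> \<le> \<bar>u x\<bar> * \<bar>v y\<bar> * B" by (intro mult_left_mono K(2)) auto
            finally show ?thesis by (simp add: mult_ac)
          qed
        qed (use v in auto)
        moreover have "0 \<le> (LINT y|N. \<bar>u x * v y * K x y\<bar>)" by (rule integral_nonneg_AE) auto
        ultimately show "norm (LINT y|N. \<bar>u x * v y * K x y\<bar>) \<le> norm (\<bar>u x\<bar> * (B * (LINT y|N. \<bar>v y\<bar>)))"
          by (simp add: mult_ac)
      qed
    qed measurable
    then show "integrable M (\<lambda>x. LINT y|N. norm ((\<lambda>(x, y). u x * v y * K x y) (x, y)))" by simp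
    show "AE x in M. integrable N (\<lambda>y. (\<lambda>(x, y). u x * v y * K x y) (x, y))"
      using ivK by (intro AE_I2) (auto simp: mult.assoc)
  qed
  have "(LINT x|M. u x * (LINT y|N. v y * K x y)) = (LINT x|M. LINT y|N. u x * v y * K x y)"
    by (simp add: mult.assoc)
  also have "\<dots> = (LINT y|N. LINT x|M. u x * v y * K x y)"
    using Fubini_integral[OF int] by simp
  also have "\<dots> = (LINT y|N. v y * (LINT x|M. u x * K x y))"
  proof -
    have *: "u x * v y * K x y = v y * (u x * K x y)" for x y by simp
    show ?thesis by (simp only: * integral_mult_right_zero)
  qed
  finally show "(LINT x|M. u x * (LINT y|N. v y * K x y)) = (LINT y|N. v y * (LINT x|M. u x * K x y))" .
  show "integrable M (\<lambda>x. u x * (LINT y|N. v y * K x y))"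
    using integrable_fst[OF int] by (simp add: mult.assoc)
qed

context bessel_kingman
begin

text \<open>The integral of exp(- s x^2) against \<open>\<mu>\<close>, which is the case k = 0 of
  \<open>gauss_moment\<close>.\<close>

definition gauss_const :: "real \<Rightarrow> real" where
  "gauss_const s = Gamma (\<alpha> + 1) / (2 * s powr (\<alpha> + 1))"

lemma gauss_const_pos: "0 < s \<Longrightarrow> 0 < gauss_const s"
  using half_le by (auto simp: gauss_const_def intro!: divide_pos_pos Gamma_real_pos)

text \<open>A Gaussian with parameter s has a transform with parameter 1 / (4 s). The powers of s
  cancel in the product, and what remains is the constant of the inversion formula.\<close>

lemma gauss_const_prod:
  assumes "0 < s" shows "gauss_const s * gauss_const (1 / (4 * s)) = 4 powr \<alpha> * (Gamma (\<alpha> + 1))\<^sup>2"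
proof -
  have "s powr (\<alpha> + 1) * (1 / (4 * s)) powr (\<alpha> + 1) = (1 / 4) powr (\<alpha> + 1)"
    using assms by (subst powr_mult[symmetric]) auto
  also have "\<dots> = 1 / (4 * 4 powr \<alpha>)"
    by (simp add: powr_divide powr_add)
  finally have *: "s powr (\<alpha> + 1) * (1 / (4 * s)) powr (\<alpha> + 1) = 1 / (4 * 4 powr \<alpha>)" .
  have "gauss_const s * gauss_const (1 / (4 * s)) =
      (Gamma (\<alpha> + 1))\<^sup>2 / (4 * (s powr (\<alpha> + 1) * (1 / (4 * s)) powr (\<alpha> + 1)))"
    by (simp add: gauss_const_def power2_eq_square mult_ac)
  then show ?thesis unfolding * by simp
qed

lemma gauss_moment:
  assumes s: "0 < s"
  shows "integrable \<mu> (\<lambda>x. x ^ (2 * k) * exp (- s * x\<^sup>2))"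
    and "(LINT x|\<mu>. x ^ (2 * k) * exp (- s * x\<^sup>2)) = gauss_const s * pochhammer (\<alpha> + 1) k / s ^ k"
proof -
  have eq: "indicator {0..} x * x powr (2 * \<alpha> + 1) * (x ^ (2 * k) * exp (- s * x\<^sup>2)) =
     indicator {0..} x * x powr (2 * (\<alpha> + 1 + real k) - 1) * exp (- s * x\<^sup>2)" for x :: real
  proof (cases "0 < x")
    case True
    then have "x powr (2 * (\<alpha> + 1 + real k) - 1) = x powr (2 * \<alpha> + 1) * x ^ (2 * k)"
      by (subst powr_realpow[symmetric]) (auto simp: powr_add[symmetric] algebra_simps)
    then show ?thesis by simp
  qed (auto simp: indicator_def)
  have h: "has_bochner_integral lborel (\<lambda>x. indicator {0..} x * x powr (2 * \<alpha> + 1) * (x ^ (2 * k) * exp (- s * x\<^sup>2)))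
      (Gamma (\<alpha> + 1 + real k) / (2 * s powr (\<alpha> + 1 + real k)))"
    unfolding eq using s half_le by (intro has_bochner_integral_power_gauss) auto
  then show "integrable \<mu> (\<lambda>x. x ^ (2 * k) * exp (- s * x\<^sup>2))"
    by (subst integrable_bk_measure) (auto simp: has_bochner_integral_iff)
  have "\<alpha> + 1 \<notin> \<int>\<^sub>\<le>\<^sub>0" using half_le by (auto dest: nonpos_Ints_nonpos)
  then have "pochhammer (\<alpha> + 1) k = Gamma (\<alpha> + 1 + real k) / Gamma (\<alpha> + 1)"
    by (rule pochhammer_Gamma)
  moreover have "Gamma (\<alpha> + 1) > 0" using half_le by (intro Gamma_real_pos) simp
  moreover have "s powr (\<alpha> + 1 + real k) = s powr (\<alpha> + 1) * s ^ k"
    using s by (simp add: powr_add powr_realpow)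
  ultimately have "Gamma (\<alpha> + 1 + real k) / (2 * s powr (\<alpha> + 1 + real k)) = gauss_const s * pochhammer (\<alpha> + 1) k / s ^ k"
    by (simp add: gauss_const_def)
  then show "(LINT x|\<mu>. x ^ (2 * k) * exp (- s * x\<^sup>2)) = gauss_const s * pochhammer (\<alpha> + 1) k / s ^ k"
    using h by (subst integral_bk_measure) (auto simp: has_bochner_integral_iff)
qed

lemma integrable_gauss: "0 < s \<Longrightarrow> integrable \<mu> (\<lambda>x. exp (- s * x\<^sup>2))"
  using gauss_moment(1)[of s 0] by simp

lemma integrable_bounded_mult:
  fixes u g :: "real \<Rightarrow> real"
  assumes u: "integrable \<mu> u" and [measurable]: "g \<in> borel_measurable borel" and "\<And>x. \<bar>g x\<bar> \<le> B"
  shows "integrable \<mu> (\<lambda>x. u x * g x)" and "integrable \<mu> (\<lambda>x. g x * u x)"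
proof -
  show "integrable \<mu> (\<lambda>x. u x * g x)"
  proof (rule Bochner_Integration.integrable_bound)
    have [measurable]: "u \<in> borel_measurable borel" using borel_measurable_integrable[OF u] by simp
    show "integrable \<mu> (\<lambda>x. B * u x)" using u by simp
    show "(\<lambda>x. u x * g x) \<in> borel_measurable \<mu>" by measurable
    show "AE x in \<mu>. norm (u x * g x) \<le> norm (B * u x)"
      unfolding real_norm_def abs_mult mult.commute[of "\<bar>u _\<bar>"]
      by (intro AE_I2 mult_right_mono order_trans[OF assms(3) abs_ge_self] abs_ge_zero)
  qed
  then show "integrable \<mu> (\<lambda>x. g x * u x)" by (simp add: mult.commute)
qed

lemma integrable_bounded_mult_gauss:
  fixes g :: "real \<Rightarrow> real"
  assumes "g \<in> borel_measurable borel" "\<And>x. \<bar>g x\<bar> \<le> B" "0 < s"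
  shows "integrable \<mu> (\<lambda>x. g x * exp (- s * x\<^sup>2))"
  by (rule integrable_bounded_mult(2)[OF integrable_gauss[OF assms(3)] assms(1,2)])

lemma integrable_mult_gauss:
  assumes "integrable \<mu> u" "0 \<le> s"
  shows "integrable \<mu> (\<lambda>x. u x * exp (- s * x\<^sup>2))"
  by (rule integrable_bounded_mult(1)[OF assms(1), where B=1]) (use assms(2) in auto)

lemma integrable_mult_bessel:
  assumes "integrable \<mu> u"
  shows "integrable \<mu> (\<lambda>x. u x * bessel_j \<alpha> (s * x))"
  by (rule integrable_bounded_mult(1)[OF assms _ abs_bessel_j_le_1]) measurable

text \<open>The multiple B exp(r^2) exp(- x^2) of a Gaussian dominates g, since exp(r^2 - x^2) is at
  least 1 on [0, r].\<close>

lemma integrable_bounded_on_interval: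
  assumes [measurable]: "g \<in> borel_measurable borel" and "\<And>x. \<bar>g x\<bar> \<le> B" "\<And>x. x \<notin> {0..r} \<Longrightarrow> g x = 0"
  shows "integrable \<mu> (g :: real \<Rightarrow> real)"
proof (rule Bochner_Integration.integrable_bound)
  show "integrable \<mu> (\<lambda>x. B * exp (r\<^sup>2) * exp (- 1 * x\<^sup>2))"
    using integrable_gauss[of 1] by simp
  show "AE x in \<mu>. norm (g x) \<le> norm (B * exp (r\<^sup>2) * exp (- 1 * x\<^sup>2))"
  proof (rule AE_I2)
    fix x
    show "norm (g x) \<le> norm (B * exp (r\<^sup>2) * exp (- 1 * x\<^sup>2))"
    proof (cases "x \<in> {0..r}")
      case True
      have "0 \<le> B" using order_trans[OF abs_ge_zero assms(2)] .
      from True have "x\<^sup>2 \<le> r\<^sup>2" by (intro power_mono) auto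
      then have "1 \<le> exp (r\<^sup>2) * exp (- x\<^sup>2)" by (simp flip: exp_add)
      then have "\<bar>g x\<bar> * 1 \<le> B * (exp (r\<^sup>2) * exp (- x\<^sup>2))"
        using assms(2)[of x] \<open>0 \<le> B\<close> by (intro mult_mono) auto
      then show ?thesis using \<open>0 \<le> B\<close> by (simp add: abs_mult mult.assoc)
    qed (use assms(3) in simp)
  qed
qed measurable

definition hankel :: "(real \<Rightarrow> real) \<Rightarrow> real \<Rightarrow> real" where
  "hankel u s = (LINT x|\<mu>. u x * bessel_j \<alpha> (s * x))"

text \<open>Term by term, the Pochhammer symbol of the Gaussian moment cancels the one in
  \<open>bessel_coeff\<close>, leaving the exponential series of - y^2 / (4 s).\<close>

theorem hankel_gauss:
  assumes s: "0 < s"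
  shows "hankel (\<lambda>x. exp (- s * x\<^sup>2)) y = gauss_const s * exp (- y\<^sup>2 / (4 * s))"
proof -
  define g where "g k x = bessel_coeff \<alpha> k * y ^ (2 * k) * (x ^ (2 * k) * exp (- s * x\<^sup>2))" for k x
  have int: "integrable \<mu> (g k)" for k
    unfolding g_def using gauss_moment(1)[OF s] by simp
  have val: "(LINT x|\<mu>. g k x) = gauss_const s * ((- y\<^sup>2 / (4 * s)) ^ k /\<^sub>R fact k)" for k
  proof -
    have "(LINT x|\<mu>. g k x) = bessel_coeff \<alpha> k * y ^ (2 * k) * (gauss_const s * pochhammer (\<alpha> + 1) k / s ^ k)"
      unfolding g_def using gauss_moment[OF s] by simp
    also have "\<dots> = gauss_const s * ((-1) ^ k * (y\<^sup>2) ^ k / (4 ^ k * s ^ k * fact k))"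
      by (simp add: bessel_coeff_def power_mult) (simp add: mult_ac)
    also have "(-1) ^ k * (y\<^sup>2) ^ k / (4 ^ k * s ^ k * fact k) = (- y\<^sup>2 / (4 * s)) ^ k /\<^sub>R fact k"
      by (simp add: power_divide power_mult_distrib power_minus[of "y\<^sup>2 / (4 * s)"] inverse_eq_divide)
    finally show ?thesis .
  qed
  have nval: "(LINT x|\<mu>. norm (g k x)) = gauss_const s * ((y\<^sup>2 / (4 * s)) ^ k /\<^sub>R fact k)" for k
  proof -
    have "norm (g k x) = \<bar>bessel_coeff \<alpha> k\<bar> * y ^ (2 * k) * (x ^ (2 * k) * exp (- s * x\<^sup>2))" for x
      by (simp add: g_def abs_mult power_mult)
    then have "(LINT x|\<mu>. norm (g k x)) = \<bar>bessel_coeff \<alpha> k\<bar> * y ^ (2 * k) * (gauss_const s * pochhammer (\<alpha> + 1) k / s ^ k)"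
      using gauss_moment[OF s] by simp
    also have "\<dots> = gauss_const s * ((y\<^sup>2) ^ k / (4 ^ k * s ^ k * fact k))"
      by (simp add: bessel_coeff_def power_mult abs_mult less_imp_le) (simp add: mult_ac)
    also have "(y\<^sup>2) ^ k / (4 ^ k * s ^ k * fact k) = (y\<^sup>2 / (4 * s)) ^ k /\<^sub>R fact k"
      by (simp add: power_divide power_mult_distrib inverse_eq_divide)
    finally show ?thesis .
  qed
  have sum: "(\<Sum>k. g k x) = exp (- s * x\<^sup>2) * bessel_j \<alpha> (y * x)" for x
  proof -
    have "(\<Sum>k. g k x) = (\<Sum>k. exp (- s * x\<^sup>2) * (bessel_coeff \<alpha> k * ((y * x)\<^sup>2) ^ k))"
      by (simp only: g_def power_mult power_mult_distrib) (simp only: mult_ac)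
    also have "\<dots> = exp (- s * x\<^sup>2) * (\<Sum>k. bessel_coeff \<alpha> k * ((y * x)\<^sup>2) ^ k)"
      by (rule suminf_mult) (rule summable_bessel)
    finally show ?thesis by (simp add: bessel_j_eq power_mult)
  qed
  have "(LINT x|\<mu>. (\<Sum>k. g k x)) = (\<Sum>k. LINT x|\<mu>. g k x)"
  proof (rule integral_suminf[OF int])
    show "AE x in \<mu>. summable (\<lambda>k. norm (g k x))"
    proof (rule AE_I2)
      fix x
      have "summable (\<lambda>k. \<bar>bessel_coeff \<alpha> k\<bar> * \<bar>(y * x)\<^sup>2\<bar> ^ k * exp (- s * x\<^sup>2))"
        by (intro summable_mult2 summable_abs_bessel)
      then show "summable (\<lambda>k. norm (g k x))"
        by (simp only: g_def power_mult power_mult_distrib real_norm_def abs_mult power_abs abs_power2 power2_abs abs_exp_cancel)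
           (simp only: mult_ac)
    qed
    show "summable (\<lambda>k. LINT x|\<mu>. norm (g k x))"
      unfolding nval by (intro summable_mult summable_exp_generic)
  qed
  also have "\<dots> = gauss_const s * exp (- y\<^sup>2 / (4 * s))"
    unfolding val exp_def by (rule suminf_mult) (rule summable_exp_generic)
  finally show ?thesis by (simp add: hankel_def sum)
qed

lemma abs_hankel_le:
  assumes "integrable \<mu> u"
  shows "\<bar>hankel u s\<bar> \<le> (LINT x|\<mu>. \<bar>u x\<bar>)"
proof -
  have "\<bar>hankel u s\<bar> \<le> (LINT x|\<mu>. \<bar>u x * bessel_j \<alpha> (s * x)\<bar>)"
    unfolding hankel_def by (rule integral_abs_bound)
  also have "\<dots> \<le> (LINT x|\<mu>. \<bar>u x\<bar>)"
    using assms abs_bessel_j_le_1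
    by (intro integral_mono integrable_abs integrable_mult_bessel) (auto simp: abs_mult mult_left_le)
  finally show ?thesis .
qed

lemma measurable_hankel [measurable]:
  assumes [measurable]: "u \<in> borel_measurable borel"
  shows "hankel u \<in> borel_measurable borel"
  unfolding hankel_def[abs_def] by measurable

text \<open>Fubini and the symmetry of the kernel \<open>bessel_j \<alpha> (x * y)\<close>. This
  moves the transform from one factor of a pairing to the other with both factors merely
  integrable.\<close>

lemma hankel_exchange:
  assumes u: "integrable \<mu> u" and v: "integrable \<mu> v"
  shows "(LINT x|\<mu>. u x * hankel v x) = (LINT x|\<mu>. v x * hankel u x)"
proof -
  have "(\<lambda>(x, y). bessel_j \<alpha> (x * y)) \<in> borel_measurable (\<mu> \<Otimes>\<^sub>M \<mu>)"
    by measurable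
  from Fubini_bounded_kernel(1)[OF sigma_finite_bk_measure sigma_finite_bk_measure u v this abs_bessel_j_le_1]
  show ?thesis by (simp add: hankel_def mult.commute[of _ "_::real"])
qed

end

section \<open>Gaussian combinations and inversion\<close>

text \<open>These are the functions \<open>exp(- x\<^sup>2) p(exp(- x\<^sup>2))\<close> with \<open>p\<close> a polynomial, so the Weierstrass theorem
  on \<open>[0, 1]\<close> applies to them.\<close>

definition gauss_comb :: "(real \<Rightarrow> real) \<Rightarrow> bool" where
  "gauss_comb G \<longleftrightarrow> (\<exists>n c. G = (\<lambda>x. \<Sum>i\<le>n. c i * exp (- (real i + 1) * x\<^sup>2)))"

lemma AE_bk_measure_if_lborel:
  assumes "AE x in lborel. P x" shows "AE x in bk_measure \<alpha>. P x"
  unfolding bk_measure_def using assms by (subst AE_density) (auto elim: eventually_mono)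

text \<open>In the variable v = exp(- x^2), Gaussian combinations are v p(v) with p a polynomial.
  Approximating k uniformly by p and multiplying by v yields an error that is itself Gaussian, which
  later supplies integrable majorants.\<close>

lemma continuous_imp_gauss_comb_approx:
  fixes k :: "real \<Rightarrow> real"
  assumes k: "continuous_on UNIV k" and supp: "\<And>x. r \<le> x \<Longrightarrow> k x = 0" and r: "0 \<le> r" and e: "0 < e"
  shows "\<exists>G. gauss_comb G \<and> (\<forall>x\<ge>0. \<bar>G x - k x * exp (- x\<^sup>2)\<bar> \<le> e * exp (- x\<^sup>2))"
proof -
  define v0 where "v0 = exp (- r\<^sup>2)"
  \<comment> \<open>This is k in the variable v. The maximum with \<open>v0\<close> freezes the
    point at x = r, where k already vanishes, and so extends the function continuously to v =
    0.\<close>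
  define q where "q v = k (sqrt (- ln (max v v0)))" for v
  have "0 < v0" by (simp add: v0_def)
  have "continuous_on {0..1} (\<lambda>v. sqrt (- ln (max v v0)))"
    using \<open>0 < v0\<close> by (intro continuous_intros) (auto simp: max_def)
  then have "continuous_on {0..1} q"
    unfolding q_def by (rule continuous_on_compose2[OF k]) auto
  then obtain p where p: "real_polynomial_function p" "\<And>v. v \<in> {0..1} \<Longrightarrow> \<bar>q v - p v\<bar> < e"
    using Stone_Weierstrass_real_polynomial_function[of "{0..1::real}" q e] e by auto
  then obtain a n where a: "p = (\<lambda>v. \<Sum>i\<le>n. a i * v ^ i)"
    by (auto simp: real_polynomial_function_iff_sum)
  define G where "G x = (\<Sum>i\<le>n. a i * exp (- (real i + 1) * x\<^sup>2))" for x
  have G: "G x = exp (- x\<^sup>2) * p (exp (- x\<^sup>2))" for x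
  proof -
    have "exp (- (real i + 1) * x\<^sup>2) = exp (- x\<^sup>2) * exp (- x\<^sup>2) ^ i" for i
      by (simp add: exp_of_nat_mult[symmetric] exp_add[symmetric] algebra_simps)
    then show ?thesis by (simp add: G_def a sum_distrib_left mult_ac)
  qed
  have "\<bar>G x - k x * exp (- x\<^sup>2)\<bar> \<le> e * exp (- x\<^sup>2)" if x: "0 \<le> x" for x
  proof -
    have "q (exp (- x\<^sup>2)) = k x"
    proof (cases "x \<le> r")
      case True
      then have "max (exp (- x\<^sup>2)) v0 = exp (- x\<^sup>2)" using x by (simp add: v0_def max_def power_mono)
      then show ?thesis using x by (simp add: q_def)
    next
      case False
      then have "max (exp (- x\<^sup>2)) v0 = v0" using r by (simp add: v0_def max_def power_mono)
      then show ?thesis using False r supp[of x] supp[of r] by (simp add: q_def v0_def)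
    qed
    then have "\<bar>k x - p (exp (- x\<^sup>2))\<bar> < e" using p(2)[of "exp (- x\<^sup>2)"] by simp
    then have "\<bar>p (exp (- x\<^sup>2)) - k x\<bar> * exp (- x\<^sup>2) \<le> e * exp (- x\<^sup>2)"
      by (intro mult_right_mono) (auto simp: abs_minus_commute)
    moreover have "G x - k x * exp (- x\<^sup>2) = (p (exp (- x\<^sup>2)) - k x) * exp (- x\<^sup>2)"
      by (simp add: G algebra_simps)
    ultimately show ?thesis by (simp add: abs_mult)
  qed
  then show ?thesis unfolding gauss_comb_def G_def[abs_def] by blast
qed

text \<open>The Gaussian bound uniform in n is the majorant for dominated convergence. One sequence
  serves every \<alpha>, because a Lebesgue null set is null for each
  \<open>bk_measure\<close>.\<close>

lemma bounded_measurable_gauss_comb_approx: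
  fixes g :: "real \<Rightarrow> real"
  assumes g: "g \<in> borel_measurable borel" "\<And>x. \<bar>g x\<bar> \<le> B" "\<And>x. x \<notin> {0..r} \<Longrightarrow> g x = 0" and r: "0 \<le> r"
  shows "\<exists>G C. (\<forall>n::nat. gauss_comb (G n)) \<and> (\<forall>n x. 0 \<le> x \<longrightarrow> \<bar>G n x\<bar> \<le> C * exp (- x\<^sup>2)) \<and>
    (\<forall>\<alpha>. AE x in bk_measure \<alpha>. (\<lambda>n. G n x) \<longlonglongrightarrow> g x)"
proof -
  note [measurable] = g(1)
  \<comment> \<open>The factor exp(x^2) compensates the factor exp(- x^2) that the approximation
    introduces.\<close>
  define g1 where "g1 x = g x * exp (x\<^sup>2)" for x
  define B1 where "B1 = B * exp (r\<^sup>2)"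
  have "0 \<le> B" using g(2)[of 0] by linarith
  have "0 \<le> B1" using \<open>0 \<le> B\<close> by (simp add: B1_def)
  have g1: "\<bar>g1 x\<bar> \<le> B1" for x
  proof (cases "x \<in> {0..r}")
    case True
    then have "\<bar>g x\<bar> * exp (x\<^sup>2) \<le> B * exp (r\<^sup>2)" using g(2)[of x] \<open>0 \<le> B\<close> by (intro mult_mono) (auto intro: power_mono)
    then show ?thesis by (simp add: g1_def B1_def abs_mult)
  qed (use g(3) \<open>0 \<le> B1\<close> in \<open>simp add: g1_def\<close>)
  have "g1 \<in> borel_measurable borel" unfolding g1_def[abs_def] by measurable
  then have "g1 \<in> borel_measurable lebesgue" by (intro measurable_completion) simp
  then have "g1 measurable_on UNIV"
    by (intro lebesgue_measurable_imp_measurable_on) auto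
  then obtain N h where N: "negligible N" and h: "\<And>n. continuous_on UNIV (h n)" "\<And>x. x \<notin> N \<Longrightarrow> (\<lambda>n. h n x) \<longlonglongrightarrow> g1 x"
    unfolding measurable_on_def by auto
  \<comment> \<open>Clamping to [- B1, B1] and cutting off continuously beyond r leaves the limit
    unchanged, since \<open>g1\<close> is bounded by \<open>B1\<close> and vanishes outside
    [0, r].\<close>
  define cut where "cut x = max 0 (min 1 (r + 1 - \<bar>x\<bar>))" for x :: real
  define k where "k n x = max (- B1) (min B1 (h n x)) * cut x" for n :: nat and x
  have kc: "continuous_on UNIV (k n)" for n
    unfolding k_def[abs_def] cut_def[abs_def] using h(1) by (intro continuous_intros) auto
  have kb: "\<bar>k n x\<bar> \<le> B1" for n x
  proof -
    have "\<bar>k n x\<bar> \<le> B1 * 1"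
      unfolding k_def abs_mult using \<open>0 \<le> B1\<close> by (intro mult_mono) (auto simp: cut_def)
    then show ?thesis by simp
  qed
  have kl: "(\<lambda>n. k n x) \<longlonglongrightarrow> g1 x" if "x \<notin> N" "0 \<le> x" for x
  proof -
    have "(\<lambda>n. k n x) \<longlonglongrightarrow> max (- B1) (min B1 (g1 x)) * cut x"
      unfolding k_def by (intro tendsto_intros h(2) that)
    moreover have "max (- B1) (min B1 (g1 x)) = g1 x" using g1[of x] by linarith
    moreover have "g1 x * cut x = g1 x"
      using that g(3)[of x] by (cases "x \<le> r") (auto simp: g1_def cut_def)
    ultimately show ?thesis by simp
  qed
  have "\<exists>G. gauss_comb G \<and> (\<forall>x\<ge>0. \<bar>G x - k n x * exp (- x\<^sup>2)\<bar> \<le> 1 / (real n + 1) * exp (- x\<^sup>2))" for n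
    using r by (intro continuous_imp_gauss_comb_approx[where r="r + 1"] kc) (auto simp: k_def cut_def)
  then obtain G where G: "\<And>n. gauss_comb (G n)"
    "\<And>n x. 0 \<le> x \<Longrightarrow> \<bar>G n x - k n x * exp (- x\<^sup>2)\<bar> \<le> 1 / (real n + 1) * exp (- x\<^sup>2)"
    by metis
  show ?thesis
  proof (intro exI[of _ G] exI[of _ "B1 + 1"] conjI allI impI)
    show "gauss_comb (G n)" for n by (rule G)
    show "\<bar>G n x\<bar> \<le> (B1 + 1) * exp (- x\<^sup>2)" if "0 \<le> x" for n x
    proof -
      have "1 / (real n + 1) * exp (- x\<^sup>2) \<le> 1 * exp (- x\<^sup>2)"
        by (intro mult_right_mono) auto
      moreover have "\<bar>k n x * exp (- x\<^sup>2)\<bar> \<le> B1 * exp (- x\<^sup>2)"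
        using kb[of n x] by (simp add: abs_mult)
      ultimately show ?thesis using G(2)[OF that, of n] unfolding ring_distribs by linarith
    qed
    fix \<alpha>
    have "AE x in lebesgue. x \<notin> N"
      using N by (intro AE_not_in) (simp add: negligible_iff_null_sets)
    then have "AE x in lborel. x \<notin> N" by (simp add: AE_completion_iff)
    then have "AE x in bk_measure \<alpha>. x \<notin> N" by (rule AE_bk_measure_if_lborel)
    then show "AE x in bk_measure \<alpha>. (\<lambda>n. G n x) \<longlonglongrightarrow> g x"
      using AE_bk_measure_nonneg
    proof eventually_elim
      case (elim x)
      have "(\<lambda>n. 1 / (real n + 1) * exp (- x\<^sup>2)) \<longlonglongrightarrow> 0 * exp (- x\<^sup>2)"
        using LIMSEQ_Suc[OF lim_1_over_n] by (intro tendsto_mult tendsto_const) (simp add: add.commute)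
      then have l0: "(\<lambda>n. 1 / (real n + 1) * exp (- x\<^sup>2)) \<longlonglongrightarrow> 0" by simp
      have "(\<lambda>n. G n x - k n x * exp (- x\<^sup>2)) \<longlonglongrightarrow> 0"
        by (rule Lim_null_comparison[OF _ l0]) (simp only: real_norm_def G(2)[OF elim(2)] eventually_True)
      moreover have "(\<lambda>n. k n x * exp (- x\<^sup>2)) \<longlonglongrightarrow> g1 x * exp (- x\<^sup>2)"
        by (intro tendsto_intros kl elim)
      ultimately have "(\<lambda>n. (G n x - k n x * exp (- x\<^sup>2)) + k n x * exp (- x\<^sup>2)) \<longlonglongrightarrow> 0 + g1 x * exp (- x\<^sup>2)"
        by (rule tendsto_add)
      moreover have "g1 x * exp (- x\<^sup>2) = g x" by (simp add: g1_def mult.assoc flip: exp_add)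
      ultimately show ?case by simp
    qed
  qed
qed

lemma measurable_gauss_comb: "gauss_comb G \<Longrightarrow> G \<in> borel_measurable borel"
  unfolding gauss_comb_def by auto

context bessel_kingman
begin

lemma integrable_gauss_comb:
  assumes "gauss_comb G" shows "integrable \<mu> G"
proof -
  obtain n c where G: "G = (\<lambda>x. \<Sum>i\<le>n. c i * exp (- (real i + 1) * x\<^sup>2))"
    using assms unfolding gauss_comb_def by blast
  show ?thesis unfolding G by (intro Bochner_Integration.integrable_sum integrable_mult_right integrable_gauss) simp
qed

lemma tendsto_integral_gauss_comb:
  assumes G: "\<And>n::nat. gauss_comb (G n)" "\<And>n x. 0 \<le> x \<Longrightarrow> \<bar>G n x\<bar> \<le> C * exp (- x\<^sup>2)"
    "AE x in \<mu>. (\<lambda>n. G n x) \<longlonglongrightarrow> g x"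
    and [measurable]: "g \<in> borel_measurable borel" 
    and D: "integrable \<mu> (\<lambda>x. D x * exp (- x\<^sup>2))" "D \<in> borel_measurable borel"
  shows "(\<lambda>n. LINT x|\<mu>. D x * G n x) \<longlonglongrightarrow> (LINT x|\<mu>. D x * g x)"
proof (rule integral_dominated_convergence)
  have [measurable]: "G n \<in> borel_measurable borel" for n by (intro measurable_gauss_comb G)
  note [measurable] = D(2)
  show "(\<lambda>x. D x * g x) \<in> borel_measurable \<mu>" by measurable
  show "(\<lambda>x. D x * G n x) \<in> borel_measurable \<mu>" for n by measurable
  show "integrable \<mu> (\<lambda>x. C * \<bar>D x * exp (- x\<^sup>2)\<bar>)" using D(1) by simp
  show "AE x in \<mu>. (\<lambda>n. D x * G n x) \<longlonglongrightarrow> D x * g x"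
    using G(3) by eventually_elim (intro tendsto_intros)
  show "AE x in \<mu>. norm (D x * G n x) \<le> C * \<bar>D x * exp (- x\<^sup>2)\<bar>" for n
    using AE_bk_measure_nonneg
  proof eventually_elim
    case (elim x)
    have "\<bar>D x\<bar> * \<bar>G n x\<bar> \<le> \<bar>D x\<bar> * (C * exp (- x\<^sup>2))" by (intro mult_left_mono G elim) auto
    then show ?case by (simp add: abs_mult mult_ac)
  qed
qed

text \<open>Gaussian combinations approximate the restriction of D to [0, n], so orthogonality makes
  the integral of D^2 over [0, n] vanish. This is the uniqueness step of the inversion
  formula.\<close>

lemma AE_zero_if_orthogonal_gauss:
  assumes D: "D \<in> borel_measurable borel" "\<And>x. \<bar>D x\<bar> \<le> B"
    and orth: "\<And>i::nat. (LINT x|\<mu>. D x * exp (- (real i + 1) * x\<^sup>2)) = 0"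
  shows "AE x in \<mu>. D x = 0"
proof -
  note [measurable] = D(1)
  have bnd: "integrable \<mu> (\<lambda>x. D x * exp (- s * x\<^sup>2))" if "0 < s" for s
    by (rule integrable_bounded_mult_gauss[OF D that])
  have orthG: "(LINT x|\<mu>. D x * G x) = 0" if G: "gauss_comb G" for G
  proof -
    obtain n c where G: "G = (\<lambda>x. \<Sum>i\<le>n. c i * exp (- (real i + 1) * x\<^sup>2))"
      using \<open>gauss_comb G\<close> unfolding gauss_comb_def by blast
    have "(LINT x|\<mu>. D x * G x) = (LINT x|\<mu>. (\<Sum>i\<le>n. c i * (D x * exp (- (real i + 1) * x\<^sup>2))))"
      by (simp add: G sum_distrib_left mult_ac)
    also have "\<dots> = (\<Sum>i\<le>n. c i * (LINT x|\<mu>. D x * exp (- (real i + 1) * x\<^sup>2)))"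
      using bnd by (subst Bochner_Integration.integral_sum) (auto intro!: integrable_mult_right simp del: minus_add_distrib mult_minus_left)
    finally show ?thesis by (simp only: orth) simp
  qed
  have "AE x in \<mu>. \<forall>n::nat. D x * (indicator {0..real n} x * D x) = 0"
  proof (subst AE_all_countable, intro allI)
    fix n :: nat
    define g where "g x = indicator {0..real n} x * D x" for x
    have "0 \<le> B" using order_trans[OF abs_ge_zero D(2)] .
    have g: "g \<in> borel_measurable borel" "\<And>x. \<bar>g x\<bar> \<le> B" "\<And>x. x \<notin> {0..real n} \<Longrightarrow> g x = 0"
    proof -
      show "g \<in> borel_measurable borel" unfolding g_def[abs_def] by measurable
      show "\<bar>g x\<bar> \<le> B" for x using D(2)[of x] \<open>0 \<le> B\<close> by (cases "x \<in> {0..real n}") (simp_all add: g_def)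
      show "g x = 0" if "x \<notin> {0..real n}" for x using that by (simp add: g_def)
    qed
    obtain G C where G: "\<And>n::nat. gauss_comb (G n)" "\<And>n x. 0 \<le> x \<Longrightarrow> \<bar>G n x\<bar> \<le> C * exp (- x\<^sup>2)"
      "AE x in \<mu>. (\<lambda>n. G n x) \<longlonglongrightarrow> g x"
      using bounded_measurable_gauss_comb_approx[OF g of_nat_0_le_iff] by blast
    have "(\<lambda>n. LINT x|\<mu>. D x * G n x) \<longlonglongrightarrow> (LINT x|\<mu>. D x * g x)"
      using bnd[of 1] by (intro tendsto_integral_gauss_comb[OF G]) (auto simp: g(1))
    then have "(LINT x|\<mu>. D x * g x) = 0"
      by (simp add: orthG[OF G(1)] LIMSEQ_const_iff)
    moreover have "integrable \<mu> (\<lambda>x. D x * g x)"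
    proof (rule integrable_bounded_on_interval[where B="B * B" and r="real n"])
      show "(\<lambda>x. D x * g x) \<in> borel_measurable borel" using g(1) by measurable
      show "\<bar>D x * g x\<bar> \<le> B * B" for x
        unfolding abs_mult using D(2) g(2) \<open>0 \<le> B\<close> by (intro mult_mono) auto
    qed (use g(3) in simp)
    moreover have "AE x in \<mu>. 0 \<le> D x * g x"
      by (auto simp: g_def indicator_def)
    ultimately show "AE x in \<mu>. D x * (indicator {0..real n} x * D x) = 0"
      using integral_nonneg_eq_0_iff_AE[of \<mu> "\<lambda>x. D x * g x"] by (simp add: g_def)
  qed
  then show ?thesis
    using AE_bk_measure_nonneg
  proof eventually_elim
    case (elim x)
    obtain n :: nat where "x \<le> real n" using real_arch_simple by blast
    with elim show ?case by (auto dest!: spec[of _ n])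
  qed
qed

section \<open>Parseval's formula and inversion\<close>

definition inv_const :: real where
  "inv_const = 4 powr \<alpha> * (Gamma (\<alpha> + 1))\<^sup>2"

lemma inv_const_pos: "0 < inv_const"
proof -
  have "0 < Gamma (\<alpha> + 1)" using half_le by (intro Gamma_real_pos) auto
  then show ?thesis by (simp add: inv_const_def)
qed

text \<open>The transform of the Gaussian with parameter a has parameter 1 / (4 a); one exchange
  applies the transform to it again, which restores the parameter a and multiplies the two
  constants.\<close>

lemma gauss_Parseval:
  assumes u: "integrable \<mu> u" and a: "0 < a"
  shows "(LINT y|\<mu>. hankel u y * hankel (\<lambda>x. exp (- a * x\<^sup>2)) y) = inv_const * (LINT x|\<mu>. u x * exp (- a * x\<^sup>2))"
proof -
  let ?b = "1 / (4 * a)"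
  have b: "0 < ?b" using a by simp
  have "(LINT y|\<mu>. hankel u y * hankel (\<lambda>x. exp (- a * x\<^sup>2)) y) =
      (LINT y|\<mu>. gauss_const a * (exp (- ?b * y\<^sup>2) * hankel u y))"
    by (simp only: hankel_gauss[OF a]) (simp add: mult_ac)
  also have "\<dots> = gauss_const a * (LINT y|\<mu>. exp (- ?b * y\<^sup>2) * hankel u y)"
    by (rule integral_mult_right_zero)
  also have "(LINT y|\<mu>. exp (- ?b * y\<^sup>2) * hankel u y) = (LINT x|\<mu>. u x * hankel (\<lambda>y. exp (- ?b * y\<^sup>2)) x)"
    by (rule hankel_exchange[OF integrable_gauss[OF b] u])
  also have "\<dots> = (LINT x|\<mu>. gauss_const ?b * (u x * exp (- a * x\<^sup>2)))"
    using a by (simp only: hankel_gauss[OF b]) (simp add: mult_ac)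
  also have "\<dots> = gauss_const ?b * (LINT x|\<mu>. u x * exp (- a * x\<^sup>2))"
    by (rule integral_mult_right_zero)
  finally show ?thesis using gauss_const_prod[OF a] by (simp add: inv_const_def flip: mult.assoc)
qed

text \<open>Nonnegativity makes the transform of a bounded function integrable, by Fatou's lemma applied to
  its pairings with ever flatter Gaussians.\<close>

theorem hankel_inversion:
  assumes h: "integrable \<mu> h" "\<And>x. \<bar>h x\<bar> \<le> B" and pos: "\<And>y. 0 \<le> y \<Longrightarrow> 0 \<le> hankel h y"
  shows "integrable \<mu> (hankel h)"
    and "AE x in \<mu>. hankel (hankel h) x = inv_const * h x"
proof -
  let ?e = "\<lambda>n y. ennreal (hankel h y * exp (- (1 / real (Suc n)) * y\<^sup>2))"
  let ?J = "LINT x|\<mu>. \<bar>hankel h x\<bar>"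
  have hm [measurable]: "h \<in> borel_measurable borel" using borel_measurable_integrable[OF h(1)] by simp
  have B: "0 \<le> B" using order_trans[OF abs_ge_zero h(2)] .
  have bound: "(\<integral>\<^sup>+ y. ennreal (hankel h y * exp (- s * y\<^sup>2)) \<partial>\<mu>) \<le> ennreal (B * inv_const)"
    if s: "0 < s" for s
  proof -
    have int: "integrable \<mu> (\<lambda>y. hankel h y * exp (- s * y\<^sup>2))"
      by (rule integrable_bounded_mult_gauss[OF _ abs_hankel_le[OF h(1)] s]) measurable
    have "(\<integral>\<^sup>+ y. ennreal (hankel h y * exp (- s * y\<^sup>2)) \<partial>\<mu>) = ennreal (LINT y|\<mu>. hankel h y * exp (- s * y\<^sup>2))"
    proof (rule nn_integral_eq_integral[OF int])
      show "AE y in \<mu>. 0 \<le> hankel h y * exp (- s * y\<^sup>2)"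
        using AE_bk_measure_nonneg by eventually_elim (simp add: pos)
    qed
    also have "(LINT y|\<mu>. hankel h y * exp (- s * y\<^sup>2)) = (LINT x|\<mu>. h x * hankel (\<lambda>y. exp (- s * y\<^sup>2)) x)"
      using hankel_exchange[OF integrable_gauss[OF s] h(1)] by (simp add: mult.commute)
    also have "\<dots> \<le> (LINT x|\<mu>. B * gauss_const s * exp (- (1 / (4 * s)) * x\<^sup>2))"
    proof (rule integral_mono)
      have e: "h x * hankel (\<lambda>y. exp (- s * y\<^sup>2)) x = gauss_const s * (h x * exp (- (1 / (4 * s)) * x\<^sup>2))" for x
        by (simp only: hankel_gauss[OF s]) simp
      show le: "h x * hankel (\<lambda>y. exp (- s * y\<^sup>2)) x \<le> B * gauss_const s * exp (- (1 / (4 * s)) * x\<^sup>2)" for x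
      proof -
        have "gauss_const s * (h x * exp (- (1 / (4 * s)) * x\<^sup>2)) \<le> gauss_const s * (B * exp (- (1 / (4 * s)) * x\<^sup>2))"
          using gauss_const_pos[OF s] abs_le_D1[OF h(2)] by (intro mult_left_mono mult_right_mono) auto
        then show ?thesis unfolding e by (simp add: mult_ac)
      qed
      show "integrable \<mu> (\<lambda>x. B * gauss_const s * exp (- (1 / (4 * s)) * x\<^sup>2))"
        using integrable_gauss[of "1 / (4 * s)"] s by simp
      show "integrable \<mu> (\<lambda>x. h x * hankel (\<lambda>y. exp (- s * y\<^sup>2)) x)"
        unfolding e using s by (intro integrable_mult_right integrable_mult_gauss h(1)) simp
    qed
    \<comment> \<open>The two constants multiply to \<open>inv_const\<close> whatever s is, so the
      bound survives the limit s to 0.\<close>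
    also have "\<dots> = B * (gauss_const s * gauss_const (1 / (4 * s)))"
      using gauss_moment(2)[of "1 / (4 * s)" 0] s by simp
    also have "\<dots> = B * inv_const" using gauss_const_prod[OF s] by (simp add: inv_const_def)
    finally show ?thesis by (simp add: ennreal_leI)
  qed
  have "(\<integral>\<^sup>+ y. ennreal (hankel h y) \<partial>\<mu>)
      = (\<integral>\<^sup>+ y. liminf (\<lambda>n. ?e n y) \<partial>\<mu>)"
  proof (rule nn_integral_cong)
    fix y
    have "(\<lambda>n. hankel h y * exp (- (1 / real (Suc n)) * y\<^sup>2)) \<longlonglongrightarrow> hankel h y * exp (- 0 * y\<^sup>2)"
      using LIMSEQ_inverse_real_of_nat by (intro tendsto_intros) (simp add: inverse_eq_divide)
    then have "(\<lambda>n. ?e n y) \<longlonglongrightarrow> ennreal (hankel h y)"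
      by (intro tendsto_ennrealI) simp
    then show "ennreal (hankel h y) = liminf (\<lambda>n. ?e n y)"
      by (rule lim_imp_Liminf[symmetric, rotated]) simp
  qed
  also have "\<dots> \<le> liminf (\<lambda>n. \<integral>\<^sup>+ y. ?e n y \<partial>\<mu>)"
    by (intro nn_integral_liminf) measurable
  also have "\<dots> \<le> liminf (\<lambda>n. ennreal (B * inv_const))"
    by (intro Liminf_mono always_eventually allI bound) simp
  also have "\<dots> < \<infinity>" by (simp add: Liminf_const)
  finally have fin: "(\<integral>\<^sup>+ y. ennreal (hankel h y) \<partial>\<mu>) < \<infinity>" .
  show int: "integrable \<mu> (hankel h)"
  proof (rule integrableI_nonneg[OF _ _ fin])
    show "AE y in \<mu>. 0 \<le> hankel h y"
      using AE_bk_measure_nonneg by eventually_elim (simp add: pos)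
  qed measurable
  \<comment> \<open>Both terms are bounded and, by \<open>gauss_Parseval\<close>, pair equally with
    every Gaussian.\<close>
  define D where "D x = hankel (hankel h) x - inv_const * h x" for x
  have [measurable]: "hankel (hankel h) \<in> borel_measurable borel" by (intro measurable_hankel hm)
  have "AE x in \<mu>. D x = 0"
  proof (rule AE_zero_if_orthogonal_gauss[where B="?J + inv_const * B"])
    show "D \<in> borel_measurable borel" unfolding D_def[abs_def] by measurable
    show "\<bar>D x\<bar> \<le> ?J + inv_const * B" for x
    proof -
      have "\<bar>inv_const * h x\<bar> \<le> inv_const * B"
        using h(2)[of x] inv_const_pos by (simp add: abs_mult)
      then show ?thesis using abs_hankel_le[OF int, of x] unfolding D_def by linarith
    qed
    fix i :: nat
    let ?a = "real i + 1"
    have a: "0 < ?a" by simp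
    have i1: "integrable \<mu> (\<lambda>x. hankel (hankel h) x * exp (- ?a * x\<^sup>2))"
      by (rule integrable_bounded_mult_gauss[OF _ abs_hankel_le[OF int] a]) measurable
    have i2: "integrable \<mu> (\<lambda>x. h x * exp (- ?a * x\<^sup>2))"
      by (rule integrable_mult_gauss[OF h(1)]) simp
    have "(LINT x|\<mu>. D x * exp (- ?a * x\<^sup>2)) =
        (LINT x|\<mu>. hankel (hankel h) x * exp (- ?a * x\<^sup>2)) - inv_const * (LINT x|\<mu>. h x * exp (- ?a * x\<^sup>2))"
      using i1 i2 unfolding D_def left_diff_distrib mult.assoc
      by (subst Bochner_Integration.integral_diff) (auto simp del: minus_add_distrib)
    also have "(LINT x|\<mu>. hankel (hankel h) x * exp (- ?a * x\<^sup>2)) = (LINT y|\<mu>. hankel h y * hankel (\<lambda>x. exp (- ?a * x\<^sup>2)) y)"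
      using hankel_exchange[OF integrable_gauss[OF a] int] by (simp add: mult.commute)
    also have "\<dots> = inv_const * (LINT x|\<mu>. h x * exp (- ?a * x\<^sup>2))"
      by (rule gauss_Parseval[OF h(1) a])
    finally show "(LINT x|\<mu>. D x * exp (- ?a * x\<^sup>2)) = 0" by simp
  qed
  then show "AE x in \<mu>. hankel (hankel h) x = inv_const * h x"
    by eventually_elim (simp add: D_def)
qed

text \<open>Linearity extends \<open>gauss_Parseval\<close>. Here u is only integrable: the
  integrable transform of G makes the left-hand pairing meaningful.\<close>

lemma gauss_comb_Parseval:
  assumes u: "integrable \<mu> u" and G: "gauss_comb G"
  shows "(LINT y|\<mu>. hankel u y * hankel G y) = inv_const * (LINT x|\<mu>. u x * G x)"
    and "integrable \<mu> (hankel G)"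
proof -
  obtain n c where G': "G = (\<lambda>x. \<Sum>i\<le>n. c i * exp (- (real i + 1) * x\<^sup>2))"
    using G unfolding gauss_comb_def by blast
  let ?g = "\<lambda>i::nat. \<lambda>x::real. exp (- (real i + 1) * x\<^sup>2)"
  have um [measurable]: "u \<in> borel_measurable borel" using borel_measurable_integrable[OF u] by simp
  have ig: "integrable \<mu> (?g i)" for i by (rule integrable_gauss) simp
  have hG: "hankel G y = (\<Sum>i\<le>n. c i * hankel (?g i) y)" for y
    unfolding hankel_def G' sum_distrib_right mult.assoc
    by (subst Bochner_Integration.integral_sum)
       (intro integrable_mult_right integrable_mult_bessel[OF ig], simp only: integral_mult_right_zero)
  have ihg: "integrable \<mu> (hankel (?g i))" for i
  proof -
    have "hankel (?g i) = (\<lambda>y. gauss_const (real i + 1) * exp (- (1 / (4 * (real i + 1))) * y\<^sup>2))"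
      by (rule ext) (subst hankel_gauss, auto)
    moreover have "integrable \<mu> (\<lambda>y. exp (- (1 / (4 * (real i + 1))) * y\<^sup>2))"
      by (rule integrable_gauss) simp
    ultimately show ?thesis by simp
  qed
  show ih: "integrable \<mu> (hankel G)"
    unfolding hG[abs_def] using ihg by (intro Bochner_Integration.integrable_sum integrable_mult_right)
  have i1: "integrable \<mu> (\<lambda>y. hankel u y * hankel (?g i) y)" for i
    by (rule integrable_bounded_mult(2)[OF ihg _ abs_hankel_le[OF u]]) measurable
  have i2: "integrable \<mu> (\<lambda>x. u x * ?g i x)" for i
    by (rule integrable_mult_gauss[OF u]) simp
  have "(LINT y|\<mu>. hankel u y * hankel G y) = (LINT y|\<mu>. (\<Sum>i\<le>n. c i * (hankel u y * hankel (?g i) y)))"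
    by (simp only: hG sum_distrib_left mult.left_commute)
  also have "\<dots> = (\<Sum>i\<le>n. c i * (LINT y|\<mu>. hankel u y * hankel (?g i) y))"
    using i1 by (subst Bochner_Integration.integral_sum) (auto intro!: integrable_mult_right simp del: minus_add_distrib)
  also have "\<dots> = (\<Sum>i\<le>n. c i * (inv_const * (LINT x|\<mu>. u x * ?g i x)))"
    by (intro sum.cong refl arg_cong2[where f="(*)"] gauss_Parseval[OF u]) simp
  also have "\<dots> = inv_const * (\<Sum>i\<le>n. LINT x|\<mu>. c i * (u x * ?g i x))"
    by (simp add: sum_distrib_left mult_ac)
  also have "(\<Sum>i\<le>n. LINT x|\<mu>. c i * (u x * ?g i x)) = (LINT x|\<mu>. (\<Sum>i\<le>n. c i * (u x * ?g i x)))"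
    using i2 by (intro Bochner_Integration.integral_sum[symmetric] integrable_mult_right) auto
  also have "\<dots> = (LINT x|\<mu>. u x * G x)"
    by (simp only: G' sum_distrib_left mult.left_commute)
  finally show "(LINT y|\<mu>. hankel u y * hankel G y) = inv_const * (LINT x|\<mu>. u x * G x)" .
qed

end

section \<open>Almost orthogonality across cells\<close>

lemma bk_I_Suc: "bk_I (Suc k) = {real k..<real k + 1}"
  by (auto simp: bk_I_def)

lemma sets_bk_I [measurable]: "bk_I n \<in> sets borel"
  by (simp add: bk_I_def)

lemma nn_integral_powr_exp:
  fixes p w :: real
  assumes "0 < p" "0 < w"
  shows "(\<integral>\<^sup>+ y. ennreal (indicator {0..} y * y powr (p - 1) * exp (- w * y)) \<partial>lborel) = ennreal (Gamma p * w powr (- p))"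
proof -
  let ?a = "\<lambda>y. indicator {0..} (0 + w * y) * (0 + w * y) powr (p - 1) / exp (0 + w * y)"
  let ?b = "\<lambda>y. indicator {0..} y * y powr (p - 1) * exp (- w * y)"
  let ?I = "\<integral>\<^sup>+ y. ennreal (?b y) \<partial>lborel"
  have "ennreal (Gamma p) = (\<integral>\<^sup>+ t. ennreal (indicator {0..} t * t powr (p - 1) / exp t) \<partial>lborel)"
    by (rule Gamma_conv_nn_integral_real) fact
  also have "\<dots> = ennreal \<bar>w\<bar> * (\<integral>\<^sup>+ y. ennreal (?a y) \<partial>lborel)"
    using assms by (intro nn_integral_real_affine) auto
  also have "(\<integral>\<^sup>+ y. ennreal (?a y) \<partial>lborel)
      = (\<integral>\<^sup>+ y. ennreal (w powr (p - 1)) * ennreal (?b y) \<partial>lborel)"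
  proof (rule nn_integral_cong)
    fix y :: real
    have "?a y
      = w powr (p - 1) * (?b y)"
      using assms by (auto simp: powr_mult exp_minus zero_le_mult_iff divide_inverse split: split_indicator)
    then show "ennreal (?a y)
      = ennreal (w powr (p - 1)) * ennreal (?b y)"
      by (simp add: ennreal_mult')
  qed
  also have "\<dots> = ennreal (w powr (p - 1)) * ?I" by (rule nn_integral_cmult) measurable
  also have "ennreal \<bar>w\<bar> * (ennreal (w powr (p - 1)) * ?I) = ennreal (w powr p) * ?I"
  proof -
    have "w powr p = w * w powr (p - 1)" using assms powr_add[of w "p - 1" 1] by simp
    then show ?thesis using assms by (simp add: ennreal_mult' flip: mult.assoc)
  qed
  finally have "ennreal (w powr (- p)) * ennreal (Gamma p) = ennreal (w powr (- p)) * ennreal (w powr p) * ?I"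
    by (simp add: mult.assoc)
  also have "ennreal (w powr (- p)) * ennreal (w powr p) = 1"
    using assms by (simp add: powr_minus flip: ennreal_mult')
  finally show ?thesis using assms by (simp add: ennreal_mult'' mult.commute)
qed

text \<open>The exponent is |k - m|, written so that natural subtraction does not truncate. Each
  side of m contributes a geometric sum of at most 2.\<close>

lemma sum_geometric_half_le:
  assumes "finite A" shows "(\<Sum>k\<in>A. (1/2::real) ^ (max k m - min k m)) \<le> 4"
proof -
  obtain n where n: "A \<subseteq> {..<m} \<union> {m..<m + n}"
  proof -
    obtain b where "A \<subseteq> {..<b}" using assms finite_nat_iff_bounded by auto
    then have "A \<subseteq> {..<m} \<union> {m..<m + b}" by (auto simp: subset_iff)
    then show thesis by (rule that)
  qed
  have geo: "(\<Sum>i<n. (1/2::real) ^ i) \<le> 2" for n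
  proof -
    have "(\<Sum>i<n. (1/2::real) ^ i) = ((1/2) ^ n - 1) / (1/2 - 1)" by (rule geometric_sum) simp
    also have "\<dots> = 2 - 2 * (1/2) ^ n" by simp
    also have "\<dots> \<le> 2" by simp
    finally show ?thesis .
  qed
  have "(\<Sum>k\<in>A. (1/2::real) ^ (max k m - min k m)) \<le> (\<Sum>k\<in>{..<m} \<union> {m..<m + n}. (1/2) ^ (max k m - min k m))"
    by (rule sum_mono2) (use n in auto)
  also have "\<dots> = (\<Sum>k<m. (1/2) ^ (m - k)) + (\<Sum>k\<in>{m..<m + n}. (1/2) ^ (k - m))"
    by (subst sum.union_disjoint) (auto intro!: sum.cong arg_cong2[where f="(+)"] simp: max_def min_def)
  also have "(\<Sum>k<m. (1/2::real) ^ (m - k)) \<le> (\<Sum>k<m. (1/2) ^ (m - Suc k))"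
    by (intro sum_mono power_decreasing) auto
  also have "\<dots> = (\<Sum>k<m. (1/2) ^ k)" by (rule sum.nat_diff_reindex)
  also have "\<dots> \<le> 2" by (rule geo)
  also have "(\<Sum>k\<in>{m..<m + n}. (1/2::real) ^ (k - m)) = (\<Sum>k<n. (1/2) ^ k)"
    by (rule sum.reindex_bij_witness[of _ "\<lambda>k. k + m" "\<lambda>k. k - m"]) auto
  also have "\<dots> \<le> 2" by (rule geo)
  finally show ?thesis by simp
qed

text \<open>Schur's test: a product is at most half the sum of the squares, the matrix is symmetric,
  and its row sums are at most 4.\<close>

lemma Schur_geometric:
  fixes a :: "nat \<Rightarrow> real"
  assumes "finite A"
  shows "(\<Sum>k\<in>A. \<Sum>m\<in>A. (1/2) ^ (max k m - min k m) * (a k * a m)) \<le> 4 * (\<Sum>k\<in>A. (a k)\<^sup>2)"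
proof -
  let ?t = "\<lambda>k m. (1/2::real) ^ (max k m - min k m)"
  have "(\<Sum>k\<in>A. \<Sum>m\<in>A. ?t k m * (a k * a m)) \<le> (\<Sum>k\<in>A. \<Sum>m\<in>A. ?t k m * ((a k)\<^sup>2 / 2) + ?t k m * ((a m)\<^sup>2 / 2))"
  proof (intro sum_mono)
    fix k m
    have "a k * a m \<le> (a k)\<^sup>2 / 2 + (a m)\<^sup>2 / 2" using sum_squares_bound[of "a k" "a m"] by simp
    then have "?t k m * (a k * a m) \<le> ?t k m * ((a k)\<^sup>2 / 2 + (a m)\<^sup>2 / 2)" by (intro mult_left_mono) auto
    then show "?t k m * (a k * a m) \<le> ?t k m * ((a k)\<^sup>2 / 2) + ?t k m * ((a m)\<^sup>2 / 2)" by (simp only: distrib_left)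
  qed
  also have "\<dots> = (\<Sum>k\<in>A. \<Sum>m\<in>A. ?t k m * ((a k)\<^sup>2 / 2)) + (\<Sum>m\<in>A. \<Sum>k\<in>A. ?t k m * ((a m)\<^sup>2 / 2))"
    unfolding sum.distrib by (rule arg_cong2[where f="(+)", OF refl sum.swap])
  also have "\<dots> = 2 * (\<Sum>k\<in>A. (\<Sum>m\<in>A. ?t m k) * ((a k)\<^sup>2 / 2))"
    by (simp only: sum_distrib_right max.commute min.commute mult_2)
  also have "\<dots> \<le> 2 * (\<Sum>k\<in>A. 4 * ((a k)\<^sup>2 / 2))"
    by (intro mult_left_mono sum_mono mult_right_mono sum_geometric_half_le assms) auto
  also have "\<dots> = 4 * (\<Sum>k\<in>A. (a k)\<^sup>2)" by (simp add: sum_distrib_left)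
  finally show ?thesis .
qed

context bessel_kingman
begin

section \<open>Measures of the cells and kernels of multipliers\<close>

lemma emeasure_bk_I_bounds:
  "ennreal (real k powr (2 * \<alpha> + 1)) \<le> emeasure \<mu> (bk_I (Suc k))"
  "emeasure \<mu> (bk_I (Suc k)) \<le> ennreal ((real k + 1) powr (2 * \<alpha> + 1))"
proof -
  let ?c = "2 * \<alpha> + 1"
  have em: "emeasure \<mu> (bk_I (Suc k)) = (\<integral>\<^sup>+ x. ennreal (indicator {0..} x * x powr ?c) * indicator (bk_I (Suc k)) x \<partial>lborel)"
    unfolding bk_measure_def by (rule emeasure_density) auto
  have l: "emeasure lborel (bk_I (Suc k)) = 1" by (simp add: bk_I_Suc)
  have "ennreal (real k powr ?c) = (\<integral>\<^sup>+ x. ennreal (real k powr ?c) * indicator (bk_I (Suc k)) x \<partial>lborel)"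
    by (subst nn_integral_cmult_indicator) (auto simp: l)
  also have "\<dots> \<le> emeasure \<mu> (bk_I (Suc k))"
    unfolding em using half_le
    by (intro nn_integral_mono) (auto simp: bk_I_Suc intro!: ennreal_leI powr_mono2 split: split_indicator)
  finally show "ennreal (real k powr ?c) \<le> emeasure \<mu> (bk_I (Suc k))" .
  have "emeasure \<mu> (bk_I (Suc k)) \<le> (\<integral>\<^sup>+ x. ennreal ((real k + 1) powr ?c) * indicator (bk_I (Suc k)) x \<partial>lborel)"
    unfolding em using half_le
    by (intro nn_integral_mono) (auto simp: bk_I_Suc intro!: ennreal_leI powr_mono2 split: split_indicator)
  also have "\<dots> = ennreal ((real k + 1) powr ?c)"
    by (subst nn_integral_cmult_indicator) (auto simp: l)
  finally show "emeasure \<mu> (bk_I (Suc k)) \<le> ennreal ((real k + 1) powr ?c)" .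
qed

lemma emeasure_bk_I: "emeasure \<mu> (bk_I (Suc k)) = ennreal (bk_omega \<alpha> (Suc k))"
  using emeasure_bk_I_bounds(2)[of k] unfolding bk_omega_def
  by (intro emeasure_eq_ennreal_measure) (auto simp: top_unique)

lemma bk_omega_bounds:
  "real k powr (2 * \<alpha> + 1) \<le> bk_omega \<alpha> (Suc k)" "bk_omega \<alpha> (Suc k) \<le> (real k + 1) powr (2 * \<alpha> + 1)"
  using emeasure_bk_I_bounds[of k] unfolding emeasure_bk_I
  by (simp_all add: bk_omega_def)

lemma integrable_indicator_bk_I: "integrable \<mu> (\<lambda>x. indicator (bk_I (Suc k)) x :: real)"
  by (subst integrable_indicator_iff) (auto simp: emeasure_bk_I)

text \<open>Multiplication by g seen from the transform side: pairing two transforms with weight g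
  is the double integral of the original functions against this kernel.\<close>

definition kern :: "(real \<Rightarrow> real) \<Rightarrow> real \<Rightarrow> real \<Rightarrow> real" where
  "kern g l m = (LINT x|\<mu>. g x * bessel_j \<alpha> (l * x) * bessel_j \<alpha> (m * x))"

lemma measurable_kern [measurable]:
  assumes [measurable]: "g \<in> borel_measurable borel"
  shows "(\<lambda>z. kern g (fst z) (snd z)) \<in> borel_measurable (borel \<Otimes>\<^sub>M borel)"
  unfolding kern_def by measurable

lemma abs_kern_le:
  assumes "integrable \<mu> g"
  shows "\<bar>kern g l m\<bar> \<le> (LINT x|\<mu>. \<bar>g x\<bar>)"
proof -
  have "kern g l m = hankel (\<lambda>x. g x * bessel_j \<alpha> (l * x)) m" by (simp add: kern_def hankel_def)
  also have "\<bar>\<dots>\<bar> \<le> (LINT x|\<mu>. \<bar>g x * bessel_j \<alpha> (l * x)\<bar>)"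
    by (intro abs_hankel_le integrable_mult_bessel assms)
  also have "\<dots> \<le> (LINT x|\<mu>. \<bar>g x\<bar>)"
    using assms abs_bessel_j_le_1
    by (intro integral_mono integrable_abs integrable_mult_bessel) (auto simp: abs_mult mult_left_le)
  finally show ?thesis .
qed

text \<open>The product formula and Fubini. In hypergroup terms this is the generalized translate of
  \<open>hankel g\<close>, so nonnegativity and bounds of \<open>hankel g\<close> on chord lengths
  carry over to the kernel.\<close>

theorem kern_eq_gegen:
  assumes g: "integrable \<mu> g"
  shows "kern g l m = (LINT t|\<nu>. hankel g (sqrt (l\<^sup>2 + m\<^sup>2 - 2 * l * m * t)))"
proof -
  let ?d = "\<lambda>t. sqrt (l\<^sup>2 + m\<^sup>2 - 2 * l * m * t)"
  have [measurable]: "g \<in> borel_measurable borel" using borel_measurable_integrable[OF g] by simp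
  have prod: "bessel_j \<alpha> (l * x) * bessel_j \<alpha> (m * x) =
      (LINT t|\<nu>. bessel_j \<alpha> (?d t * x))" for x
  proof -
    have "(l * x)\<^sup>2 + (m * x)\<^sup>2 - 2 * (l * x) * (m * x) * t = (l\<^sup>2 + m\<^sup>2 - 2 * l * m * t) * x\<^sup>2" for t
      by (simp add: power_mult_distrib algebra_simps power2_eq_square)
    then have *: "sqrt ((l * x)\<^sup>2 + (m * x)\<^sup>2 - 2 * (l * x) * (m * x) * t) = ?d t * \<bar>x\<bar>" for t
      by (simp only: real_sqrt_mult real_sqrt_abs)
    have "bessel_j \<alpha> (c * \<bar>x\<bar>) = bessel_j \<alpha> (c * x)" for c
      using bessel_j_minus[of "c * x"] by (simp add: abs_if)
    then show ?thesis by (simp only: bessel_j_product *)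
  qed
  have "kern g l m = (LINT x|\<mu>. g x * (LINT t|\<nu>. 1 * bessel_j \<alpha> (?d t * x)))"
    by (simp only: kern_def mult.assoc prod mult_1_left)
  also have "\<dots> = (LINT t|\<nu>. 1 * (LINT x|\<mu>. g x * bessel_j \<alpha> (?d t * x)))"
    by (rule Fubini_bounded_kernel(1)[where B=1])
       (auto intro!: g sigma_finite_bk_measure gegen.sigma_finite_measure_axioms abs_bessel_j_le_1)
  finally show ?thesis by (simp add: hankel_def)
qed

lemma hankel_mult_hankel:
  assumes g: "integrable \<mu> g" and w: "integrable \<mu> w"
  shows "hankel (\<lambda>x. g x * hankel w x) l = (LINT m|\<mu>. w m * kern g l m)"
proof -
  have jm: "(\<lambda>(x, y). bessel_j \<alpha> (x * y)) \<in> borel_measurable (\<mu> \<Otimes>\<^sub>M \<mu>)"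
    by measurable
  have "hankel (\<lambda>x. g x * hankel w x) l =
      (LINT x|\<mu>. (g x * bessel_j \<alpha> (l * x)) * (LINT m|\<mu>. w m * bessel_j \<alpha> (x * m)))"
    by (simp add: hankel_def mult_ac)
  also have "\<dots> = (LINT m|\<mu>. w m * (LINT x|\<mu>. (g x * bessel_j \<alpha> (l * x)) * bessel_j \<alpha> (x * m)))"
    by (rule Fubini_bounded_kernel(1)[OF sigma_finite_bk_measure sigma_finite_bk_measure integrable_mult_bessel[OF g] w jm abs_bessel_j_le_1])
  finally show ?thesis by (simp add: kern_def mult.commute)
qed

lemma integral_hankel_mult_hankel:
  assumes g: "integrable \<mu> g" and v: "integrable \<mu> v" and w: "integrable \<mu> w"
  shows "(LINT x|\<mu>. g x * hankel v x * hankel w x) =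
    (LINT l|\<mu>. v l * (LINT m|\<mu>. w m * kern g l m))"
proof -
  have [measurable]: "w \<in> borel_measurable borel" using borel_measurable_integrable[OF w] by simp
  have gw: "integrable \<mu> (\<lambda>x. g x * hankel w x)"
    by (rule integrable_bounded_mult(1)[OF g _ abs_hankel_le[OF w]]) measurable
  have "(LINT x|\<mu>. g x * hankel v x * hankel w x) = (LINT x|\<mu>. (g x * hankel w x) * hankel v x)"
    by (simp add: mult_ac)
  also have "\<dots> = (LINT l|\<mu>. v l * hankel (\<lambda>x. g x * hankel w x) l)"
    by (rule hankel_exchange[OF gw v])
  finally show ?thesis by (simp only: hankel_mult_hankel[OF g w])
qed

end

text \<open>The index is the integer part of l. The last conclusion collapses a sum over cells to
  the single cell containing l.\<close>

lemma bk_I_partition: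
  assumes "1 \<le> l" "l < real R"
  obtains k where "k \<in> {1..<R}" "l \<in> bk_I (Suc k)"
    "\<And>X :: nat \<Rightarrow> real. (\<Sum>i\<in>{1..<R}. indicator (bk_I (Suc i)) l * X i) = X k"
proof -
  define k where "k = nat \<lfloor>l\<rfloor>"
  have k: "real k \<le> l" "l < real k + 1" unfolding k_def using assms by linarith+
  have kR: "k \<in> {1..<R}"
  proof -
    have "real k < real R" using k assms by linarith
    moreover have "0 < real k" using k assms by linarith
    ultimately show ?thesis by simp
  qed
  have ind: "indicator (bk_I (Suc i)) l = (if i = k then 1 else 0 :: real)" for i
  proof (cases "i = k")
    case False
    then have "real i + 1 \<le> real k \<or> real k + 1 \<le> real i" by linarith
    then show ?thesis using k False by (auto simp: bk_I_Suc indicator_def)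
  qed (use k in \<open>simp add: bk_I_Suc\<close>)
  show thesis
  proof (rule that[of k])
    show "(\<Sum>i\<in>{1..<R}. indicator (bk_I (Suc i)) l * X i) = X k" for X :: "nat \<Rightarrow> real"
    proof -
      have "(\<Sum>i\<in>{1..<R}. indicator (bk_I (Suc i)) l * X i) = (\<Sum>i\<in>{1..<R}. if i = k then X i else 0)"
        by (intro sum.cong refl) (simp add: ind)
      also have "\<dots> = X k" using kR by (subst sum.delta) auto
      finally show ?thesis .
    qed
  qed (use kR k in \<open>auto simp: bk_I_Suc\<close>)
qed

context bessel_kingman
begin

text \<open>Cell \<open>k\<close> is \<open>I\<^sub>k\<^sub>+\<^sub>1 = [k, k + 1)\<close>. The energy leaves out cell \<open>0\<close>, where the bound for the
  Gaussian kernel blows up.\<close>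

definition cell_int :: "(real \<Rightarrow> real) \<Rightarrow> nat \<Rightarrow> real" where
  "cell_int v k = (LINT x|\<mu>. v x * indicator (bk_I (Suc k)) x)"

definition cell_energy :: "(real \<Rightarrow> real) \<Rightarrow> nat \<Rightarrow> real" where
  "cell_energy v R = (\<Sum>k\<in>{1..<R}. (cell_int v k)\<^sup>2 / bk_omega \<alpha> (Suc k))"

lemma integrable_cell:
  fixes v :: "real \<Rightarrow> real"
  assumes "integrable \<mu> v"
  shows "integrable \<mu> (\<lambda>x. v x * indicator (bk_I (Suc k)) x)"
  using integrable_mult_indicator[of "bk_I (Suc k)" \<mu> v] assms by (simp add: mult.commute)

text \<open>As v is nonnegative, a cellwise constant majorant of the kernel turns the double
  integral into a finite quadratic form in the cell integrals. The constants may be negative: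
  applied to the negative of a kernel, the lemma gives lower bounds.\<close>

lemma integral_kern_le:
  assumes g: "integrable \<mu> g" and v: "integrable \<mu> v"
    and vpos: "\<And>x. 0 \<le> v x" and supp: "\<And>x. x \<notin> {1..<real R} \<Longrightarrow> v x = 0"
    and le: "\<And>k m x y. k \<in> {1..<R} \<Longrightarrow> m \<in> {1..<R} \<Longrightarrow> x \<in> bk_I (Suc k) \<Longrightarrow> y \<in> bk_I (Suc m) \<Longrightarrow> kern g x y \<le> c k m"
  shows "(LINT x|\<mu>. v x * (LINT y|\<mu>. v y * kern g x y))
     \<le> (\<Sum>k\<in>{1..<R}. \<Sum>m\<in>{1..<R}. c k m * (cell_int v k * cell_int v m))"
proof -
  let ?s = "\<lambda>k. \<Sum>m\<in>{1..<R}. c k m * cell_int v m"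
  let ?L = "\<lambda>x. LINT y|\<mu>. v y * kern g x y"
  have [measurable]: "g \<in> borel_measurable borel" "v \<in> borel_measurable borel"
    using borel_measurable_integrable[OF g] borel_measurable_integrable[OF v] by simp_all
  have km: "case_prod (kern g) \<in> borel_measurable (\<mu> \<Otimes>\<^sub>M \<mu>)"
    by (simp add: case_prod_beta' measurable_kern cong: measurable_cong_sets)
  note F = Fubini_bounded_kernel[OF sigma_finite_bk_measure sigma_finite_bk_measure v v km abs_kern_le[OF g]]
  have iv: "integrable \<mu> (\<lambda>y. v y * kern g x y)" for x
  proof (rule integrable_bounded_mult(1)[OF v _ abs_kern_le[OF g]])
    show "kern g x \<in> borel_measurable borel" unfolding kern_def by measurable
  qed
  have inner: "?L x \<le> ?s k"
    if k: "k \<in> {1..<R}" "x \<in> bk_I (Suc k)" for k x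
  proof -
    have "?L x \<le> (LINT y|\<mu>. (\<Sum>m\<in>{1..<R}. c k m * (v y * indicator (bk_I (Suc m)) y)))"
    proof (rule integral_mono[OF iv])
      show "integrable \<mu> (\<lambda>y. \<Sum>m\<in>{1..<R}. c k m * (v y * indicator (bk_I (Suc m)) y))"
        by (intro Bochner_Integration.integrable_sum integrable_mult_right integrable_cell v)
      fix y
      show "v y * kern g x y \<le> (\<Sum>m\<in>{1..<R}. c k m * (v y * indicator (bk_I (Suc m)) y))"
      proof (cases "y \<in> {1..<real R}")
        case True
        then obtain m where m: "m \<in> {1..<R}" "y \<in> bk_I (Suc m)"
          "\<And>X :: nat \<Rightarrow> real. (\<Sum>i\<in>{1..<R}. indicator (bk_I (Suc i)) y * X i) = X m"
          using bk_I_partition[of y R] by auto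
        have "v y * kern g x y \<le> v y * c k m" using le[OF k(1) m(1) k(2) m(2)] vpos by (intro mult_left_mono)
        also have "\<dots> = (\<Sum>m\<in>{1..<R}. indicator (bk_I (Suc m)) y * (v y * c k m))" by (rule m(3)[symmetric])
        finally show ?thesis by (simp add: mult_ac)
      qed (simp add: supp)
    qed
    also have "\<dots> = ?s k"
      unfolding cell_int_def
      by (subst Bochner_Integration.integral_sum) (intro integrable_mult_right integrable_cell v, simp)
    finally show ?thesis .
  qed
  have "(LINT x|\<mu>. v x * ?L x) \<le>
     (LINT x|\<mu>. (\<Sum>k\<in>{1..<R}. ?s k * (v x * indicator (bk_I (Suc k)) x)))"
  proof (rule integral_mono[OF F(2)])
    show "integrable \<mu> (\<lambda>x. \<Sum>k\<in>{1..<R}. ?s k * (v x * indicator (bk_I (Suc k)) x))"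
      by (intro Bochner_Integration.integrable_sum integrable_mult_right integrable_cell v)
    fix x
    show "v x * ?L x \<le> (\<Sum>k\<in>{1..<R}. ?s k * (v x * indicator (bk_I (Suc k)) x))"
    proof (cases "x \<in> {1..<real R}")
      case True
      then obtain k where k: "k \<in> {1..<R}" "x \<in> bk_I (Suc k)"
        "\<And>X :: nat \<Rightarrow> real. (\<Sum>i\<in>{1..<R}. indicator (bk_I (Suc i)) x * X i) = X k"
        using bk_I_partition[of x R] by auto
      have "v x * ?L x \<le> v x * ?s k"
        using inner[OF k(1,2)] vpos by (intro mult_left_mono)
      also have "\<dots> = (\<Sum>k\<in>{1..<R}. indicator (bk_I (Suc k)) x * (v x * ?s k))" by (rule k(3)[symmetric])
      finally show ?thesis by (simp add: mult_ac)
    qed (simp add: supp)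
  qed
  also have "\<dots> = (\<Sum>k\<in>{1..<R}. ?s k * cell_int v k)"
    unfolding cell_int_def
    by (subst Bochner_Integration.integral_sum) (intro integrable_mult_right integrable_cell v, simp)
  also have "\<dots> = (\<Sum>k\<in>{1..<R}. \<Sum>m\<in>{1..<R}. c k m * (cell_int v k * cell_int v m))"
    by (simp add: sum_distrib_left sum_distrib_right mult_ac)
  finally show ?thesis .
qed

section \<open>Cell bounds for the Gaussian kernel\<close>

lemma gegen_weight_le_powr:
  assumes "t \<in> {-1..1}"
  shows "gegen_weight t \<le> 2 powr (\<alpha> - 1/2) * (1 - t) powr (\<alpha> - 1/2)"
proof -
  have "1 - t\<^sup>2 = (1 + t) * (1 - t)" by (simp add: algebra_simps power2_eq_square)
  also have "\<dots> \<le> 2 * (1 - t)" using assms by (intro mult_right_mono) auto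
  finally have "(1 - t\<^sup>2) powr (\<alpha> - 1/2) \<le> (2 * (1 - t)) powr (\<alpha> - 1/2)"
    using assms half_le by (intro powr_mono2) (auto simp: abs_square_le_1 abs_le_iff)
  then show ?thesis using assms unfolding powr_mult by (simp add: gegen_weight_def)
qed

text \<open>The mass sits near t = 1. With 1 - t^2 <= 2 (1 - t) and y = 1 - t the integral is
  enlarged to the half-line y >= 0, where it is a Gamma integral.\<close>

lemma gegen_integral_exp_le:
  assumes w: "0 < w"
  shows "(LINT t|\<nu>. exp (- w * (1 - t))) \<le>
    2 powr (\<alpha> - 1/2) * Gamma (\<alpha> + 1/2) / gegen_norm \<alpha> * w powr (- (\<alpha> + 1/2))"
proof -
  let ?p = "\<alpha> + 1/2"
  let ?h = "\<lambda>t::real. indicator {0..} (1 + - 1 * t) * (1 + - 1 * t) powr (?p - 1) * exp (- w * (1 + - 1 * t))"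
  let ?g = "\<lambda>t. gegen_weight t * exp (- w * (1 - t))"
  have "ennreal (LINT t|lborel. ?g t) = (\<integral>\<^sup>+ t. ennreal (?g t) \<partial>lborel)"
  proof (rule nn_integral_eq_integral[symmetric])
    show "AE t in lborel. 0 \<le> ?g t" by (simp add: gegen_weight_nonneg)
    show "integrable lborel (\<lambda>t. ?g t)"
    proof (rule Bochner_Integration.integrable_bound)
      show "integrable lborel (indicator {-1..1} :: real \<Rightarrow> real)" by simp
      show "AE t in lborel. norm (?g t) \<le> norm (indicator {-1..1} t :: real)"
      proof (rule AE_I2)
        fix t :: real
        show "norm (?g t) \<le> norm (indicator {-1..1} t :: real)"
        proof (cases "t \<in> {-1..1}")
          case True
          then have "?g t \<le> 1 * 1"
            using gegen_weight_le[of t] gegen_weight_nonneg w by (intro mult_mono) auto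
          then show ?thesis using True gegen_weight_nonneg[of t] by (simp add: abs_mult)
        qed (simp add: gegen_weight_def)
      qed
    qed measurable
  qed
  also have "\<dots> \<le> (\<integral>\<^sup>+ t. ennreal (2 powr (\<alpha> - 1/2)) * ennreal (?h t) \<partial>lborel)"
  proof (rule nn_integral_mono)
    fix t :: real
    have "?g t \<le> 2 powr (\<alpha> - 1/2) * (?h t)"
    proof (cases "t \<in> {-1..1}")
      case True
      then have "?g t \<le> (2 powr (\<alpha> - 1/2) * (1 - t) powr (\<alpha> - 1/2)) * exp (- w * (1 - t))"
        by (intro mult_right_mono gegen_weight_le_powr) auto
      then show ?thesis using True by (simp add: mult.assoc)
    qed (simp add: gegen_weight_def)
    then show "ennreal (?g t) \<le> ennreal (2 powr (\<alpha> - 1/2)) * ennreal (?h t)"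
      by (simp add: ennreal_leI flip: ennreal_mult')
  qed
  also have "\<dots> = ennreal (2 powr (\<alpha> - 1/2)) * (\<integral>\<^sup>+ t. ennreal (?h t) \<partial>lborel)"
    by (rule nn_integral_cmult) measurable
  also have "(\<integral>\<^sup>+ t. ennreal (?h t) \<partial>lborel)
     = (\<integral>\<^sup>+ y. ennreal (indicator {0..} y * y powr (?p - 1) * exp (- w * y)) \<partial>lborel)"
    by (subst (2) nn_integral_real_affine[where c="-1" and t=1]) auto
  also have "\<dots> = ennreal (Gamma ?p * w powr (- ?p))"
    using half_le w by (intro nn_integral_powr_exp) auto
  also have "ennreal (2 powr (\<alpha> - 1/2)) * \<dots> = ennreal (2 powr (\<alpha> - 1/2) * (Gamma ?p * w powr (- ?p)))"
    by (simp add: ennreal_mult')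
  finally have "(LINT t|lborel. ?g t) \<le> 2 powr (\<alpha> - 1/2) * (Gamma ?p * w powr (- ?p))"
    using half_le by (subst (asm) ennreal_le_iff) (auto intro!: mult_nonneg_nonneg less_imp_le[OF Gamma_real_pos])
  then have "(LINT t|lborel. ?g t) / gegen_norm \<alpha> \<le> 2 powr (\<alpha> - 1/2) * (Gamma ?p * w powr (- ?p)) / gegen_norm \<alpha>"
    using gegen_norm_pos by (intro divide_right_mono) auto
  then show ?thesis by (simp add: integral_gegen)
qed

definition kern_const :: real where
  "kern_const = Gamma (\<alpha> + 1) * 2 powr (2 * \<alpha>) * Gamma (\<alpha> + 1/2) / (2 * gegen_norm \<alpha>)"

lemma kern_const_pos: "0 < kern_const"
  unfolding kern_const_def using half_le gegen_norm_pos
  by (intro divide_pos_pos mult_pos_pos Gamma_real_pos) auto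

text \<open>Splitting the squared chord as (l - m)^2 + 2 l m (1 - t) separates the exponential in l
  - m from an average of the preceding type with w = l m / (2 s). The powers s^(-(\<alpha> + 1)) and
  s^(\<alpha> + 1/2) combine to s^(-1/2).\<close>

lemma kern_gauss_le:
  assumes s: "0 < s" and lm: "0 < l" "0 < m"
  shows "kern (\<lambda>x. exp (- s * x\<^sup>2)) l m \<le>
    kern_const * s powr (- 1/2) * (l powr (- (\<alpha> + 1/2)) * m powr (- (\<alpha> + 1/2))) * exp (- (l - m)\<^sup>2 / (4 * s))"
proof -
  let ?w = "l * m / (2 * s)" and ?p = "\<alpha> + 1/2"
  let ?e = "exp (- (l - m)\<^sup>2 / (4 * s))"
  let ?G = "hankel (\<lambda>x. exp (- s * x\<^sup>2))"
  let ?D = "\<lambda>t. l\<^sup>2 + m\<^sup>2 - 2 * l * m * t"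
  have w: "0 < ?w" using s lm by simp
  have "kern (\<lambda>x. exp (- s * x\<^sup>2)) l m = (LINT t|\<nu>. ?G (sqrt (?D t)))"
    by (rule kern_eq_gegen[OF integrable_gauss[OF s]])
  also have "\<dots> = (LINT t|\<nu>. gauss_const s * ?e * exp (- ?w * (1 - t)))"
  proof (rule integral_cong_AE)
    show "AE t in \<nu>. ?G (sqrt (?D t)) = gauss_const s * ?e * exp (- ?w * (1 - t))"
      using AE_gegen
    proof eventually_elim
      case (elim t)
      have "(sqrt (?D t))\<^sup>2 = l\<^sup>2 + m\<^sup>2 - 2 * l * m * t"
        by (rule real_sqrt_pow2) (rule gegen_chord_bounds(1)[OF elim])
      moreover have "- (?D t) / (4 * s) = - (l - m)\<^sup>2 / (4 * s) + - ?w * (1 - t)"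
        using s by (simp add: field_simps power2_eq_square)
      ultimately show ?case by (simp only: hankel_gauss[OF s] exp_add mult.assoc)
    qed
    have [measurable]: "?G \<in> borel_measurable borel" by (rule measurable_hankel) measurable
    show "(\<lambda>t. ?G (sqrt (?D t))) \<in> borel_measurable \<nu>"
      by measurable
  qed measurable
  also have "\<dots> = gauss_const s * ?e * (LINT t|\<nu>. exp (- ?w * (1 - t)))"
    by (rule integral_mult_right_zero)
  also have "\<dots> \<le> gauss_const s * ?e * (2 powr (\<alpha> - 1/2) * Gamma ?p / gegen_norm \<alpha> * ?w powr (- ?p))"
    using gauss_const_pos[OF s] by (intro mult_left_mono gegen_integral_exp_le w) auto
  also have "\<dots> = kern_const * s powr (- 1/2) * (l powr (- ?p) * m powr (- ?p)) * ?e"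
  proof -
    have w1: "?w powr (- ?p) = l powr (- ?p) * m powr (- ?p) * (2 powr ?p * s powr ?p)"
    proof -
      have "?w powr (- ?p) = (l powr (- ?p) * m powr (- ?p)) / (2 powr (- ?p) * s powr (- ?p))"
        by (simp only: powr_divide powr_mult)
      then show ?thesis
        by (simp only: powr_minus[of 2] powr_minus[of s] divide_inverse inverse_mult_distrib inverse_inverse_eq)
    qed
    have sp: "s powr ?p = s powr (\<alpha> + 1) * s powr (- 1/2)" by (simp add: powr_add[symmetric] add.commute)
    have tp: "(2::real) powr (\<alpha> - 1/2) * 2 powr ?p = 2 powr (2 * \<alpha>)" by (simp add: powr_add[symmetric])
    have gp: "gauss_const s * s powr (\<alpha> + 1) = Gamma (\<alpha> + 1) / 2" using s by (simp add: gauss_const_def)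
    have "gauss_const s * ?e * (2 powr (\<alpha> - 1/2) * Gamma ?p / gegen_norm \<alpha> * ?w powr (- ?p))
      = (gauss_const s * s powr (\<alpha> + 1)) * (2 powr (\<alpha> - 1/2) * 2 powr ?p) * (Gamma ?p / gegen_norm \<alpha>) *
        s powr (- 1/2) * (l powr (- ?p) * m powr (- ?p)) * ?e"
      unfolding w1 sp by (simp only: divide_inverse mult_ac)
    also have "\<dots> = kern_const * s powr (- 1/2) * (l powr (- ?p) * m powr (- ?p)) * ?e"
      unfolding gp tp kern_const_def by simp
    finally show ?thesis .
  qed
  finally show ?thesis .
qed

text \<open>On a cell with k >= 1 one has k + 1 <= 2 x, so the measure of the cell is at most the
  square of (2 x)^(\<alpha> + 1/2).\<close>

lemma powr_le_cell:
  assumes k: "1 \<le> k" and x: "x \<in> bk_I (Suc k)"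
  shows "x powr (- (\<alpha> + 1/2)) \<le> 2 powr (\<alpha> + 1/2) / sqrt (bk_omega \<alpha> (Suc k))"
proof -
  let ?p = "\<alpha> + 1/2"
  have k1: "1 \<le> real k" and x1: "real k \<le> x" using k x by (auto simp: bk_I_Suc)
  have p: "0 < ?p" using half_le by simp
  have om: "0 < bk_omega \<alpha> (Suc k)" using bk_omega_bounds(1)[of k] k1 by (smt (verit) powr_gt_zero)
  have "bk_omega \<alpha> (Suc k) \<le> (2 * x) powr (2 * \<alpha> + 1)"
    using bk_omega_bounds(2)[of k] powr_mono2[of "2 * \<alpha> + 1" "real k + 1" "2 * x"] k1 x1 half_le by linarith
  also have "\<dots> = ((2 * x) powr ?p)\<^sup>2"
    using k1 x1 by (simp add: power2_eq_square powr_add[symmetric])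
  finally have "sqrt (bk_omega \<alpha> (Suc k)) \<le> (2 * x) powr ?p"
    by (intro real_le_lsqrt) auto
  then have "sqrt (bk_omega \<alpha> (Suc k)) \<le> 2 powr ?p * x powr ?p" by (simp add: powr_mult)
  then show ?thesis using om k1 x1 by (simp add: powr_minus field_simps)
qed

text \<open>The index distance is at most |x - y| + 1, and d^2 / 4 >= d - 1 since (d / 2 - 1)^2 >=
  0. The two losses of 1 account for \<open>exp 2\<close>; the base 1/2 replaces exp(-1).\<close>

lemma exp_dist_le_cell:
  assumes x: "x \<in> bk_I (Suc k)" and y: "y \<in> bk_I (Suc m)" and s: "0 < s" "s \<le> 1"
  shows "exp (- (x - y)\<^sup>2 / (4 * s)) \<le> exp 2 * (1/2) ^ (max k m - min k m)"
proof -
  let ?n = "max k m - min k m"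
  have n: "real ?n \<le> \<bar>x - y\<bar> + 1" using x y by (auto simp: bk_I_Suc max_def min_def of_nat_diff)
  have "d - 1 \<le> d\<^sup>2 / 4" for d :: real
    using zero_le_power2[of "d / 2 - 1"] by (simp add: power2_eq_square algebra_simps)
  from this[of "\<bar>x - y\<bar>"] have "\<bar>x - y\<bar> - 1 \<le> (x - y)\<^sup>2 / 4" by (simp only: power2_abs)
  also have "\<dots> \<le> (x - y)\<^sup>2 / (4 * s)" using s by (intro divide_left_mono) auto
  finally have "- (x - y)\<^sup>2 / (4 * s) \<le> 2 - real ?n" using n by simp
  then have "exp (- (x - y)\<^sup>2 / (4 * s)) \<le> exp (2 - real ?n)" by simp
  also have "\<dots> = exp 2 * (exp (-1)) ^ ?n"
    by (simp add: exp_diff exp_minus exp_of_nat_mult[symmetric] power_inverse divide_inverse)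
  also have "\<dots> \<le> exp 2 * (1/2) ^ ?n"
  proof -
    have "(2::real) \<le> exp 1" using exp_ge_add_one_self[of 1] by simp
    then have "exp (-1) \<le> (1/2::real)" by (simp add: exp_minus field_simps)
    then show ?thesis by (intro mult_left_mono power_mono) auto
  qed
  finally show ?thesis .
qed

lemma bk_omega_pos: "1 \<le> k \<Longrightarrow> 0 < bk_omega \<alpha> (Suc k)"
  using bk_omega_bounds(1)[of k] by (smt (verit) powr_gt_zero of_nat_1 of_nat_mono)

text \<open>The 4 is the row sum bound of Schur's test, \<open>exp 2\<close> comes from
  \<open>exp_dist_le_cell\<close>, and the square from using \<open>powr_le_cell\<close> in both
  variables.\<close>

definition energy_const :: real where
  "energy_const = 4 * (kern_const * exp 2 * (2 powr (\<alpha> + 1/2))\<^sup>2)"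

lemma energy_const_pos: "0 < energy_const"
  unfolding energy_const_def using kern_const_pos by simp

text \<open>The weighted integral of the squared transform is a quadratic form of v with the
  Gaussian kernel. Dividing the cell integrals by the roots of the cell measures reduces its
  majorant to the matrix (1/2)^|k - m|.\<close>

theorem hankel_gauss_energy:
  assumes v: "integrable \<mu> v"
    and vpos: "\<And>x. 0 \<le> v x" and supp: "\<And>x. x \<notin> {1..<real R} \<Longrightarrow> v x = 0"
    and s: "0 < s" "s \<le> 1"
  shows "(LINT x|\<mu>. exp (- s * x\<^sup>2) * (hankel v x)\<^sup>2) \<le> energy_const * s powr (- 1/2) * cell_energy v R"
proof -
  let ?g = "\<lambda>x::real. exp (- s * x\<^sup>2)"
  let ?th = "\<lambda>k m. (1/2::real) ^ (max k m - min k m)"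
  let ?C = "kern_const * s powr (- 1/2) * (2 powr (\<alpha> + 1/2))\<^sup>2 * exp 2"
  let ?c = "\<lambda>k m. ?C * ?th k m / (sqrt (bk_omega \<alpha> (Suc k)) * sqrt (bk_omega \<alpha> (Suc m)))"
  let ?a = "\<lambda>k. cell_int v k / sqrt (bk_omega \<alpha> (Suc k))"
  have C: "0 \<le> ?C" using kern_const_pos by simp
  have "(LINT x|\<mu>. ?g x * (hankel v x)\<^sup>2) = (LINT x|\<mu>. ?g x * hankel v x * hankel v x)"
    by (simp add: power2_eq_square mult.assoc)
  also have "\<dots> = (LINT x|\<mu>. v x * (LINT y|\<mu>. v y * kern ?g x y))"
    by (rule integral_hankel_mult_hankel[OF integrable_gauss[OF s(1)] v v])
  also have "\<dots> \<le> (\<Sum>k\<in>{1..<R}. \<Sum>m\<in>{1..<R}. ?c k m * (cell_int v k * cell_int v m))"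
  proof (rule integral_kern_le[OF integrable_gauss[OF s(1)] v vpos supp])
    fix k m x y assume km: "k \<in> {1..<R}" "m \<in> {1..<R}" and xy: "x \<in> bk_I (Suc k)" "y \<in> bk_I (Suc m)"
    have xy0: "0 < x" "0 < y" using km xy by (auto simp: bk_I_Suc)
    have "kern ?g x y \<le> kern_const * s powr (- 1/2) * (x powr (- (\<alpha> + 1/2)) * y powr (- (\<alpha> + 1/2))) * exp (- (x - y)\<^sup>2 / (4 * s))"
      by (rule kern_gauss_le[OF s(1) xy0])
    also have "\<dots> \<le> kern_const * s powr (- 1/2) * ((2 powr (\<alpha> + 1/2) / sqrt (bk_omega \<alpha> (Suc k))) * (2 powr (\<alpha> + 1/2) / sqrt (bk_omega \<alpha> (Suc m)))) * (exp 2 * ?th k m)"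
      using kern_const_pos km bk_omega_pos[of k] bk_omega_pos[of m]
      by (intro mult_mono powr_le_cell exp_dist_le_cell xy s order_refl) auto
    also have "\<dots> = ?c k m" by (simp add: power2_eq_square mult_ac)
    finally show "kern ?g x y \<le> ?c k m" .
  qed
  also have "\<dots> = ?C * (\<Sum>k\<in>{1..<R}. \<Sum>m\<in>{1..<R}. ?th k m * (?a k * ?a m))"
    by (simp add: sum_distrib_left mult_ac)
  also have "\<dots> \<le> ?C * (4 * (\<Sum>k\<in>{1..<R}. (?a k)\<^sup>2))"
    using C by (intro mult_left_mono Schur_geometric) auto
  also have "(\<Sum>k\<in>{1..<R}. (?a k)\<^sup>2) = cell_energy v R"
    unfolding cell_energy_def by (intro sum.cong refl) (auto simp: power_divide less_imp_le[OF bk_omega_pos])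
  also have "?C * (4 * cell_energy v R) = energy_const * s powr (- 1/2) * cell_energy v R"
    by (simp add: energy_const_def mult_ac)
  finally show ?thesis .
qed

end

section \<open>A compactly supported cutoff with nonnegative transform\<close>

text \<open>The profile of a Sonine integral: the first power of 1 - x^2 / r^2 raises the order of
  the Bessel function by two, see \<open>hankel_bump\<close>.\<close>

definition bump :: "real \<Rightarrow> real \<Rightarrow> real" where
  "bump r x = (if 0 \<le> x \<and> x \<le> r then 1 - x\<^sup>2 / r\<^sup>2 else 0)"

lemma bump_bounds: "0 \<le> bump r x" "bump r x \<le> 1" "\<bar>bump r x\<bar> \<le> 1"
proof -
  show 1: "0 \<le> bump r x"
    unfolding bump_def using power_mono[of x r 2] by (auto simp: divide_le_eq_1)
  show 2: "bump r x \<le> 1" by (auto simp: bump_def)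
  show "\<bar>bump r x\<bar> \<le> 1" using 1 2 by simp
qed

lemma measurable_bump [measurable]: "(\<lambda>z. bump (fst z) (snd z)) \<in> borel_measurable (borel \<Otimes>\<^sub>M borel)"
  unfolding bump_def by measurable

lemma measurable_bump' [measurable]: "bump r \<in> borel_measurable borel"
  unfolding bump_def[abs_def] by measurable

context bessel_kingman
begin

lemma bk_power_integral:
  assumes r: "0 < r"
  shows "(LINT x|\<mu>. indicator {0..r} x * x ^ (2 * k)) = r powr (2 * \<alpha> + 2) * r ^ (2 * k) / (2 * (\<alpha> + real k + 1))"
    and "integrable \<mu> (\<lambda>x. indicator {0..r} x * x ^ (2 * k))"
proof -
  let ?c = "2 * \<alpha> + 1 + 2 * real k"
  show int: "integrable \<mu> (\<lambda>x. indicator {0..r} x * x ^ (2 * k))"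
  proof (rule integrable_bounded_on_interval)
    show "\<bar>indicator {0..r} x * x ^ (2 * k)\<bar> \<le> r ^ (2 * k)" for x
      using r by (auto simp: indicator_def power_mono)
  qed (auto simp: indicator_def)
  have a1: "(LINT x|\<mu>. indicator {0..r} x * x ^ (2 * k)) =
      (LINT x|lborel. indicator {0..} x * x powr (2 * \<alpha> + 1) * (indicator {0..r} x * x ^ (2 * k)))"
    by (rule integral_bk_measure) measurable
  have a2: "indicator {0..} x * x powr (2 * \<alpha> + 1) * (indicator {0..r} x * x ^ (2 * k)) = (if x \<in> {0..r} then x powr ?c else 0)" for x :: real
  proof (cases "0 < x")
    case True
    then have "x powr ?c = x powr (2 * \<alpha> + 1) * x ^ (2 * k)"
      by (simp add: powr_add flip: powr_realpow)
    then show ?thesis using True by (simp add: indicator_def)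
  qed (auto simp: indicator_def)
  have a3: "integrable lborel (\<lambda>x. indicator {0..} x * x powr (2 * \<alpha> + 1) * (indicator {0..r} x * x ^ (2 * k)))"
    using int by (subst (asm) integrable_bk_measure) auto
  have 1: "((\<lambda>x. if x \<in> {0..r} then x powr ?c else 0) has_integral (LINT x|\<mu>. indicator {0..r} x * x ^ (2 * k))) UNIV"
    using has_integral_integral_lborel[OF a3] unfolding a1[symmetric] by (simp only: a2)
  have "((\<lambda>x. x powr ?c) has_integral (r powr (?c + 1) / (?c + 1))) {0..r}"
    using half_le r by (intro has_integral_powr_from_0) auto
  then have 2: "((\<lambda>x. if x \<in> {0..r} then x powr ?c else 0) has_integral (r powr (?c + 1) / (?c + 1))) UNIV"
    by (subst has_integral_restrict_UNIV)
  have "r powr (?c + 1) = r powr (2 * \<alpha> + 2) * r powr real (2 * k)"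
    by (simp only: powr_add[symmetric]) (simp add: algebra_simps)
  then have "r powr (?c + 1) = r powr (2 * \<alpha> + 2) * r ^ (2 * k)" using r by (simp only: powr_realpow)
  moreover have "?c + 1 = 2 * (\<alpha> + real k + 1)" by simp
  ultimately show "(LINT x|\<mu>. indicator {0..r} x * x ^ (2 * k)) = r powr (2 * \<alpha> + 2) * r ^ (2 * k) / (2 * (\<alpha> + real k + 1))"
    using has_integral_unique[OF 1 2] by (simp only:)
qed

text \<open>Subtracting consecutive power integrals yields the denominators (\<alpha> + k + 1)
  (\<alpha> + k + 2). They advance the Pochhammer symbol by two steps, to the one belonging to order
  \<alpha> + 2.\<close>

theorem hankel_bump:
  assumes r: "0 < r"
  shows "hankel (bump r) z = r powr (2 * \<alpha> + 2) / (2 * (\<alpha> + 1) * (\<alpha> + 2)) * bessel_j (\<alpha> + 2) (z * r)"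
proof -
  interpret B: bessel_kingman "\<alpha> + 2" by standard (use half_le in simp)
  let ?c = "r powr (2 * \<alpha> + 2) / (2 * (\<alpha> + 1) * (\<alpha> + 2))"
  let ?d = "\<lambda>k::nat. 2 * (\<alpha> + real k + 1) * (\<alpha> + real k + 2)"
  let ?I = "\<lambda>k x. indicator {0..r} x * x ^ (2 * k) :: real"
  define g where "g k x = bessel_coeff \<alpha> k * z ^ (2 * k) * (bump r x * x ^ (2 * k))" for k x
  have bp: "bump r x * x ^ (2 * k) = ?I k x - ?I (Suc k) x / r\<^sup>2" for k x
    by (auto simp: bump_def indicator_def field_simps power2_eq_square)
  have ib: "integrable \<mu> (\<lambda>x. bump r x * x ^ (2 * k))" for k
    unfolding bp by (intro Bochner_Integration.integrable_diff bk_power_integral(2)[OF r] integrable_divide)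
  have vb: "(LINT x|\<mu>. bump r x * x ^ (2 * k)) = r powr (2 * \<alpha> + 2) * r ^ (2 * k) / ?d k" for k
  proof -
    have "(LINT x|\<mu>. bump r x * x ^ (2 * k)) = (LINT x|\<mu>. ?I k x) - (LINT x|\<mu>. ?I (Suc k) x) / r\<^sup>2"
      unfolding bp
      by (subst Bochner_Integration.integral_diff[OF bk_power_integral(2)[OF r] integrable_divide[OF bk_power_integral(2)[OF r]]])
         (simp only: integral_divide_zero)
    also have "\<dots> = r powr (2 * \<alpha> + 2) * r ^ (2 * k) * (1 / (2 * (\<alpha> + real k + 1)) - 1 / (2 * (\<alpha> + real k + 2)))"
    proof -
      have "r ^ (2 * Suc k) = r\<^sup>2 * r ^ (2 * k)" by (simp add: power2_eq_square)
      moreover have "\<alpha> + real (Suc k) + 1 = \<alpha> + real k + 2" by simp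
      ultimately have "r powr (2 * \<alpha> + 2) * r ^ (2 * Suc k) / (2 * (\<alpha> + real (Suc k) + 1)) / r\<^sup>2 = r powr (2 * \<alpha> + 2) * r ^ (2 * k) * (1 / (2 * (\<alpha> + real k + 2)))"
        using r by (simp only:) simp
      then show ?thesis unfolding bk_power_integral(1)[OF r] by (simp only: right_diff_distrib) simp
    qed
    also have "1 / (2 * (\<alpha> + real k + 1)) - 1 / (2 * (\<alpha> + real k + 2)) = 1 / ?d k"
    proof -
      have "\<alpha> + real k + 1 \<noteq> 0" "\<alpha> + real k + 2 \<noteq> 0" using half_le by auto
      then show ?thesis by (simp add: divide_simps)
    qed
    finally show ?thesis by simp
  qed
  have int: "integrable \<mu> (g k)" for k
    unfolding g_def using ib by (rule integrable_mult_right)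
  have coeff: "bessel_coeff \<alpha> k / ?d k = bessel_coeff (\<alpha> + 2) k / (2 * (\<alpha> + 1) * (\<alpha> + 2))" for k
  proof -
    have "pochhammer (\<alpha> + 1) (Suc (Suc k)) = (\<alpha> + 1) * ((\<alpha> + 2) * pochhammer (\<alpha> + 2 + 1) k)"
      by (simp add: pochhammer_rec add_ac)
    moreover have "pochhammer (\<alpha> + 1) (Suc (Suc k)) = pochhammer (\<alpha> + 1) k * (\<alpha> + real k + 1) * (\<alpha> + real k + 2)"
      by (simp add: pochhammer_Suc add_ac)
    ultimately have p: "pochhammer (\<alpha> + 1) k * (\<alpha> + real k + 1) * (\<alpha> + real k + 2) = (\<alpha> + 1) * ((\<alpha> + 2) * pochhammer (\<alpha> + 2 + 1) k)" by simp
    have "bessel_coeff \<alpha> k / ?d k =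
       (-1) ^ k / (4 ^ k * fact k * 2 * (pochhammer (\<alpha> + 1) k * (\<alpha> + real k + 1) * (\<alpha> + real k + 2)))"
      by (simp add: bessel_coeff_def mult_ac)
    also have "\<dots> = bessel_coeff (\<alpha> + 2) k / (2 * (\<alpha> + 1) * (\<alpha> + 2))"
      unfolding p by (simp add: bessel_coeff_def mult_ac)
    finally show ?thesis .
  qed
  have val: "(LINT x|\<mu>. g k x) = ?c * (bessel_coeff (\<alpha> + 2) k * ((z * r)\<^sup>2) ^ k)" for k
  proof -
    have "(LINT x|\<mu>. g k x) = bessel_coeff \<alpha> k * z ^ (2 * k) * (r powr (2 * \<alpha> + 2) * r ^ (2 * k) / ?d k)"
      unfolding g_def integral_mult_right_zero vb ..
    also have "\<dots> = (bessel_coeff \<alpha> k / ?d k) * r powr (2 * \<alpha> + 2) * ((z * r)\<^sup>2) ^ k"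
      by (simp only: power_mult power_mult_distrib divide_inverse) (simp only: mult_ac)
    finally show ?thesis unfolding coeff by simp
  qed
  have nval: "(LINT x|\<mu>. norm (g k x)) = ?c * (\<bar>bessel_coeff (\<alpha> + 2) k\<bar> * \<bar>(z * r)\<^sup>2\<bar> ^ k)" for k
  proof -
    have "norm (g k x) = \<bar>bessel_coeff \<alpha> k\<bar> * z ^ (2 * k) * (bump r x * x ^ (2 * k))" for x
      using bump_bounds(1)[of r x] by (simp add: g_def abs_mult power_mult)
    then have "(LINT x|\<mu>. norm (g k x)) = \<bar>bessel_coeff \<alpha> k\<bar> * z ^ (2 * k) * (r powr (2 * \<alpha> + 2) * r ^ (2 * k) / ?d k)"
      by (simp only: integral_mult_right_zero vb)
    also have "\<dots> = \<bar>bessel_coeff \<alpha> k / ?d k\<bar> * r powr (2 * \<alpha> + 2) * ((z * r)\<^sup>2) ^ k"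
    proof -
      have "\<bar>bessel_coeff \<alpha> k / ?d k\<bar> = \<bar>bessel_coeff \<alpha> k\<bar> / ?d k"
        using half_le by (simp add: abs_mult)
      then show ?thesis
        by (simp only: power_mult power_mult_distrib divide_inverse) (simp only: mult_ac)
    qed
    also have "\<dots> = ?c * (\<bar>bessel_coeff (\<alpha> + 2) k\<bar> * \<bar>(z * r)\<^sup>2\<bar> ^ k)"
      unfolding coeff using half_le by (simp add: abs_mult)
    finally show ?thesis .
  qed
  have sum: "(\<Sum>k. g k x) = bump r x * bessel_j \<alpha> (z * x)" for x
  proof -
    have "(\<Sum>k. g k x) = (\<Sum>k. bump r x * (bessel_coeff \<alpha> k * ((z * x)\<^sup>2) ^ k))"
      by (simp only: g_def power_mult power_mult_distrib) (simp only: mult_ac)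
    also have "\<dots> = bump r x * (\<Sum>k. bessel_coeff \<alpha> k * ((z * x)\<^sup>2) ^ k)"
      by (rule suminf_mult) (rule summable_bessel)
    finally show ?thesis by (simp add: bessel_j_eq power_mult)
  qed
  have "hankel (bump r) z = (LINT x|\<mu>. (\<Sum>k. g k x))" by (simp add: hankel_def sum)
  also have "\<dots> = (\<Sum>k. LINT x|\<mu>. g k x)"
  proof (rule integral_suminf[OF int])
    show "AE x in \<mu>. summable (\<lambda>k. norm (g k x))"
    proof (rule AE_I2)
      fix x
      have "summable (\<lambda>k. \<bar>bessel_coeff \<alpha> k\<bar> * \<bar>(z * x)\<^sup>2\<bar> ^ k * \<bar>bump r x\<bar>)"
        by (intro summable_mult2 summable_abs_bessel)
      then show "summable (\<lambda>k. norm (g k x))"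
        by (simp only: g_def power_mult power_mult_distrib real_norm_def abs_mult power_abs abs_power2 power2_abs)
           (simp only: mult_ac)
    qed
    show "summable (\<lambda>k. LINT x|\<mu>. norm (g k x))"
      unfolding nval by (intro summable_mult B.summable_abs_bessel)
  qed
  also have "\<dots> = ?c * (\<Sum>k. bessel_coeff (\<alpha> + 2) k * ((z * r)\<^sup>2) ^ k)"
    unfolding val by (rule suminf_mult) (rule B.summable_bessel)
  finally show ?thesis by (simp add: B.bessel_j_eq power_mult)
qed

text \<open>By the product formula with \<open>x = y\<close>, the square of \<open>j\<^sub>\<alpha>\<^sub>+\<^sub>2\<close> is a mixture of dilates of
  \<open>j\<^sub>\<alpha>\<^sub>+\<^sub>2\<close>, and each dilate is the transform of a bump.\<close>

theorem positive_definite_cutoff: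
  assumes e: "0 < e"
  obtains h B where "h \<in> borel_measurable borel" "\<And>x. \<bar>h x\<bar> \<le> B" "\<And>x. x \<notin> {0..2 * e} \<Longrightarrow> h x = 0"
    "\<And>z. hankel h z = (bessel_j (\<alpha> + 2) (e * z))\<^sup>2"
proof -
  interpret B: bessel_kingman "\<alpha> + 2" by standard (use half_le in simp)
  \<comment> \<open>The chord for two sides of length e; it is at most 2 e for t in [-1, 1], which
    gives the support of h.\<close>
  define r where "r t = e * sqrt (2 - 2 * t)" for t
  \<comment> \<open>The power of \<open>r t\<close> cancels the factor r^(2 \<alpha> + 2) in
    \<open>hankel_bump\<close>; c removes its remaining constant and normalizes the Gegenbauer
    measure of order \<alpha> + 2.\<close>
  define u where "u t = B.gegen_weight t * r t powr (- (2 * \<alpha> + 2))" for t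
  define c where "c = 2 * (\<alpha> + 1) * (\<alpha> + 2) / gegen_norm (\<alpha> + 2)"
  define h where "h x = c * (LINT t|lborel. u t * bump (r t) x)" for x
  let ?e = "e powr (- (2 * \<alpha> + 2))"
  let ?J = "\<lambda>x. LINT t|lborel. u t * bump (r t) x"
  let ?j = "bessel_j (\<alpha> + 2)"
  let ?R = "\<lambda>z t. sqrt ((e * z)\<^sup>2 + (e * z)\<^sup>2 - 2 * (e * z) * (e * z) * t)"
  have [measurable]: "r \<in> borel_measurable borel" "u \<in> borel_measurable borel"
    unfolding r_def[abs_def] u_def[abs_def] by measurable
  have c: "0 < c" unfolding c_def using half_le B.gegen_norm_pos by auto
  have u0: "0 \<le> u t" for t unfolding u_def by (simp add: B.gegen_weight_nonneg)
  \<comment> \<open>At t = 1 the weight vanishes like (1 - t)^(\<alpha> + 3/2) and the power of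
    \<open>r t\<close> grows like (1 - t)^(-(\<alpha> + 1)); the net exponent is 1/2, so u stays
    bounded.\<close>
  have ub: "u t \<le> ?e * 2 * indicator {-1..1} t" for t
  proof (cases "t \<in> {-1..<1}")
    case True
    let ?y = "2 * (1 - t)"
    have y: "0 < ?y" "?y \<le> 4" using True by auto
    have "B.gegen_weight t \<le> ?y powr (\<alpha> + 3/2)"
      using B.gegen_weight_le_powr[of t] True unfolding powr_mult by (simp add: algebra_simps)
    moreover have "r t powr (- (2 * \<alpha> + 2)) = ?e * ?y powr (- (\<alpha> + 1))"
    proof -
      have "sqrt (2 - 2 * t) = ?y powr (1/2)" using y by (simp add: powr_half_sqrt algebra_simps)
      then have "r t = e * ?y powr (1/2)" by (simp only: r_def)
      then have "r t powr (- (2 * \<alpha> + 2)) = ?e * (?y powr (1/2)) powr (- (2 * \<alpha> + 2))"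
        by (simp only: powr_mult)
      also have "(?y powr (1/2)) powr (- (2 * \<alpha> + 2)) = ?y powr (- (\<alpha> + 1))"
        unfolding powr_powr by (rule arg_cong[where f="\<lambda>q. ?y powr q"]) (simp add: field_simps)
      finally show ?thesis .
    qed
    ultimately have "u t \<le> ?y powr (\<alpha> + 3/2) * (?e * ?y powr (- (\<alpha> + 1)))"
      unfolding u_def by (simp only: ) (intro mult_right_mono, auto)
    also have "\<dots> = ?e * ?y powr (1/2)"
    proof -
      have "?y powr (\<alpha> + 3/2) * ?y powr (- (\<alpha> + 1)) = ?y powr (1/2)" by (simp add: powr_add[symmetric])
      then show ?thesis by (simp only: mult.left_commute)
    qed
    also have "\<dots> \<le> ?e * 2"
      using y by (intro mult_left_mono) (auto simp add: powr_half_sqrt real_le_lsqrt)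
    finally show ?thesis using True by simp
  next
    case False
    then have "t = 1 \<or> t \<notin> {-1..1}" by auto
    then have "u t = 0" by (auto simp: u_def B.gegen_weight_def)
    then show ?thesis by (simp add: indicator_def)
  qed
  have iu: "integrable lborel u"
  proof (rule Bochner_Integration.integrable_bound)
    show "integrable lborel (\<lambda>t. ?e * 2 * indicator {-1..1::real} t)" by simp
    show "AE t in lborel. norm (u t) \<le> norm (?e * 2 * indicator {-1..1} t)"
      using u0 ub by (intro AE_I2) (simp add: order_trans[OF ub abs_ge_self])
  qed measurable
  have iK: "integrable lborel (\<lambda>t. u t * bump (r t) x)" for x
  proof (rule Bochner_Integration.integrable_bound[OF iu])
    have "(\<lambda>t. bump (r t) x) \<in> borel_measurable borel"
      using measurable_compose[of "\<lambda>t. (r t, x)" borel "borel \<Otimes>\<^sub>M borel", OF _ measurable_bump] by simp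
    then show "(\<lambda>t. u t * bump (r t) x) \<in> borel_measurable lborel" by simp
    show "AE t in lborel. norm (u t * bump (r t) x) \<le> norm (u t)"
      using bump_bounds(3) by (intro AE_I2) (simp add: abs_mult mult_left_le)
  qed
  have hb: "\<bar>h x\<bar> \<le> c * (LINT t|lborel. u t)" for x
  proof -
    have "\<bar>LINT t|lborel. u t * bump (r t) x\<bar> \<le> (LINT t|lborel. \<bar>u t * bump (r t) x\<bar>)" by (rule integral_abs_bound)
    also have "\<dots> \<le> (LINT t|lborel. u t)"
      using u0 bump_bounds(3) by (intro integral_mono integrable_abs iK iu) (simp add: abs_mult mult_left_le)
    finally show ?thesis using c by (simp add: h_def abs_mult)
  qed
  have supp: "h x = 0" if x: "x \<notin> {0..2 * e}" for x
  proof -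
    have "u t * bump (r t) x = 0" for t
    proof (cases "t \<in> {-1..1}")
      case True
      then have "sqrt (2 - 2 * t) \<le> 2" by (intro real_le_lsqrt) auto
      then have "r t \<le> 2 * e" using e by (simp add: r_def)
      then show ?thesis using x by (auto simp: bump_def)
    qed (simp add: u_def B.gegen_weight_def)
    then have "(\<lambda>t. u t * bump (r t) x) = (\<lambda>t. 0)" by (rule ext)
    then show ?thesis by (simp only: h_def) simp
  qed
  have hm: "h \<in> borel_measurable borel"
  proof -
    have "(\<lambda>(x, t). u t * bump (r t) x) \<in> borel_measurable (borel \<Otimes>\<^sub>M lborel)"
    proof -
      have "(\<lambda>z. bump (r (snd z)) (fst z)) \<in> borel_measurable (borel \<Otimes>\<^sub>M lborel)"
        using measurable_compose[of "\<lambda>z. (r (snd z), fst z)" "borel \<Otimes>\<^sub>M lborel" "borel \<Otimes>\<^sub>M borel", OF _ measurable_bump] by simp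
      then show ?thesis by (simp add: case_prod_beta')
    qed
    then show ?thesis unfolding h_def[abs_def]
      by (intro borel_measurable_times borel_measurable_const lborel.borel_measurable_lebesgue_integral)
  qed
  have ft: "hankel h z = (?j (e * z))\<^sup>2" for z
  proof -
    \<comment> \<open>Restricting the character to the support of h leaves the integral unchanged
      and makes this factor integrable for Fubini.\<close>
    define v where "v x = indicator {0..2 * e} x * bessel_j \<alpha> (z * x)" for x
    have iv: "integrable \<mu> v"
      using abs_bessel_j_le_1
      by (intro integrable_bounded_on_interval[where B=1 and r="2 * e"]) (auto simp: v_def[abs_def] indicator_def)
    have "hankel h z = (LINT x|\<mu>. c * (v x * ?J x))"
      unfolding hankel_def
    proof (rule Bochner_Integration.integral_cong[OF refl])
      fix x
      show "h x * bessel_j \<alpha> (z * x) = c * (v x * ?J x)"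
      proof (cases "x \<in> {0..2 * e}")
        case True then show ?thesis by (simp add: v_def h_def)
      next
        case False then show ?thesis using supp[OF False] by (simp add: v_def)
      qed
    qed
    also have "\<dots> = c * (LINT x|\<mu>. v x * ?J x)"
      by (rule integral_mult_right_zero)
    also have "(LINT x|\<mu>. v x * ?J x) = (LINT t|lborel. u t * (LINT x|\<mu>. v x * bump (r t) x))"
    proof (rule Fubini_bounded_kernel(1)[OF sigma_finite_bk_measure sigma_finite_lborel iv iu _ bump_bounds(3)])
      have "(\<lambda>z. bump (r (snd z)) (fst z)) \<in> borel_measurable (\<mu> \<Otimes>\<^sub>M lborel)"
        using measurable_compose[of "\<lambda>z. (r (snd z), fst z)" "\<mu> \<Otimes>\<^sub>M lborel" "borel \<Otimes>\<^sub>M borel", OF _ measurable_bump] by simp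
      then show "(\<lambda>(x, t). bump (r t) x) \<in> borel_measurable (\<mu> \<Otimes>\<^sub>M lborel)" by (simp add: case_prod_beta')
    qed
    also have "\<dots> = (LINT t|lborel. (B.gegen_weight t * ?j (z * r t)) / (2 * (\<alpha> + 1) * (\<alpha> + 2)))"
    proof (rule Bochner_Integration.integral_cong[OF refl])
      fix t :: real
      show "u t * (LINT x|\<mu>. v x * bump (r t) x) = (B.gegen_weight t * ?j (z * r t)) / (2 * (\<alpha> + 1) * (\<alpha> + 2))"
      proof (cases "t \<in> {-1..<1}")
        case True
        then have rt: "0 < r t" "r t \<le> 2 * e"
        proof -
          show "0 < r t" using True e by (simp add: r_def)
          have "sqrt (2 - 2 * t) \<le> 2" using True by (intro real_le_lsqrt) auto
          then show "r t \<le> 2 * e" using e by (simp add: r_def)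
        qed
        have "(LINT x|\<mu>. v x * bump (r t) x) = hankel (bump (r t)) z"
          unfolding hankel_def
          using rt by (intro Bochner_Integration.integral_cong refl) (auto simp: v_def bump_def indicator_def)
        then have "u t * (LINT x|\<mu>. v x * bump (r t) x) =
            (r t powr (- (2 * \<alpha> + 2)) * r t powr (2 * \<alpha> + 2)) * (B.gegen_weight t * ?j (z * r t) / (2 * (\<alpha> + 1) * (\<alpha> + 2)))"
          by (simp only: hankel_bump[OF rt(1)] u_def divide_inverse mult_ac)
        also have "r t powr (- (2 * \<alpha> + 2)) * r t powr (2 * \<alpha> + 2) = 1"
          using rt by (simp only: powr_add[symmetric]) simp
        finally show ?thesis by (simp only: mult_1_left)
      next
        case False
        then have "t = 1 \<or> t \<notin> {-1..1}" by auto
        then have "B.gegen_weight t = 0" by (auto simp: B.gegen_weight_def)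
        then show ?thesis by (simp add: u_def)
      qed
    qed
    also have "c * \<dots> = (LINT t|lborel. B.gegen_weight t * ?j (z * r t)) / gegen_norm (\<alpha> + 2)"
      using half_le by (simp add: c_def)
    also have "\<dots> = (LINT t|gegen_measure (\<alpha> + 2). ?j (z * r t))"
      by (rule B.integral_gegen[symmetric]) measurable
    also have "\<dots> = (LINT t|gegen_measure (\<alpha> + 2). ?j (?R z t))"
    proof (rule Bochner_Integration.integral_cong[OF refl])
      fix t
      have "(e * z)\<^sup>2 + (e * z)\<^sup>2 - 2 * (e * z) * (e * z) * t = (e * z)\<^sup>2 * (2 - 2 * t)"
        by (simp add: power2_eq_square algebra_simps)
      \<comment> \<open>Only the absolute value of z r(t) comes out of the root; evenness of the
        Bessel function makes the sign harmless.\<close>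
      then have "?R z t = \<bar>z * r t\<bar> \<or> ?R z t = - \<bar>z * r t\<bar>"
        using e by (simp add: real_sqrt_mult r_def abs_mult)  (auto simp: abs_if)
      then show "?j (z * r t) = ?j (?R z t)"
        using B.bessel_j_minus[of "z * r t"] by (auto simp: abs_if split: if_splits)
    qed
    also have "\<dots> = (?j (e * z))\<^sup>2"
      unfolding B.bessel_j_product[symmetric] by (simp only: power2_eq_square)
    finally show ?thesis .
  qed
  show thesis by (rule that[OF hm hb supp ft])
qed

end

section \<open>From local square integrability to the transform\<close>

text \<open>Cauchy-Schwarz with a free parameter: integrated, it stays linear in the two square
  integrals, so that a suitable t allows absorption.\<close>

lemma abs_mult_le_weighted:
  fixes a b t :: real
  assumes "0 < t" shows "\<bar>a * b\<bar> \<le> t / 2 * a\<^sup>2 + b\<^sup>2 / (2 * t)"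
proof -
  have "0 \<le> (t * \<bar>a\<bar> - \<bar>b\<bar>)\<^sup>2 / (2 * t)" using assms by simp
  also have "\<dots> = t / 2 * a\<^sup>2 + b\<^sup>2 / (2 * t) - \<bar>a\<bar> * \<bar>b\<bar>"
    using assms by (simp add: power2_diff field_simps power2_eq_square)
  finally show ?thesis by (simp add: abs_mult)
qed

context bessel_kingman
begin

text \<open>In \<open>kern_cutoff_ge\<close>, 1/4 bounds the squared Bessel factor from below, the
  first power of 2 comes from the set \<open>T\<close>, and the second from comparing k + 1 with
  k.\<close>

definition cutoff_const :: real where
  "cutoff_const = 2 powr (- (\<alpha> + 1/2)) * 2 powr (- (2 * \<alpha> + 1)) / (4 * gegen_norm \<alpha>)"

lemma cutoff_const_pos: "0 < cutoff_const"
  using gegen_norm_pos by (simp add: cutoff_const_def)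

lemma kern_cutoff_nonneg:
  assumes h: "integrable \<mu> h" and ft: "\<And>z. hankel h z = (bessel_j (\<alpha> + 2) (e * z))\<^sup>2"
  shows "0 \<le> kern h l m"
  unfolding kern_eq_gegen[OF h] ft by (intro integral_nonneg_AE) simp

text \<open>Within a cell the chord is at most 2 as long as t is within 1 / (k + 1)^2 of 1. For e <=
  1/2 the Bessel factor is then at least 1/2, and the Gegenbauer mass of such t is of the order of
  the inverse measure of the cell.\<close>

lemma kern_cutoff_ge:
  assumes h: "integrable \<mu> h" and ft: "\<And>z. hankel h z = (bessel_j (\<alpha> + 2) (e * z))\<^sup>2"
    and e: "0 < e" "e \<le> 1/2" and k: "1 \<le> k" and l: "l \<in> bk_I (Suc k)" and m: "m \<in> bk_I (Suc k)"
  shows "cutoff_const / bk_omega \<alpha> (Suc k) \<le> kern h l m"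
proof -
  interpret B: bessel_kingman "\<alpha> + 2" by standard (use half_le in simp)
  define K where "K = (real k + 1)\<^sup>2"
  have K: "1 \<le> K" by (simp add: K_def)
  \<comment> \<open>Staying 1 / (2 K) away from t = 1 gives 1 - t^2 >= 1 / (2 K) on
    \<open>T\<close>, while the length of \<open>T\<close> is still 1 / (2 K).\<close>
  define T where "T = {1 - 1 / K..1 - 1 / (2 * K)}"
  have T: "T \<subseteq> {0..1}" using K by (auto simp: T_def field_simps)
  let ?D = "\<lambda>t. l\<^sup>2 + m\<^sup>2 - 2 * l * m * t"
  let ?q = "\<lambda>t. bessel_j (\<alpha> + 2) (e * sqrt (?D t))"
  have lm: "0 \<le> l" "0 \<le> m" "\<bar>l - m\<bar> \<le> 1" "l * m \<le> K"
  proof -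
    show "0 \<le> l" "0 \<le> m" "\<bar>l - m\<bar> \<le> 1" using l m by (auto simp: bk_I_Suc)
    show "l * m \<le> K" unfolding K_def power2_eq_square using l m by (intro mult_mono) (auto simp: bk_I_Suc)
  qed
  have q: "1/4 * indicator T t \<le> (?q t)\<^sup>2" for t
  proof (cases "t \<in> T")
    case True
    then have t: "t \<in> {-1..1}" "0 \<le> 1 - t" "1 - t \<le> 1 / K" using T by (auto simp: T_def)
    have "(l - m)\<^sup>2 \<le> 1" using lm by (simp add: abs_square_le_1)
    moreover have "l * m * (1 - t) \<le> K * (1 / K)" using lm t K by (intro mult_mono) auto
    moreover have "?D t = (l - m)\<^sup>2 + 2 * (l * m * (1 - t))" by (simp add: power2_eq_square algebra_simps)
    ultimately have "?D t \<le> 4" using K by simp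
    have "(e * sqrt (?D t))\<^sup>2 = e\<^sup>2 * ?D t"
      using gegen_chord_bounds(1)[OF t(1), of l m] by (simp only: power_mult_distrib real_sqrt_pow2)
    also have "\<dots> \<le> (1/2)\<^sup>2 * 4"
      using e \<open>?D t \<le> 4\<close> gegen_chord_bounds(1)[OF t(1), of l m] by (intro mult_mono power_mono) auto
    finally have "(e * sqrt (?D t))\<^sup>2 \<le> 1" by (simp add: power2_eq_square)
    then have "1/2 \<le> ?q t" using B.bessel_j_ge[of "e * sqrt (?D t)"] by linarith
    then have "(1/2)\<^sup>2 \<le> (?q t)\<^sup>2" by (intro power_mono) auto
    then show ?thesis using True by (simp add: power2_eq_square)
  qed simp
  have om: "2 powr (- (2 * \<alpha> + 1)) / bk_omega \<alpha> (Suc k) \<le> (real k + 1) powr (- (2 * \<alpha> + 1))"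
  proof -
    have "(real k + 1) powr (2 * \<alpha> + 1) \<le> (2 * real k) powr (2 * \<alpha> + 1)"
      using k half_le by (intro powr_mono2) auto
    also have "\<dots> \<le> 2 powr (2 * \<alpha> + 1) * bk_omega \<alpha> (Suc k)"
      using bk_omega_bounds(1)[of k] by (simp add: powr_mult)
    finally have "(real k + 1) powr (2 * \<alpha> + 1) \<le> 2 powr (2 * \<alpha> + 1) * bk_omega \<alpha> (Suc k)" .
    moreover have "1 / a / w \<le> 1 / b" if "0 < a" "0 < b" "0 < w" "b \<le> a * w" for a b w :: real
      using that by (simp add: field_simps)
    ultimately show ?thesis using bk_omega_pos[OF k] by (simp only: powr_minus_divide) simp
  qed
  have "cutoff_const / bk_omega \<alpha> (Suc k) = 2 powr (- (\<alpha> + 1/2)) / (4 * gegen_norm \<alpha>) * (2 powr (- (2 * \<alpha> + 1)) / bk_omega \<alpha> (Suc k))"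
    by (simp add: cutoff_const_def)
  also have "\<dots> \<le> 2 powr (- (\<alpha> + 1/2)) / (4 * gegen_norm \<alpha>) * (real k + 1) powr (- (2 * \<alpha> + 1))"
    using gegen_norm_pos by (intro mult_left_mono om) auto
  also have "\<dots> = 1/4 * ((2 * K) powr (- (\<alpha> + 1/2)) / gegen_norm \<alpha>)"
  proof -
    have "K = (real k + 1) powr 2" by (simp add: K_def)
    then have "K powr (- (\<alpha> + 1/2)) = (real k + 1) powr (2 * (- (\<alpha> + 1/2)))" by (simp only: powr_powr)
    also have "2 * (- (\<alpha> + 1/2)) = - (2 * \<alpha> + 1)" by simp
    finally show ?thesis unfolding powr_mult by simp
  qed
  also have "(2 * K) powr (- (\<alpha> + 1/2)) = (LINT t|lborel. (1 / (2 * K)) powr (\<alpha> - 1/2) * indicator T t)"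
  proof -
    have "measure lborel T = 1 / (2 * K)" using K by (simp add: T_def field_simps)
    then have "(LINT t|lborel. (1 / (2 * K)) powr (\<alpha> - 1/2) * indicator T t) = (1 / (2 * K)) powr (\<alpha> - 1/2) * (1 / (2 * K)) powr 1"
      using K by (simp add: T_def)
    also have "\<dots> = (1 / (2 * K)) powr (\<alpha> + 1/2)" by (simp only: powr_add[symmetric]) (simp add: add.commute)
    also have "\<dots> = (2 * K) powr (- (\<alpha> + 1/2))" by (simp only: powr_minus_divide powr_divide powr_one_eq_one)
    finally show ?thesis by simp
  qed
  also have "\<dots> / gegen_norm \<alpha> \<le> (LINT t|lborel. gegen_weight t * indicator T t) / gegen_norm \<alpha>"
  proof (intro divide_right_mono integral_mono)
    show "0 \<le> gegen_norm \<alpha>" using gegen_norm_pos by simp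
    show "integrable lborel (\<lambda>t. (1 / (2 * K)) powr (\<alpha> - 1/2) * indicator T t)"
      by (intro integrable_mult_right integrable_real_indicator) (auto simp: T_def emeasure_lborel_Icc_eq)
    show "integrable lborel (\<lambda>t. gegen_weight t * indicator T t)"
    proof (rule Bochner_Integration.integrable_bound)
      show "integrable lborel (\<lambda>t. t ^ 0 * gegen_weight t)" by (rule integrable_power_gegen_weight)
      show "(\<lambda>t. gegen_weight t * indicator T t) \<in> borel_measurable lborel" unfolding T_def by measurable
    qed (auto simp: indicator_def)
    fix t
    show "(1 / (2 * K)) powr (\<alpha> - 1/2) * indicator T t \<le> gegen_weight t * indicator T t"
    proof (cases "t \<in> T")
      case True
      then have t: "0 \<le> t" "t \<le> 1" "1 / (2 * K) \<le> 1 - t" using T by (auto simp: T_def)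
      have "1 / (2 * K) \<le> 1 * (1 - t)" using t by simp
      also have "\<dots> \<le> (1 + t) * (1 - t)" using t by (intro mult_right_mono) auto
      also have "\<dots> = 1 - t\<^sup>2" by (simp add: power2_eq_square algebra_simps)
      finally show ?thesis using t True K half_le by (simp add: gegen_weight_def powr_mono2)
    qed simp
  qed
  also have "(LINT t|lborel. gegen_weight t * indicator T t) / gegen_norm \<alpha> = (LINT t|\<nu>. indicator T t)"
    by (rule integral_gegen[symmetric]) (simp add: T_def)
  also have "1/4 * (LINT t|\<nu>. indicator T t) = (LINT t|\<nu>. 1/4 * indicator T t :: real)"
    by (rule integral_mult_right_zero[symmetric])
  also have "\<dots> \<le> (LINT t|\<nu>. (?q t)\<^sup>2)"
  proof (rule integral_mono)
    show "integrable \<nu> (\<lambda>t. 1/4 * indicator T t :: real)"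
      by (rule gegen_integrable_bounded[where B=1]) (auto simp: indicator_def T_def)
    show "integrable \<nu> (\<lambda>t. (?q t)\<^sup>2)"
    proof (rule gegen_integrable_bounded[where B=1])
      show "\<bar>(?q t)\<^sup>2\<bar> \<le> 1" for t
        using B.abs_bessel_j_le_1[of "e * sqrt (?D t)"] by (simp add: abs_square_le_1)
    qed measurable
  qed (rule q)
  also have "\<dots> = kern h l m" unfolding kern_eq_gegen[OF h] ft ..
  finally show ?thesis by simp
qed

text \<open>Being bounded with bounded support, the truncation is integrable even when the full
  transform is not known to be; it leaves the cells that enter the energy intact.\<close>

definition trunc_hankel :: "(real \<Rightarrow> real) \<Rightarrow> nat \<Rightarrow> real \<Rightarrow> real" where
  "trunc_hankel u R x = indicator {1..<real R} x * hankel u x"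

lemma trunc_hankel:
  assumes u: "integrable \<mu> u" and pos: "\<And>y. 0 \<le> y \<Longrightarrow> 0 \<le> hankel u y"
  shows "integrable \<mu> (trunc_hankel u R)" "0 \<le> trunc_hankel u R x"
    "x \<notin> {1..<real R} \<Longrightarrow> trunc_hankel u R x = 0"
    "cell_energy (trunc_hankel u R) R = cell_energy (hankel u) R"
proof -
  have [measurable]: "u \<in> borel_measurable borel" using borel_measurable_integrable[OF u] by simp
  show "0 \<le> trunc_hankel u R x" using pos[of x] by (simp add: trunc_hankel_def indicator_def)
  show "x \<notin> {1..<real R} \<Longrightarrow> trunc_hankel u R x = 0" by (simp add: trunc_hankel_def)
  have "0 \<le> (LINT x|\<mu>. \<bar>u x\<bar>)" by (rule integral_nonneg_AE) simp
  then show "integrable \<mu> (trunc_hankel u R)"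
    using abs_hankel_le[OF u]
    by (intro integrable_bounded_on_interval[where B="LINT x|\<mu>. \<bar>u x\<bar>" and r="real R"])
       (auto simp: trunc_hankel_def[abs_def] indicator_def)
  have "cell_int (trunc_hankel u R) k = cell_int (hankel u) k" if k: "k \<in> {1..<R}" for k
  proof -
    have "bk_I (Suc k) \<subseteq> {1..<real R}"
    proof
      fix x assume "x \<in> bk_I (Suc k)"
      moreover have "real k + 1 \<le> real R" "1 \<le> real k" using k by auto
      ultimately show "x \<in> {1..<real R}" by (auto simp: bk_I_Suc)
    qed
    then show ?thesis unfolding cell_int_def trunc_hankel_def
      by (intro Bochner_Integration.integral_cong refl) (auto simp: indicator_def)
  qed
  then show "cell_energy (trunc_hankel u R) R = cell_energy (hankel u) R"
    unfolding cell_energy_def by (intro sum.cong refl) simp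
qed

text \<open>Nonnegativity enters twice: the transform of H = h \<open>hankel v\<close> is
  nonnegative, so inversion applies to H, and replacing \<open>hankel u\<close> by its truncation v
  only decreases the pairing. The energy is a finite sum, so half of it may be absorbed.\<close>

theorem cell_energy_bounded:
  assumes u: "integrable \<mu> u" and pos: "\<And>y. 0 \<le> y \<Longrightarrow> 0 \<le> hankel u y"
    and d: "0 < d" and sq: "integrable \<mu> (\<lambda>x. indicator {0..d} x * (u x)\<^sup>2)"
  shows "\<exists>C. \<forall>R. cell_energy (hankel u) R \<le> C"
proof -
  have um [measurable]: "u \<in> borel_measurable borel" using borel_measurable_integrable[OF u] by simp
  define e where "e = min (1/2) (d/2)"
  have e: "0 < e" "e \<le> 1/2" "2 * e \<le> d" using d by (auto simp: e_def)
  obtain h B0 where hm: "h \<in> borel_measurable borel" and hb0: "\<And>x. \<bar>h x\<bar> \<le> B0"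
    and hs: "\<And>x. x \<notin> {0..2 * e} \<Longrightarrow> h x = 0"
    and ft: "\<And>z. hankel h z = (bessel_j (\<alpha> + 2) (e * z))\<^sup>2"
    using positive_definite_cutoff[OF e(1)] by blast
  note [measurable] = hm
  \<comment> \<open>One is added to have a strictly positive bound, needed for the parameter
    \<open>\<tau>\<close> below.\<close>
  define B where "B = B0 + 1"
  have B: "0 < B" and hb: "\<bar>h x\<bar> \<le> B" for x
    using hb0[of x] order_trans[OF abs_ge_zero hb0] by (auto simp: B_def add_nonneg_pos)
  have hi: "integrable \<mu> h"
    by (rule integrable_bounded_on_interval[OF hm hb hs])
  define P where "P = (LINT x|\<mu>. indicator {0..d} x * (u x)\<^sup>2)"
  \<comment> \<open>The energy estimate is used with s = 1; \<open>exp 1\<close> pays for inserting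
    exp(- x^2) on [0, 2 e], which lies in [0, 1].\<close>
  define E where "E = exp 1 * energy_const"
  have E: "0 < E" using energy_const_pos by (simp add: E_def)
  \<comment> \<open>Chosen so that the energy term of the upper bound becomes exactly half of the
    lower bound \<open>cutoff_const * A\<close>.\<close>
  define \<tau> where "\<tau> = inv_const * B * E / cutoff_const"
  have \<tau>: "0 < \<tau>" using inv_const_pos B E cutoff_const_pos by (simp add: \<tau>_def)
  have "cell_energy (hankel u) R \<le> inv_const * B * \<tau> * P / cutoff_const" for R
  proof -
    define v where "v = trunc_hankel u R"
    have v: "integrable \<mu> v" "\<And>x. 0 \<le> v x" "\<And>x. x \<notin> {1..<real R} \<Longrightarrow> v x = 0"
      "cell_energy v R = cell_energy (hankel u) R"
      unfolding v_def by (intro trunc_hankel u pos; assumption)+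
    define A where "A = cell_energy v R"
  let ?S = "\<lambda>x. exp (- 1 * x\<^sup>2) * (hankel v x)\<^sup>2"
  let ?m = "\<lambda>x. B * (\<tau> / 2) * (indicator {0..d} x * (u x)\<^sup>2) + B * exp 1 / (2 * \<tau>) * ?S x"
    have vm [measurable]: "v \<in> borel_measurable borel" using borel_measurable_integrable[OF v(1)] by simp
    define H where "H x = h x * hankel v x" for x
    define V where "V = (LINT x|\<mu>. \<bar>v x\<bar>)"
    have Vb: "\<bar>hankel v x\<bar> \<le> V" for x unfolding V_def by (rule abs_hankel_le[OF v(1)])
    have Hm [measurable]: "H \<in> borel_measurable borel" unfolding H_def[abs_def] by measurable
    have Hb: "\<bar>H x\<bar> \<le> B * V" for x
      unfolding H_def abs_mult using hb Vb B by (intro mult_mono) auto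
    have Hs: "H x = 0" if "x \<notin> {0..2 * e}" for x using hs[OF that] by (simp add: H_def)
    have Hi: "integrable \<mu> H" by (rule integrable_bounded_on_interval[OF Hm Hb Hs])
    have psi: "hankel H y = (LINT m|\<mu>. v m * kern h y m)" for y
      unfolding H_def by (rule hankel_mult_hankel[OF hi v(1)])
    have psi0: "0 \<le> hankel H y" for y
      unfolding psi using v(2) kern_cutoff_nonneg[OF hi ft] by (intro integral_nonneg_AE) simp
    have psii: "integrable \<mu> (hankel H)" by (rule hankel_inversion(1)[OF Hi Hb psi0])
    have inv: "AE x in \<mu>. hankel (hankel H) x = inv_const * H x" by (rule hankel_inversion(2)[OF Hi Hb psi0])
    have "(LINT y|\<mu>. hankel H y * hankel u y) = (LINT x|\<mu>. u x * hankel (hankel H) x)"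
      by (rule hankel_exchange[OF psii u])
    also have "\<dots> = (LINT x|\<mu>. inv_const * (u x * H x))"
      using inv by (intro integral_cong_AE) (auto elim!: eventually_mono)
    also have "\<dots> = inv_const * (LINT x|\<mu>. u x * H x)" by simp
    finally have main: "(LINT y|\<mu>. hankel H y * hankel u y) = inv_const * (LINT x|\<mu>. u x * H x)" .

    have lower: "cutoff_const * A \<le> (LINT y|\<mu>. hankel H y * hankel u y)"
    proof -
      \<comment> \<open>The upper bound lemma applied to - h gives the lower bound. Off the diagonal
        the nonnegativity of the kernel suffices, so only the cells k = m contribute.\<close>
      let ?g = "\<lambda>x. - h x"
  let ?c = "\<lambda>k m. if k = m then - (cutoff_const / bk_omega \<alpha> (Suc k)) else 0"
      have kg: "kern ?g x y = - kern h x y" for x y by (simp add: kern_def)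
      have "(LINT x|\<mu>. v x * (LINT y|\<mu>. v y * kern ?g x y)) \<le>
         (\<Sum>k\<in>{1..<R}. \<Sum>m\<in>{1..<R}. ?c k m * (cell_int v k * cell_int v m))"
      proof (rule integral_kern_le[OF _ v(1) v(2) v(3)])
        show "integrable \<mu> ?g" using hi by simp
        fix k m x y assume "k \<in> {1..<R}" "x \<in> bk_I (Suc k)" "y \<in> bk_I (Suc m)"
        then show "kern ?g x y \<le> ?c k m"
          unfolding kg using kern_cutoff_nonneg[OF hi ft, of x y] kern_cutoff_ge[OF hi ft e(1,2), of k x y] by auto
      qed
      also have "\<dots> = (\<Sum>k\<in>{1..<R}. - cutoff_const * ((cell_int v k)\<^sup>2 / bk_omega \<alpha> (Suc k)))"
      proof (rule sum.cong[OF refl])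
        fix k assume k: "k \<in> {1..<R}"
        have "(\<Sum>m\<in>{1..<R}. ?c k m * (cell_int v k * cell_int v m))
          = (\<Sum>m\<in>{1..<R}. if k = m then - (cutoff_const / bk_omega \<alpha> (Suc k)) * (cell_int v k * cell_int v m) else 0)"
          by (intro sum.cong) auto
        also have "\<dots> = - cutoff_const * ((cell_int v k)\<^sup>2 / bk_omega \<alpha> (Suc k))"
          using k by (subst sum.delta') (auto simp: power2_eq_square)
        finally show "(\<Sum>m\<in>{1..<R}. ?c k m * (cell_int v k * cell_int v m))
          = - cutoff_const * ((cell_int v k)\<^sup>2 / bk_omega \<alpha> (Suc k))" .
      qed
      also have "\<dots> = - cutoff_const * A" by (simp add: A_def cell_energy_def sum_distrib_left)
      finally have "cutoff_const * A \<le> (LINT x|\<mu>. v x * (LINT y|\<mu>. v y * kern h x y))"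
        by (simp add: kg)
      also have "\<dots> = (LINT x|\<mu>. hankel H x * v x)" by (simp add: psi mult.commute)
      also have "\<dots> \<le> (LINT y|\<mu>. hankel H y * hankel u y)"
      proof (rule integral_mono_AE)
        show "integrable \<mu> (\<lambda>x. hankel H x * hankel u x)"
          by (rule integrable_bounded_mult(1)[OF psii _ abs_hankel_le[OF u]]) measurable
        have "\<bar>v x\<bar> \<le> (LINT x|\<mu>. \<bar>u x\<bar>)" for x
          using abs_hankel_le[OF u, of x] by (auto simp: v_def trunc_hankel_def indicator_def)
        then show "integrable \<mu> (\<lambda>x. hankel H x * v x)"
          by (rule integrable_bounded_mult(1)[OF psii vm])
        show "AE x in \<mu>. hankel H x * v x \<le> hankel H x * hankel u x"
          using AE_bk_measure_nonneg
        proof eventually_elim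
          case (elim x)
          then show ?case using psi0[of x] pos[of x] by (intro mult_left_mono) (auto simp: v_def trunc_hankel_def indicator_def)
        qed
      qed
      finally show ?thesis .
    qed

    have "(LINT x|\<mu>. u x * H x) \<le> (LINT x|\<mu>. ?m x)"
    proof (rule integral_mono)
      show "integrable \<mu> (\<lambda>x. u x * H x)" by (rule integrable_bounded_mult(1)[OF u Hm Hb])
      have "integrable \<mu> ?S"
      proof (rule integrable_bounded_mult(1)[OF integrable_gauss])
        show "\<bar>(hankel v x)\<^sup>2\<bar> \<le> V\<^sup>2" for x using power_mono[OF Vb[of x], of 2] by simp
      qed measurable
      then show "integrable \<mu> (\<lambda>x. ?m x)"
        using sq by (intro Bochner_Integration.integrable_add integrable_mult_right)
      fix x
      show "u x * H x \<le> ?m x"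
      proof (cases "x \<in> {0..2 * e}")
        case True
        then have xd: "x \<in> {0..d}" and x1: "x\<^sup>2 \<le> 1" using e by (auto simp: abs_square_le_1)
        have "u x * H x \<le> \<bar>h x\<bar> * \<bar>u x * hankel v x\<bar>"
          using abs_ge_self[of "u x * H x"] by (simp add: H_def abs_mult mult_ac)
        also have "\<dots> \<le> B * (\<tau> / 2 * (u x)\<^sup>2 + (hankel v x)\<^sup>2 / (2 * \<tau>))"
          using hb B \<tau> by (intro mult_mono abs_mult_le_weighted) auto
        also have "(hankel v x)\<^sup>2 / (2 * \<tau>) \<le> exp 1 * ?S x / (2 * \<tau>)"
        proof (intro divide_right_mono)
          have "1 \<le> exp 1 * exp (- x\<^sup>2)" using x1 by (simp flip: exp_add)
          then have "1 * (hankel v x)\<^sup>2 \<le> exp 1 * exp (- x\<^sup>2) * (hankel v x)\<^sup>2" by (intro mult_right_mono) auto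
          then show "(hankel v x)\<^sup>2 \<le> exp 1 * ?S x" by (simp add: mult.assoc)
        qed (use \<tau> in auto)
        finally have "u x * H x \<le> B * (\<tau> / 2 * (u x)\<^sup>2 + exp 1 * ?S x / (2 * \<tau>))"
          using B by simp
        then show ?thesis using xd by (simp add: distrib_left mult.assoc)
      next
        case False
        then show ?thesis using Hs[OF False] B \<tau> by simp
      qed
    qed
    also have "\<dots> = B * (\<tau> / 2) * P + B * exp 1 / (2 * \<tau>) * (LINT x|\<mu>. ?S x)"
    proof -
      have "integrable \<mu> ?S"
      proof (rule integrable_bounded_mult(1)[OF integrable_gauss])
        show "\<bar>(hankel v x)\<^sup>2\<bar> \<le> V\<^sup>2" for x using power_mono[OF Vb[of x], of 2] by simp
      qed measurable
      then show ?thesis unfolding P_def using sq by (subst Bochner_Integration.integral_add) auto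
    qed
    also have "\<dots> \<le> B * (\<tau> / 2) * P + B * exp 1 / (2 * \<tau>) * (energy_const * A)"
    proof -
      have "(LINT x|\<mu>. ?S x) \<le> energy_const * 1 powr (- 1/2) * cell_energy v R"
        by (rule hankel_gauss_energy[OF v(1) v(2)]) (auto intro: v(3))
      then show ?thesis using B \<tau> unfolding A_def by (intro add_left_mono mult_left_mono) auto
    qed
    also have "\<dots> = B * \<tau> * P / 2 + B * E * A / (2 * \<tau>)" by (simp add: E_def)
    finally have upper: "inv_const * (LINT x|\<mu>. u x * H x) \<le> inv_const * (B * \<tau> * P / 2 + B * E * A / (2 * \<tau>))"
      using inv_const_pos by (intro mult_left_mono) auto
    also have "\<dots> = inv_const * B * \<tau> * P / 2 + cutoff_const * A / 2"
      using \<tau> inv_const_pos B E cutoff_const_pos by (simp add: \<tau>_def distrib_left) (simp add: mult_ac)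
    finally have "cutoff_const * A \<le> inv_const * B * \<tau> * P" using lower main by linarith
    then show ?thesis using cutoff_const_pos v(4) by (simp add: A_def field_simps)
  qed
  then show ?thesis by blast
qed

end

section \<open>From the transform to square integrals over cells\<close>

context bessel_kingman
begin

text \<open>The square of G decays like exp(- 2 x^2), and exp(s x^2) with s <= 1 uses up at most
  half of that.\<close>

lemma gauss_comb_sq_integrable:
  assumes G: "G \<in> borel_measurable borel" "\<And>x. 0 \<le> x \<Longrightarrow> \<bar>G x\<bar> \<le> C * exp (- x\<^sup>2)" and s: "s \<le> 1"
  shows "integrable \<mu> (\<lambda>x. exp (s * x\<^sup>2) * (G x)\<^sup>2)"
    and "0 \<le> x \<Longrightarrow> exp (s * x\<^sup>2) * (G x)\<^sup>2 \<le> C\<^sup>2 * exp (- 1 * x\<^sup>2)"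
proof -
  note [measurable] = G(1)
  show le: "exp (s * x\<^sup>2) * (G x)\<^sup>2 \<le> C\<^sup>2 * exp (- 1 * x\<^sup>2)" if "0 \<le> x" for x
  proof -
    have "(G x)\<^sup>2 \<le> (C * exp (- x\<^sup>2))\<^sup>2" using power_mono[OF G(2)[OF that], of 2] by simp
    also have "\<dots> = C\<^sup>2 * exp (- 2 * x\<^sup>2)" by (simp add: power_mult_distrib exp_double[symmetric])
    finally have "exp (s * x\<^sup>2) * (G x)\<^sup>2 \<le> exp (s * x\<^sup>2) * (C\<^sup>2 * exp (- 2 * x\<^sup>2))" by (intro mult_left_mono) auto
    also have "\<dots> = C\<^sup>2 * exp (s * x\<^sup>2 + - 2 * x\<^sup>2)" by (simp only: exp_add mult_ac)
    also have "\<dots> \<le> C\<^sup>2 * exp (- 1 * x\<^sup>2)"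
    proof -
      have "s * x\<^sup>2 \<le> 1 * x\<^sup>2" using s by (intro mult_right_mono) auto
      then show ?thesis by (intro mult_left_mono) auto
    qed
    finally show ?thesis .
  qed
  show "integrable \<mu> (\<lambda>x. exp (s * x\<^sup>2) * (G x)\<^sup>2)"
  proof (rule Bochner_Integration.integrable_bound)
    show "integrable \<mu> (\<lambda>x. C\<^sup>2 * exp (- 1 * x\<^sup>2))" using integrable_gauss[of 1] by simp
    show "AE x in \<mu>. norm (exp (s * x\<^sup>2) * (G x)\<^sup>2) \<le> norm (C\<^sup>2 * exp (- 1 * x\<^sup>2))"
      using AE_bk_measure_nonneg by eventually_elim (use le in \<open>simp add: abs_mult\<close>)
  qed measurable
qed

text \<open>Parseval's formula moves the pairing to the transform side. On cell 0 the transform of G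
  is bounded by its integral norm; on the other cells an exchange brings in \<open>hankel v\<close>,
  to which the energy estimate applies.\<close>

lemma gauss_comb_pairing_bound:
  assumes u: "integrable \<mu> u" and pos: "\<And>y. 0 \<le> y \<Longrightarrow> 0 \<le> hankel u y"
    and A: "\<And>R. cell_energy (hankel u) R \<le> A"
    and G: "gauss_comb G" "\<And>x. 0 \<le> x \<Longrightarrow> \<bar>G x\<bar> \<le> C * exp (- x\<^sup>2)" and s: "0 < s" "s \<le> 1" and t: "0 < t"
  shows "inv_const * (LINT x|\<mu>. u x * G x) \<le>
     cell_int (hankel u) 0 * (LINT x|\<mu>. \<bar>G x\<bar>) +
     (t / 2 * (LINT x|\<mu>. exp (s * x\<^sup>2) * (G x)\<^sup>2) + energy_const * s powr (- 1/2) * A / (2 * t))"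
    (is "_ \<le> ?rhs")
proof -
  let ?Q = "LINT x|\<mu>. exp (s * x\<^sup>2) * (G x)\<^sup>2"
  let ?N = "LINT x|\<mu>. \<bar>G x\<bar>"
  let ?E = "energy_const * s powr (- 1/2) * A"
  let ?K = "cell_int (hankel u) 0"
  have um [measurable]: "u \<in> borel_measurable borel" using borel_measurable_integrable[OF u] by simp
  have Gm [measurable]: "G \<in> borel_measurable borel" by (rule measurable_gauss_comb[OF G(1)])
  have Gi: "integrable \<mu> G" by (rule integrable_gauss_comb[OF G(1)])
  note GP = gauss_comb_Parseval[OF u G(1)]
  let ?U = "LINT x|\<mu>. \<bar>u x\<bar>"
  have U0: "0 \<le> ?U" by (rule integral_nonneg_AE) simp
  have part: "(LINT y|\<mu>. indicator {0..<real R} y * (hankel u y * hankel G y)) \<le> ?rhs" if R: "1 \<le> R" for R :: nat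
  proof -
    define v where "v = trunc_hankel u R"
    have v: "integrable \<mu> v" "\<And>x. 0 \<le> v x" "\<And>x. x \<notin> {1..<real R} \<Longrightarrow> v x = 0"
      "cell_energy v R = cell_energy (hankel u) R"
      unfolding v_def by (intro trunc_hankel u pos; assumption)+
    have [measurable]: "v \<in> borel_measurable borel" using borel_measurable_integrable[OF v(1)] by simp
    define w where "w x = hankel u x * indicator (bk_I (Suc 0)) x" for x
    have wm [measurable]: "w \<in> borel_measurable borel" unfolding w_def[abs_def] by measurable
    have wi: "integrable \<mu> w"
      using abs_hankel_le[OF u] U0
      by (intro integrable_bounded_on_interval[where B="?U" and r=1] wm) (auto simp: w_def indicator_def bk_I_Suc)
    have w0: "AE x in \<mu>. 0 \<le> w x"
      using AE_bk_measure_nonneg by eventually_elim (simp add: w_def pos)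
    have split: "indicator {0..<real R} y * (hankel u y * hankel G y) = w y * hankel G y + v y * hankel G y" for y
    proof -
      have "1 \<le> real R" using R by simp
      then have "indicator {0..<real R} y = (indicator (bk_I (Suc 0)) y + indicator {1..<real R} y :: real)"
        by (auto simp: bk_I_Suc indicator_def)
      then show ?thesis by (simp add: w_def v_def trunc_hankel_def algebra_simps)
    qed
    have iw: "integrable \<mu> (\<lambda>y. w y * hankel G y)"
      by (rule integrable_bounded_mult(1)[OF wi _ abs_hankel_le[OF Gi]]) measurable
    have iv: "integrable \<mu> (\<lambda>y. v y * hankel G y)"
      by (rule integrable_bounded_mult(1)[OF v(1) _ abs_hankel_le[OF Gi]]) measurable
    have "(LINT y|\<mu>. w y * hankel G y) \<le> (LINT y|\<mu>. w y * ?N)"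
    proof (rule integral_mono_AE[OF iw])
      show "integrable \<mu> (\<lambda>y. w y * ?N)" using wi by simp
      show "AE y in \<mu>. w y * hankel G y \<le> w y * ?N"
        using w0 by eventually_elim (intro mult_left_mono abs_le_D1[OF abs_hankel_le[OF Gi]])
    qed
    also have "\<dots> = ?K * ?N"
      by (simp add: cell_int_def w_def)
    finally have 1: "(LINT y|\<mu>. w y * hankel G y) \<le> ?K * ?N" .
    have i1: "integrable \<mu> (\<lambda>x. exp (s * x\<^sup>2) * (G x)\<^sup>2)"
      by (rule gauss_comb_sq_integrable(1)[OF Gm G(2) s(2)])
    have i2: "integrable \<mu> (\<lambda>x. exp (- s * x\<^sup>2) * (hankel v x)\<^sup>2)"
    proof (rule integrable_bounded_mult(1)[OF integrable_gauss[OF s(1)]])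
      show "\<bar>(hankel v x)\<^sup>2\<bar> \<le> (LINT x|\<mu>. \<bar>v x\<bar>)\<^sup>2" for x
        using power_mono[OF abs_hankel_le[OF v(1), of x], of 2] by simp
    qed measurable
    have "(LINT y|\<mu>. v y * hankel G y) = (LINT x|\<mu>. G x * hankel v x)"
      by (rule hankel_exchange[OF v(1) Gi])
    also have "\<dots> \<le> (LINT x|\<mu>. t / 2 * (exp (s * x\<^sup>2) * (G x)\<^sup>2) + exp (- s * x\<^sup>2) * (hankel v x)\<^sup>2 / (2 * t))"
    proof (rule integral_mono)
      show "integrable \<mu> (\<lambda>x. G x * hankel v x)"
        by (rule integrable_bounded_mult(1)[OF Gi _ abs_hankel_le[OF v(1)]]) measurable
      show "integrable \<mu> (\<lambda>x. t / 2 * (exp (s * x\<^sup>2) * (G x)\<^sup>2) + exp (- s * x\<^sup>2) * (hankel v x)\<^sup>2 / (2 * t))"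
        using i1 i2 by (intro Bochner_Integration.integrable_add integrable_mult_right integrable_divide)
      fix x
      \<comment> \<open>The weights exp(s x^2 / 2) and exp(- s x^2 / 2) cancel in the product; their
        squares are the weights of the two integrals in the bound.\<close>
      have "G x * hankel v x = (exp (s * x\<^sup>2 / 2) * G x) * (exp (- (s * x\<^sup>2 / 2)) * hankel v x)"
        by (simp add: exp_minus)
      also have "\<dots> \<le> t / 2 * (exp (s * x\<^sup>2 / 2) * G x)\<^sup>2 + (exp (- (s * x\<^sup>2 / 2)) * hankel v x)\<^sup>2 / (2 * t)"
        using abs_mult_le_weighted[OF t] abs_ge_self order_trans by blast
      also have "\<dots> = t / 2 * (exp (s * x\<^sup>2) * (G x)\<^sup>2) + exp (- s * x\<^sup>2) * (hankel v x)\<^sup>2 / (2 * t)"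
        by (simp add: power_mult_distrib exp_double[symmetric])
      finally show "G x * hankel v x \<le> t / 2 * (exp (s * x\<^sup>2) * (G x)\<^sup>2) + exp (- s * x\<^sup>2) * (hankel v x)\<^sup>2 / (2 * t)" .
    qed
    also have "\<dots> = t / 2 * ?Q + (LINT x|\<mu>. exp (- s * x\<^sup>2) * (hankel v x)\<^sup>2) / (2 * t)"
      by (subst Bochner_Integration.integral_add[OF integrable_mult_right[OF i1] integrable_divide[OF i2]])
         (simp only: integral_mult_right_zero integral_divide_zero)
    also have "\<dots> \<le> t / 2 * ?Q + ?E / (2 * t)"
    proof (intro add_left_mono divide_right_mono)
      have "(LINT x|\<mu>. exp (- s * x\<^sup>2) * (hankel v x)\<^sup>2) \<le> energy_const * s powr (- 1/2) * cell_energy v R"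
        by (rule hankel_gauss_energy[OF v(1) v(2)]) (auto intro: v(3) s)
      also have "\<dots> \<le> ?E"
        unfolding v(4) using energy_const_pos by (intro mult_left_mono A) auto
      finally show "(LINT x|\<mu>. exp (- s * x\<^sup>2) * (hankel v x)\<^sup>2) \<le> ?E" .
    qed (use t in simp)
    finally have 2: "(LINT y|\<mu>. v y * hankel G y) \<le>
       t / 2 * ?Q + ?E / (2 * t)" .
    show ?thesis unfolding split Bochner_Integration.integral_add[OF iw iv] using 1 2 by (rule add_mono)
  qed
  have "integrable \<mu> (\<lambda>y. hankel G y * hankel u y)"
    by (rule integrable_bounded_mult(1)[OF GP(2) _ abs_hankel_le[OF u]]) measurable
  then have iUG: "integrable \<mu> (\<lambda>y. hankel u y * hankel G y)" by (simp add: mult.commute)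
  \<comment> \<open>The truncation is removed by dominated convergence, the transform of G being
    integrable and that of u bounded.\<close>
  have "(\<lambda>R. LINT y|\<mu>. indicator {0..<real R} y * (hankel u y * hankel G y)) \<longlonglongrightarrow> (LINT y|\<mu>. hankel u y * hankel G y)"
  proof (rule integral_dominated_convergence)
    show "integrable \<mu> (\<lambda>y. \<bar>hankel u y * hankel G y\<bar>)" using iUG by simp
    show "AE y in \<mu>. (\<lambda>R. indicator {0..<real R} y * (hankel u y * hankel G y)) \<longlonglongrightarrow> hankel u y * hankel G y"
      using AE_bk_measure_nonneg
    proof eventually_elim
      case (elim y)
      obtain N :: nat where N: "y < real N" using reals_Archimedean2 by blast
      have "eventually (\<lambda>R. indicator {0..<real R} y * (hankel u y * hankel G y) = hankel u y * hankel G y) sequentially"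
        using eventually_ge_at_top[of N]
      proof eventually_elim
        case (elim R)
        then have "y < real R" using N by (meson less_le_trans of_nat_mono)
        then show ?case using \<open>0 \<le> y\<close> by simp
      qed
      then show ?case by (rule tendsto_eventually)
    qed
    show "AE y in \<mu>. norm (indicator {0..<real R} y * (hankel u y * hankel G y)) \<le> \<bar>hankel u y * hankel G y\<bar>" for R :: nat
      by (intro AE_I2) (simp add: indicator_def)
  qed measurable
  then have "(LINT y|\<mu>. hankel u y * hankel G y) \<le> ?rhs"
    by (rule Lim_bounded[where M=1]) (intro allI impI part)
  then show ?thesis unfolding GP(1) .
qed

text \<open>The three integrals involving G in the preceding bound converge along the Gaussian
  approximation of g, while the remaining terms are constant.\<close>

lemma bounded_pairing_bound:
  assumes u: "integrable \<mu> u" and pos: "\<And>y. 0 \<le> y \<Longrightarrow> 0 \<le> hankel u y"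
    and A: "\<And>R. cell_energy (hankel u) R \<le> A"
    and g: "g \<in> borel_measurable borel" "\<And>x. \<bar>g x\<bar> \<le> B" "\<And>x. x \<notin> {0..r} \<Longrightarrow> g x = 0" "0 \<le> r"
    and s: "0 < s" "s \<le> 1" and t: "0 < t"
  shows "inv_const * (LINT x|\<mu>. u x * g x) \<le>
     cell_int (hankel u) 0 * (LINT x|\<mu>. \<bar>g x\<bar>) +
     (t / 2 * (LINT x|\<mu>. exp (s * x\<^sup>2) * (g x)\<^sup>2) + energy_const * s powr (- 1/2) * A / (2 * t))"
proof -
  let ?Q = "\<lambda>g. LINT x|\<mu>. exp (s * x\<^sup>2) * (g x)\<^sup>2"
  let ?N = "\<lambda>g. LINT x|\<mu>. \<bar>g x :: real\<bar>"
  let ?E = "energy_const * s powr (- 1/2) * A / (2 * t)"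
  let ?K = "cell_int (hankel u) 0"
  note [measurable] = g(1)
  have um [measurable]: "u \<in> borel_measurable borel" using borel_measurable_integrable[OF u] by simp
  obtain G C where G: "\<And>n::nat. gauss_comb (G n)" "\<And>n x. 0 \<le> x \<Longrightarrow> \<bar>G n x\<bar> \<le> C * exp (- x\<^sup>2)"
      "AE x in \<mu>. (\<lambda>n. G n x) \<longlonglongrightarrow> g x"
    using bounded_measurable_gauss_comb_approx[OF g] by blast
  have [measurable]: "G n \<in> borel_measurable borel" for n by (rule measurable_gauss_comb[OF G(1)])
  have "integrable \<mu> (\<lambda>x. u x * exp (- x\<^sup>2))"
    using integrable_mult_gauss[OF u, of 1] by simp
  then have l1: "(\<lambda>n. LINT x|\<mu>. u x * G n x) \<longlonglongrightarrow> (LINT x|\<mu>. u x * g x)"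
    by (intro tendsto_integral_gauss_comb[where C=C] G g(1) um)
  have l2: "(\<lambda>n. LINT x|\<mu>. \<bar>G n x\<bar>) \<longlonglongrightarrow> ?N g"
  proof (rule integral_dominated_convergence)
    show "integrable \<mu> (\<lambda>x. C * exp (- x\<^sup>2))" using integrable_gauss[of 1] by simp
    show "AE x in \<mu>. (\<lambda>n. \<bar>G n x\<bar>) \<longlonglongrightarrow> \<bar>g x\<bar>"
      using G(3) by eventually_elim (rule tendsto_rabs)
    show "AE x in \<mu>. norm \<bar>G n x\<bar> \<le> C * exp (- x\<^sup>2)" for n
      using AE_bk_measure_nonneg by eventually_elim (simp add: G(2))
  qed measurable
  have l3: "(\<lambda>n. ?Q (G n)) \<longlonglongrightarrow> ?Q g"
  proof (rule integral_dominated_convergence)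
    show "integrable \<mu> (\<lambda>x. C\<^sup>2 * exp (- 1 * x\<^sup>2))" using integrable_gauss[of 1] by simp
    show "AE x in \<mu>. (\<lambda>n. exp (s * x\<^sup>2) * (G n x)\<^sup>2) \<longlonglongrightarrow> exp (s * x\<^sup>2) * (g x)\<^sup>2"
      using G(3) by eventually_elim (intro tendsto_intros)
    show "AE x in \<mu>. norm (exp (s * x\<^sup>2) * (G n x)\<^sup>2) \<le> C\<^sup>2 * exp (- 1 * x\<^sup>2)" for n
      using AE_bk_measure_nonneg
    proof eventually_elim
      case (elim x)
      have "exp (s * x\<^sup>2) * (G n x)\<^sup>2 \<le> C\<^sup>2 * exp (- 1 * x\<^sup>2)"
        by (rule gauss_comb_sq_integrable(2)[OF measurable_gauss_comb[OF G(1)] G(2) s(2) elim])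
      then show ?case by (simp add: abs_mult)
    qed
  qed measurable
  show ?thesis
  proof (rule LIMSEQ_le)
    show "(\<lambda>n. inv_const * (LINT x|\<mu>. u x * G n x)) \<longlonglongrightarrow> inv_const * (LINT x|\<mu>. u x * g x)"
      by (intro tendsto_intros l1)
    show "(\<lambda>n. ?K * ?N (G n) +
       (t / 2 * ?Q (G n) + ?E))
      \<longlonglongrightarrow> ?K * ?N g +
       (t / 2 * ?Q g + ?E)"
      by (intro tendsto_add tendsto_mult_left tendsto_const l2 l3)
    show "\<exists>N. \<forall>n\<ge>N. inv_const * (LINT x|\<mu>. u x * G n x) \<le> ?K * ?N (G n) +
       (t / 2 * ?Q (G n) + ?E)"
      by (intro exI allI impI gauss_comb_pairing_bound[OF u _ A G(1) G(2) s t] pos)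
  qed
qed

text \<open>The lower bound in \<open>bk_omega_bounds\<close> is 0 for this cell, so positivity is
  drawn from the density being positive on (0, 1).\<close>

lemma bk_omega_1_pos: "0 < bk_omega \<alpha> (Suc 0)"
proof (rule ccontr)
  assume "\<not> 0 < bk_omega \<alpha> (Suc 0)"
  then have "emeasure \<mu> (bk_I (Suc 0)) = 0"
    unfolding emeasure_bk_I using measure_nonneg[of \<mu> "bk_I (Suc 0)"] by (simp add: bk_omega_def)
  then have "(\<integral>\<^sup>+ x. ennreal (indicator {0..} x * x powr (2 * \<alpha> + 1)) * indicator {0..<1} x \<partial>lborel) = 0"
    unfolding bk_measure_def bk_I_Suc by (subst (asm) emeasure_density) auto
  then have "AE x in lborel. ennreal (indicator {0..} x * x powr (2 * \<alpha> + 1)) * indicator {0..<1} x = 0"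
    by (subst (asm) nn_integral_0_iff_AE) auto
  then have "AE x in lborel. \<not> (x \<in> {0<..<1::real})"
    by eventually_elim (auto simp: indicator_def split: if_splits)
  then have "emeasure lborel {0<..<1::real} = 0"
    by (subst (asm) AE_iff_measurable[of "{0<..<1}"]) auto
  then show False by simp
qed

lemma bk_omega_Suc_pos: "0 < bk_omega \<alpha> (Suc n)"
  using bk_omega_1_pos bk_omega_pos[of n] by (cases n) auto

text \<open>This absorbs the loss s^(-1/2) = n + 1 of the energy estimate. For n >= 1 it rests on n
  <= n^(2 \<alpha> + 1); the term with the first cell measure covers n = 0.\<close>

lemma Suc_le_bk_omega: "real n + 1 \<le> (2 + 1 / bk_omega \<alpha> (Suc 0)) * bk_omega \<alpha> (Suc n)"
proof (cases "n = 0")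
  case True
  then show ?thesis using bk_omega_1_pos by (simp add: field_simps)
next
  case False
  then have n: "1 \<le> real n" by simp
  have "real n powr 1 \<le> real n powr (2 * \<alpha> + 1)" using n half_le by (intro powr_mono) auto
  then have "real n \<le> bk_omega \<alpha> (Suc n)" using bk_omega_bounds(1)[of n] n by simp
  then have "real n + 1 \<le> 2 * bk_omega \<alpha> (Suc n)" using n by linarith
  also have "\<dots> \<le> (2 + 1 / bk_omega \<alpha> (Suc 0)) * bk_omega \<alpha> (Suc n)"
    using bk_omega_1_pos bk_omega_Suc_pos[of n] by (intro mult_right_mono) auto
  finally show ?thesis .
qed

text \<open>Test u against its own truncation g to one cell and to |u| <= m: then u g = g^2, and the
  pairing bound controls the finite integral X of g^2 by a fraction of itself plus a multiple of the
  cell measure. Fatou's lemma lets m grow.\<close>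

theorem square_integral_cells_bounded:
  assumes u: "integrable \<mu> u" and pos: "\<And>y. 0 \<le> y \<Longrightarrow> 0 \<le> hankel u y"
    and A: "\<And>R. cell_energy (hankel u) R \<le> A"
  shows "\<exists>C. \<forall>n. (\<integral>\<^sup>+ x. ennreal ((u x)\<^sup>2) * indicator (bk_I (Suc n)) x \<partial>\<mu>) \<le> ennreal (C * bk_omega \<alpha> (Suc n))"
proof -
  have um [measurable]: "u \<in> borel_measurable borel" using borel_measurable_integrable[OF u] by simp
  \<comment> \<open>One is added because \<open>\<rho>\<close> divides by K.\<close>
  define K where "K = cell_int (hankel u) 0 + 1"
  have K0: "0 \<le> cell_int (hankel u) 0"
  proof -
    have "AE x in \<mu>. 0 \<le> hankel u x * indicator (bk_I (Suc 0)) x"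
      using AE_bk_measure_nonneg by eventually_elim (simp add: pos)
    then show ?thesis unfolding cell_int_def by (rule integral_nonneg_AE)
  qed
  then have K: "0 < K" by (simp add: K_def)
  have A0: "0 \<le> A" using A[of 0] by (simp add: cell_energy_def)
  \<comment> \<open>With these values of \<open>\<rho>\<close> and \<open>\<tau>\<close> the terms
    containing X add up to \<open>inv_const / 2 * X\<close>, half of the left-hand side.\<close>
  define \<rho> where "\<rho> = inv_const / (2 * K)"
  define \<tau> where "\<tau> = inv_const / (2 * exp 1)"
  have \<rho>: "0 < \<rho>" and \<tau>: "0 < \<tau>" using inv_const_pos K by (simp_all add: \<rho>_def \<tau>_def)
  define c1 where "c1 = 2 + 1 / bk_omega \<alpha> (Suc 0)"
  let ?c = "K / (2 * \<rho>) + energy_const * A * c1 / (2 * \<tau>)"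
  define C where "C = 2 / inv_const * (?c)"
  have bound: "(LINT x|\<mu>. (if \<bar>u x\<bar> \<le> real m then (u x)\<^sup>2 * indicator (bk_I (Suc n)) x else 0)) \<le> C * bk_omega \<alpha> (Suc n)"
    for m n :: nat
  proof -
    define g where "g x = (if \<bar>u x\<bar> \<le> real m then u x * indicator (bk_I (Suc n)) x else 0)" for x
    \<comment> \<open>On the cell x <= n + 1, hence exp(s x^2) <= exp 1, at the price s^(-1/2) = n +
      1.\<close>
    define s where "s = 1 / (real n + 1)\<^sup>2"
    define X where "X = (LINT x|\<mu>. (g x)\<^sup>2)"
    let ?w = "bk_omega \<alpha> (Suc n)"
    have s: "0 < s" "s \<le> 1" by (auto simp: s_def)
    have ss: "s powr (- 1/2) = real n + 1"
    proof -
      have "s = (real n + 1) powr (- 2)" by (simp add: s_def powr_minus_divide)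
      then have "s powr (- 1/2) = (real n + 1) powr (- 2 * (- 1/2))" by (simp only: powr_powr)
      then show ?thesis by simp
    qed
    have gm [measurable]: "g \<in> borel_measurable borel" unfolding g_def[abs_def] by measurable
    have gb: "\<bar>g x\<bar> \<le> real m" for x by (simp add: g_def indicator_def)
    have gs: "g x = 0" if "x \<notin> {0..real n + 1}" for x using that by (auto simp: g_def bk_I_Suc indicator_def)
    have gs': "g x = 0" if "x \<notin> bk_I (Suc n)" for x using that by (auto simp: g_def indicator_def)
    have ig2: "integrable \<mu> (\<lambda>x. (g x)\<^sup>2)"
    proof (rule integrable_bounded_on_interval)
      show "\<bar>(g x)\<^sup>2\<bar> \<le> (real m)\<^sup>2" for x using power_mono[OF gb[of x], of 2] by simp
      show "(g x)\<^sup>2 = 0" if "x \<notin> {0..real n + 1}" for x using gs[OF that] by simp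
    qed measurable
    have ige: "integrable \<mu> (\<lambda>x. exp (s * x\<^sup>2) * (g x)\<^sup>2)" and
      le1: "(LINT x|\<mu>. exp (s * x\<^sup>2) * (g x)\<^sup>2) \<le> exp 1 * X"
    proof -
      have le: "exp (s * x\<^sup>2) * (g x)\<^sup>2 \<le> exp 1 * (g x)\<^sup>2" for x
      proof (cases "x \<in> {0..real n + 1}")
        case True
        then have "x\<^sup>2 \<le> (real n + 1)\<^sup>2" by (intro power_mono) auto
        then have "s * x\<^sup>2 \<le> 1" by (simp add: s_def divide_le_eq_1)
        then show ?thesis by (intro mult_right_mono) auto
      qed (simp add: gs)
      show i: "integrable \<mu> (\<lambda>x. exp (s * x\<^sup>2) * (g x)\<^sup>2)"
      proof (rule Bochner_Integration.integrable_bound)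
        show "integrable \<mu> (\<lambda>x. exp 1 * (g x)\<^sup>2)" using ig2 by simp
        show "AE x in \<mu>. norm (exp (s * x\<^sup>2) * (g x)\<^sup>2) \<le> norm (exp 1 * (g x)\<^sup>2)"
          using le by (intro AE_I2) (simp add: abs_mult)
      qed measurable
      have "(LINT x|\<mu>. exp (s * x\<^sup>2) * (g x)\<^sup>2) \<le> (LINT x|\<mu>. exp 1 * (g x)\<^sup>2)"
        using le ig2 by (intro integral_mono i) auto
      then show "(LINT x|\<mu>. exp (s * x\<^sup>2) * (g x)\<^sup>2) \<le> exp 1 * X" by (simp add: X_def)
    qed
    have le2: "(LINT x|\<mu>. \<bar>g x\<bar>) \<le> \<rho> / 2 * X + ?w / (2 * \<rho>)"
    proof -
      have "(LINT x|\<mu>. \<bar>g x\<bar>) \<le> (LINT x|\<mu>. \<rho> / 2 * (g x)\<^sup>2 + indicator (bk_I (Suc n)) x / (2 * \<rho>))"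
      proof (rule integral_mono)
        show "integrable \<mu> (\<lambda>x. \<bar>g x\<bar>)"
          by (intro integrable_abs integrable_bounded_on_interval[OF gm gb gs])
        show "integrable \<mu> (\<lambda>x. \<rho> / 2 * (g x)\<^sup>2 + indicator (bk_I (Suc n)) x / (2 * \<rho>))"
          using ig2 integrable_indicator_bk_I by (intro Bochner_Integration.integrable_add integrable_mult_right integrable_divide)
        show "\<bar>g x\<bar> \<le> \<rho> / 2 * (g x)\<^sup>2 + indicator (bk_I (Suc n)) x / (2 * \<rho>)" for x
        proof (cases "x \<in> bk_I (Suc n)")
          case True
          then show ?thesis using abs_mult_le_weighted[OF \<rho>, of "g x" 1] by simp
        qed (simp add: gs')
      qed
      also have "\<dots> = \<rho> / 2 * X + (LINT x|\<mu>. indicator (bk_I (Suc n)) x) / (2 * \<rho>)"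
        unfolding X_def
        by (subst Bochner_Integration.integral_add[OF integrable_mult_right[OF ig2] integrable_divide[OF integrable_indicator_bk_I]])
           (simp only: integral_mult_right_zero integral_divide_zero)
      also have "(LINT x|\<mu>. indicator (bk_I (Suc n)) x) = ?w" by (simp add: bk_omega_def)
      finally show ?thesis .
    qed
    have "inv_const * (LINT x|\<mu>. u x * g x) \<le> cell_int (hankel u) 0 * (LINT x|\<mu>. \<bar>g x\<bar>) +
       (\<tau> / 2 * (LINT x|\<mu>. exp (s * x\<^sup>2) * (g x)\<^sup>2) + energy_const * s powr (- 1/2) * A / (2 * \<tau>))"
      by (rule bounded_pairing_bound[OF u _ A gm gb gs _ s \<tau>]) (auto intro: pos)
    moreover have "u x * g x = (g x)\<^sup>2" for x by (simp add: g_def power2_eq_square indicator_def)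
    ultimately have "inv_const * X \<le> cell_int (hankel u) 0 * (LINT x|\<mu>. \<bar>g x\<bar>) +
       (\<tau> / 2 * (LINT x|\<mu>. exp (s * x\<^sup>2) * (g x)\<^sup>2) + energy_const * (real n + 1) * A / (2 * \<tau>))"
      by (simp only: X_def ss)
    also have "\<dots> \<le> K * (\<rho> / 2 * X + ?w / (2 * \<rho>)) + (\<tau> / 2 * (exp 1 * X) + energy_const * (c1 * ?w) * A / (2 * \<tau>))"
    proof (intro add_mono)
      have "0 \<le> (LINT x|\<mu>. \<bar>g x\<bar>)" by (rule integral_nonneg_AE) simp
      then show "cell_int (hankel u) 0 * (LINT x|\<mu>. \<bar>g x\<bar>) \<le> K * (\<rho> / 2 * X + ?w / (2 * \<rho>))"
        using le2 K0 by (intro mult_mono) (auto simp: K_def)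
      show "\<tau> / 2 * (LINT x|\<mu>. exp (s * x\<^sup>2) * (g x)\<^sup>2) \<le> \<tau> / 2 * (exp 1 * X)"
        using le1 \<tau> by (intro mult_left_mono) auto
      show "energy_const * (real n + 1) * A / (2 * \<tau>) \<le> energy_const * (c1 * ?w) * A / (2 * \<tau>)"
        using Suc_le_bk_omega[of n] energy_const_pos A0 \<tau> unfolding c1_def
        by (intro divide_right_mono mult_right_mono mult_left_mono) auto
    qed
    also have "\<dots> = (K * \<rho> + \<tau> * exp 1) / 2 * X + (?c) * ?w"
      by (simp add: algebra_simps add_divide_distrib)
    also have "(K * \<rho> + \<tau> * exp 1) / 2 = inv_const / 2"
    proof -
      have "K * \<rho> = inv_const / 2" using K by (simp add: \<rho>_def)
      moreover have "\<tau> * exp 1 = inv_const / 2" by (simp add: \<tau>_def)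
      ultimately show ?thesis by simp
    qed
    finally have "inv_const / 2 * X \<le> (?c) * ?w" by simp
    then have "2 / inv_const * (inv_const / 2 * X) \<le> 2 / inv_const * ((?c) * ?w)"
      using inv_const_pos by (intro mult_left_mono) auto
    moreover have "2 / inv_const * (inv_const / 2 * X) = X" using inv_const_pos by simp
    ultimately have "X \<le> C * ?w" by (simp only: C_def mult.assoc)
    moreover have "(g x)\<^sup>2 = (if \<bar>u x\<bar> \<le> real m then (u x)\<^sup>2 * indicator (bk_I (Suc n)) x else 0)" for x
      by (simp add: g_def indicator_def)
    ultimately show ?thesis by (simp only: X_def)
  qed
  have "(\<integral>\<^sup>+ x. ennreal ((u x)\<^sup>2) * indicator (bk_I (Suc n)) x \<partial>\<mu>) \<le> ennreal (C * bk_omega \<alpha> (Suc n))" for n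
  proof -
    let ?f = "\<lambda>m x. if \<bar>u x\<bar> \<le> real m then (u x)\<^sup>2 * indicator (bk_I (Suc n)) x else 0 :: real"
    have nn: "(\<integral>\<^sup>+ x. ennreal (?f m x) \<partial>\<mu>) \<le> ennreal (C * bk_omega \<alpha> (Suc n))" for m
    proof -
      have "integrable \<mu> (?f m)"
      proof (rule integrable_bounded_on_interval[where B="(real m)\<^sup>2" and r="real n + 1"])
        show "\<bar>?f m x\<bar> \<le> (real m)\<^sup>2" for x
          using power_mono[of "\<bar>u x\<bar>" "real m" 2] by (auto simp: indicator_def)
        show "?f m x = 0" if "x \<notin> {0..real n + 1}" for x
          using that by (auto simp: bk_I_Suc indicator_def)
      qed measurable
      then have "(\<integral>\<^sup>+ x. ennreal (?f m x) \<partial>\<mu>) = ennreal (LINT x|\<mu>. ?f m x)"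
        by (intro nn_integral_eq_integral) auto
      also have "\<dots> \<le> ennreal (C * bk_omega \<alpha> (Suc n))" by (intro ennreal_leI bound)
      finally show ?thesis .
    qed
    have "(\<integral>\<^sup>+ x. ennreal ((u x)\<^sup>2) * indicator (bk_I (Suc n)) x \<partial>\<mu>) = (\<integral>\<^sup>+ x. liminf (\<lambda>m. ennreal (?f m x)) \<partial>\<mu>)"
    proof (rule nn_integral_cong)
      fix x
      obtain N :: nat where N: "\<bar>u x\<bar> \<le> real N" using real_arch_simple by blast
      have "eventually (\<lambda>m. ennreal (?f m x) = ennreal ((u x)\<^sup>2) * indicator (bk_I (Suc n)) x) sequentially"
        using eventually_ge_at_top[of N]
      proof eventually_elim
        case (elim m)
        then have "\<bar>u x\<bar> \<le> real m" using N by (meson order_trans of_nat_mono)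
        then show ?case by (auto simp: indicator_def)
      qed
      then have "(\<lambda>m. ennreal (?f m x)) \<longlonglongrightarrow> ennreal ((u x)\<^sup>2) * indicator (bk_I (Suc n)) x" by (rule tendsto_eventually)
      then show "ennreal ((u x)\<^sup>2) * indicator (bk_I (Suc n)) x = liminf (\<lambda>m. ennreal (?f m x))"
        by (rule lim_imp_Liminf[symmetric, rotated]) simp
    qed
    also have "\<dots> \<le> liminf (\<lambda>m. \<integral>\<^sup>+ x. ennreal (?f m x) \<partial>\<mu>)"
      by (intro nn_integral_liminf) measurable
    also have "\<dots> \<le> liminf (\<lambda>m. ennreal (C * bk_omega \<alpha> (Suc n)))"
      by (intro Liminf_mono always_eventually allI nn)
    also have "\<dots> = ennreal (C * bk_omega \<alpha> (Suc n))" by (simp add: Liminf_const)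
    finally show ?thesis .
  qed
  then show ?thesis by blast
qed

end

section \<open>The equivalence\<close>

context bessel_kingman
begin

lemma bk_fourier_eq:
  assumes f: "integrable \<mu> f"
  shows "bk_fourier \<alpha> f s = Complex (hankel (\<lambda>x. Re (f x)) s) (hankel (\<lambda>x. Im (f x)) s)"
proof -
  have fm [measurable]: "f \<in> borel_measurable borel" using borel_measurable_integrable[OF f] by simp
  have int: "integrable \<mu> (\<lambda>x. f x * complex_of_real (bessel_j \<alpha> (s * x)))"
  proof (rule Bochner_Integration.integrable_bound[OF f])
    show "AE x in \<mu>. norm (f x * complex_of_real (bessel_j \<alpha> (s * x))) \<le> norm (f x)"
      using abs_bessel_j_le_1 by (intro AE_I2) (simp add: norm_mult mult_left_le)
  qed measurable
  show ?thesis
  proof (rule complex_eqI)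
    show "Re (bk_fourier \<alpha> f s) = Re (Complex (hankel (\<lambda>x. Re (f x)) s) (hankel (\<lambda>x. Im (f x)) s))"
      unfolding bk_fourier_def using integral_Re[OF int] by (simp add: hankel_def)
    show "Im (bk_fourier \<alpha> f s) = Im (Complex (hankel (\<lambda>x. Re (f x)) s) (hankel (\<lambda>x. Im (f x)) s))"
      unfolding bk_fourier_def using integral_Im[OF int] by (simp add: hankel_def)
  qed
qed

text \<open>The amalgam sum contains cell 0, which the energy omits; that single term is finite
  because U is bounded. Agreement on the half-line is enough, since the cells lie there.\<close>

lemma amalgam_L1_l2_iff_cell_energy:
  fixes F :: "real \<Rightarrow> complex"
  assumes F: "F \<in> borel_measurable borel" and U: "U \<in> borel_measurable borel" "\<And>x. \<bar>U x\<bar> \<le> B"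
    and eq: "\<And>x. 0 \<le> x \<Longrightarrow> norm (F x) = U x"
  shows "amalgam_L1_l2 \<alpha> F \<longleftrightarrow> (\<exists>C. \<forall>R. cell_energy U R \<le> C)"
proof -
  note [measurable] = F U(1)
  let ?w = "\<lambda>n. bk_omega \<alpha> (Suc n)"
  let ?V = "\<lambda>n x. U x * indicator (bk_I (Suc n)) x"
  define a where "a n = (cell_int U n)\<^sup>2 / ?w n" for n
  have U0: "0 \<le> U x" if "0 \<le> x" for x using eq[OF that] by (metis norm_ge_zero)
  have a0: "0 \<le> a n" for n using bk_omega_Suc_pos[of n] by (simp add: a_def)
  have cell: "(\<integral>\<^sup>+ x. ennreal (norm (F x)) * indicator (bk_I (Suc n)) x \<partial>\<mu>) = ennreal (cell_int U n)" for n
  proof -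
    have "(\<integral>\<^sup>+ x. ennreal (norm (F x)) * indicator (bk_I (Suc n)) x \<partial>\<mu>)
       = (\<integral>\<^sup>+ x. ennreal (?V n x) \<partial>\<mu>)"
    proof (rule nn_integral_cong)
      fix x
      show "ennreal (norm (F x)) * indicator (bk_I (Suc n)) x = ennreal (?V n x)"
      proof (cases "x \<in> bk_I (Suc n)")
        case True
        then show ?thesis using eq[of x] by (auto simp: bk_I_Suc)
      qed simp
    qed
    also have "\<dots> = ennreal (cell_int U n)"
      unfolding cell_int_def
    proof (rule nn_integral_eq_integral)
      show "AE x in \<mu>. 0 \<le> ?V n x"
        using AE_bk_measure_nonneg by eventually_elim (simp add: U0)
      show "integrable \<mu> (\<lambda>x. ?V n x)"
      proof (rule integrable_bounded_on_interval[where B=B and r="real n + 1"])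
        show "\<bar>?V n x\<bar> \<le> B" for x
          using U(2)[of x] by (auto simp: indicator_def)
        show "?V n x = 0" if "x \<notin> {0..real n + 1}" for x
          using that by (auto simp: bk_I_Suc indicator_def)
      qed measurable
    qed
    finally show ?thesis .
  qed
  have summand: "ennreal (?w n) * (ennreal (1 / ?w n) * ennreal (cell_int U n)) ^ 2 = ennreal (a n)" for n
  proof -
    have c0: "0 \<le> cell_int U n"
      unfolding cell_int_def
    proof (rule integral_nonneg_AE)
      show "AE x in \<mu>. 0 \<le> ?V n x"
        using AE_bk_measure_nonneg by eventually_elim (simp add: U0)
    qed
    have "ennreal (?w n) * (ennreal (1 / ?w n) * ennreal (cell_int U n)) ^ 2 = ennreal (?w n * (1 / ?w n * cell_int U n)\<^sup>2)"
      using bk_omega_Suc_pos[of n] c0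
      by (simp only: ennreal_mult[symmetric] ennreal_power less_imp_le zero_le_divide_1_iff zero_le_power2 mult_nonneg_nonneg)
    also have "?w n * (1 / ?w n * cell_int U n)\<^sup>2 = a n"
      using bk_omega_Suc_pos[of n] by (simp add: a_def power2_eq_square)
    finally show ?thesis .
  qed
  have "amalgam_L1_l2 \<alpha> F \<longleftrightarrow> (\<Sum>n. ennreal (a n)) < \<infinity>"
    unfolding amalgam_L1_l2_def cell summand using F by simp
  also have "\<dots> \<longleftrightarrow> (\<exists>C. \<forall>R. cell_energy U R \<le> C)"
  proof
    assume "(\<Sum>n. ennreal (a n)) < \<infinity>"
    then have "summable a" using a0 by (intro summable_suminf_not_top) auto
    then have "cell_energy U R \<le> suminf a" for R
      unfolding cell_energy_def a_def[symmetric] using a0 by (intro sum_le_suminf) auto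
    then show "\<exists>C. \<forall>R. cell_energy U R \<le> C" by blast
  next
    assume "\<exists>C. \<forall>R. cell_energy U R \<le> C"
    then obtain C where C: "\<And>R. cell_energy U R \<le> C" by blast
    have C': "(\<Sum>n<R. a n) \<le> a 0 + C" for R
    proof -
      have "(\<Sum>n<R. a n) \<le> (\<Sum>n\<in>insert 0 {1..<R}. a n)"
        using a0 by (intro sum_mono2) auto
      also have "\<dots> = a 0 + cell_energy U R" by (simp add: cell_energy_def a_def)
      finally show ?thesis using C[of R] by linarith
    qed
    have "summable a"
    proof (rule bounded_imp_summable)
      show "(\<Sum>n\<le>R. a n) \<le> a 0 + C" for R using C'[of "Suc R"] by (simp only: lessThan_Suc_atMost)
    qed (rule a0)
    then show "(\<Sum>n. ennreal (a n)) < \<infinity>" using a0 by (simp add: suminf_ennreal2)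
  qed
  finally show ?thesis .
qed

end

theorem mainTheorem1:
  fixes \<alpha> :: real and f :: "real \<Rightarrow> complex"
  assumes "\<alpha> \<ge> 1/2"
    and "integrable (bk_measure \<alpha>) f"
    and "\<And>s. s \<ge> 0 \<Longrightarrow> Im (bk_fourier \<alpha> f s) = 0 \<and> Re (bk_fourier \<alpha> f s) \<ge> 0"
  shows "((\<exists>\<delta>>0. (\<integral>\<^sup>+ x. ennreal (norm (f x) ^ 2) * indicator {0..\<delta>} x \<partial>bk_measure \<alpha>) < \<infinity>)
            \<longleftrightarrow> amalgam_L1_l2 \<alpha> (bk_fourier \<alpha> f))
       \<and> (amalgam_L1_l2 \<alpha> (bk_fourier \<alpha> f) \<longleftrightarrow> amalgam_L2_linf \<alpha> f)"
proof -
  interpret bessel_kingman \<alpha> by standard (rule assms(1))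
  let ?u = "\<lambda>x. Re (f x)" and ?v = "\<lambda>x. Im (f x)" and ?w = "\<lambda>n. bk_omega \<alpha> (Suc n)"
  let ?N = "\<lambda>n. \<integral>\<^sup>+ x. ennreal (norm (f x) ^ 2) * indicator (bk_I (Suc n)) x \<partial>bk_measure \<alpha>"
  let ?D = "\<lambda>\<delta>. \<integral>\<^sup>+ x. ennreal (norm (f x) ^ 2) * indicator {0..\<delta>} x \<partial>bk_measure \<alpha>"
  let ?U = "\<lambda>n. \<integral>\<^sup>+ x. ennreal ((?u x)\<^sup>2) * indicator (bk_I (Suc n)) x \<partial>bk_measure \<alpha>"
  let ?V = "\<lambda>n. \<integral>\<^sup>+ x. ennreal ((?v x)\<^sup>2) * indicator (bk_I (Suc n)) x \<partial>bk_measure \<alpha>"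
  have fm [measurable]: "f \<in> borel_measurable borel" using borel_measurable_integrable[OF assms(2)] by simp
  have u: "integrable (bk_measure \<alpha>) ?u" and v: "integrable (bk_measure \<alpha>) ?v"
    using assms(2) by (auto intro: integrable_Re integrable_Im)
  note four = bk_fourier_eq[OF assms(2)]
  have upos: "0 \<le> hankel ?u y" and vzero: "hankel ?v y = 0" if "0 \<le> y" for y
    using assms(3)[OF that] by (simp_all add: four)
  have ii_iff: "amalgam_L1_l2 \<alpha> (bk_fourier \<alpha> f) \<longleftrightarrow> (\<exists>C. \<forall>R. cell_energy (hankel ?u) R \<le> C)"
  proof (rule amalgam_L1_l2_iff_cell_energy)
    have "(\<lambda>s. complex_of_real (hankel ?u s) + \<i> * complex_of_real (hankel ?v s)) \<in> borel_measurable borel"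
      by measurable
    then show "bk_fourier \<alpha> f \<in> borel_measurable borel"
      by (simp add: four[abs_def] Complex_eq)
    show "hankel ?u \<in> borel_measurable borel" by measurable
    show "\<bar>hankel ?u x\<bar> \<le> (LINT x|bk_measure \<alpha>. \<bar>?u x\<bar>)" for x by (rule abs_hankel_le[OF u])
    show "norm (bk_fourier \<alpha> f x) = hankel ?u x" if "0 \<le> x" for x
      using upos[OF that] vzero[OF that] by (simp add: four complex_norm)
  qed
  have i_ii: "amalgam_L1_l2 \<alpha> (bk_fourier \<alpha> f)"
    if i: "\<exists>\<delta>>0. ?D \<delta> < \<infinity>"
  proof -
    obtain d where d: "0 < d" and fin: "?D d < \<infinity>"
      using i by blast
    have "integrable (bk_measure \<alpha>) (\<lambda>x. indicator {0..d} x * (?u x)\<^sup>2)"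
    proof (rule integrableI_nonneg)
      have "(\<integral>\<^sup>+ x. ennreal (indicator {0..d} x * (?u x)\<^sup>2) \<partial>bk_measure \<alpha>) \<le> ?D d"
      proof (rule nn_integral_mono)
        fix x
        have "(?u x)\<^sup>2 \<le> (norm (f x))\<^sup>2" using power_mono[OF abs_Re_le_cmod[of "f x"], of 2] by simp
        then show "ennreal (indicator {0..d} x * (?u x)\<^sup>2) \<le> ennreal (norm (f x) ^ 2) * indicator {0..d} x"
          by (auto simp: indicator_def intro!: ennreal_leI)
      qed
      with fin show "(\<integral>\<^sup>+ x. ennreal (indicator {0..d} x * (?u x)\<^sup>2) \<partial>bk_measure \<alpha>) < \<infinity>" by (rule le_less_trans[rotated])
    qed (auto simp: indicator_def)
    then show ?thesis unfolding ii_iff using cell_energy_bounded[OF u _ d] upos by blast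
  qed
  have ii_iii: "amalgam_L2_linf \<alpha> f" if ii: "amalgam_L1_l2 \<alpha> (bk_fourier \<alpha> f)"
  proof -
    obtain A where A: "\<And>R. cell_energy (hankel ?u) R \<le> A" using ii ii_iff by blast
    obtain C1 where C1: "\<And>n. ?U n \<le> ennreal (C1 * ?w n)"
      using square_integral_cells_bounded[OF u _ A] upos by blast
    \<comment> \<open>The imaginary part of f has transform zero on the half-line, so it satisfies
      the energy hypothesis with bound 0, and the same theorem controls its square
      integrals.\<close>
    have "cell_int (hankel ?v) k = 0" for k
    proof -
      have "cell_int (hankel ?v) k = (LINT x|bk_measure \<alpha>. 0)"
        unfolding cell_int_def
        by (intro Bochner_Integration.integral_cong refl) (auto simp: bk_I_Suc indicator_def vzero)
      then show ?thesis by simp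
    qed
    then have "cell_energy (hankel ?v) R \<le> 0" for R by (simp add: cell_energy_def)
    then obtain C2 where C2: "\<And>n. ?V n \<le> ennreal (C2 * ?w n)"
      using square_integral_cells_bounded[OF v, of 0] vzero by auto
    have "ennreal (1 / ?w n) * ?N n \<le> ennreal (\<bar>C1\<bar> + \<bar>C2\<bar>)" for n
    proof -
      have w: "0 < ?w n" by (rule bk_omega_Suc_pos)
      have "?N n =
        (\<integral>\<^sup>+ x. ennreal ((?u x)\<^sup>2) * indicator (bk_I (Suc n)) x + ennreal ((?v x)\<^sup>2) * indicator (bk_I (Suc n)) x \<partial>bk_measure \<alpha>)"
        by (intro nn_integral_cong) (simp add: cmod_power2 distrib_right)
      also have "\<dots> = ?U n +
          ?V n"
        by (rule nn_integral_add) measurable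
      also have "\<dots> \<le> ennreal (\<bar>C1\<bar> * ?w n) + ennreal (\<bar>C2\<bar> * ?w n)"
        using w by (intro add_mono order_trans[OF C1] order_trans[OF C2] ennreal_leI mult_right_mono) auto
      also have "\<dots> = ennreal (?w n * (\<bar>C1\<bar> + \<bar>C2\<bar>))"
        using w by (simp add: distrib_left mult.commute flip: ennreal_plus)
      finally have "ennreal (1 / ?w n) * ?N n \<le> ennreal (1 / ?w n) * ennreal (?w n * (\<bar>C1\<bar> + \<bar>C2\<bar>))"
        by (rule mult_left_mono) simp
      also have "\<dots> = ennreal (\<bar>C1\<bar> + \<bar>C2\<bar>)"
        using w by (simp flip: ennreal_mult')
      finally show ?thesis .
    qed
    then have "(SUP n. ennreal (1 / ?w n) * ?N n) \<le> ennreal (\<bar>C1\<bar> + \<bar>C2\<bar>)"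
      by (intro SUP_least)
    also have "\<dots> < \<infinity>" by simp
    finally show ?thesis unfolding amalgam_L2_linf_def using fm by simp
  qed
  have iii_i: "\<exists>\<delta>>0. ?D \<delta> < \<infinity>"
    if iii: "amalgam_L2_linf \<alpha> f"
  \<comment> \<open>With \<delta> = 1/2 the closed interval [0, \<delta>] fits into the half-open
    first cell [0, 1).\<close>
  proof (intro exI[of _ "1/2 :: real"] conjI)
    let ?I = "?N 0"
    have "ennreal (1 / ?w 0) * ?I \<le> (SUP n. ennreal (1 / ?w n) * ?N n)"
      by (rule SUP_upper) simp
    also have "\<dots> < \<infinity>" using iii by (simp add: amalgam_L2_linf_def)
    finally have "ennreal (1 / ?w 0) * ?I < \<infinity>" .
    moreover have "ennreal (1 / ?w 0) \<noteq> 0" using bk_omega_Suc_pos[of 0] by simp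
    ultimately have I: "?I < \<infinity>" by (auto simp: ennreal_mult_less_top)
    have "?D (1/2) \<le> ?I"
      by (intro nn_integral_mono mult_left_mono) (auto simp: indicator_def bk_I_Suc)
    with I show "?D (1/2) < \<infinity>" by (rule le_less_trans[rotated])
  qed simp
  show ?thesis using i_ii ii_iii iii_i by blast
qed

end
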